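(* Let $\ell>0$ and $B(x)=\operatorname{diag}(\beta_1(x),\dots,\beta_n(x))$ with $\beta_k\in L^1([0,\ell];\mathbb R)$ each having constant nonzero sign on $[0,\ell]$. Let the boundary conditions $Cy(0)+Dy(\ell)=0$ be regular. (i) The system of root vectors of $L_U(0)$ is complete in $\mathfrak H$. (ii) Assume in addition that $\beta_k,1/\beta_k\in L^\infty[0,\ell]$, that for some $n_-\in\{0,\dots,n\}$, $\beta_1\le\dots\le\beta_{n_-}<0<\beta_{n_-+1}\le\dots\le\beta_n$ on $[0,\ell]$, that there is $\theta>0$ such that for each $k\le n-1$ either $\beta_k\equiv\beta_{k+1}$ or $\beta_k(x)+\theta<\beta_{k+1}(x)$ on $[0,\ell]$, and let $Q\in L^1([0,\ell];\mathbb C^{n\times n})$. Then there exist $C_0,M>0$ and $z_1,z_2,z_3\in\mathbb C\setminus\mathbb R$ such that the origin is an interior point of the triangle with vertices $z_1,z_2,z_3$ and $$|\Delta_Q(\lambda)|\ge C_0\big(e^{-\operatorname{Im}\lambda\cdot b_-}+e^{-\operatorname{Im}\lambda\cdot b_+}\big),\qquad|\lambda|>M,\ \arg\lambda=\arg z_k,\ k=1,2,3,$$ and the system of root vectors of $L_U(Q)$ is complete in $\mathfrak H$.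
   Context: $\rho_k(x)=\int_0^x\beta_k$, $b_k=\rho_k(\ell)$, $b_-=\sum_{b_k<0}b_k$, $b_+=\sum_{b_k>0}b_k$. $\mathfrak H=\bigoplus_kL^2_{|\beta_k|}[0,\ell]$ with $(f,g)_{\mathfrak H}=\int_0^\ell\langle|B|f,g\rangle dx$. For $C,D\in\mathbb C^{n\times n}$ with $\operatorname{rank}(C\ D)=n$, $L_U(Q)y=-iB^{-1}(y'+Qy)$ on $\{y\in AC([0,\ell];\mathbb C^n):-iB^{-1}(y'+Qy)\in\mathfrak H,\ Cy(0)+Dy(\ell)=0\}$. $\Delta_Q(\lambda)=\det(C+D\Phi_Q(\ell,\lambda))$ where $\Phi_Q$ is the fundamental matrix of $-iB^{-1}(y'+Qy)=\lambda y$ with $\Phi_Q(0,\lambda)=I_n$. With $P_+=\operatorname{diag}(p_k^+)$, $p_k^+=1$ iff $b_k>0$, $P_-=I-P_+$, the boundary conditions are regular if $\det(CP_-+DP_+)\ne0\ne\det(CP_++DP_-)$. A system of root vectors is the union over the (distinct) eigenvalues of bases of the corresponding root subspaces; it is complete if its closed linear span is $\mathfrak H$. *)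

theory Defs
  imports "HOL-Analysis.Analysis" "Jordan_Normal_Form.DL_Rank"
begin

text \<open>Conventions: indices are 0-based, k < n.  The coefficient functions are
  beta :: nat => real => real (beta k is beta_{k+1} of the paper), the potential is
  Q :: nat => nat => real => complex (entry (k,j)).  Elements of the Hilbert space H are
  functions f :: nat => real => complex (component k is f k), compared only up to a.e.
  equality through the (semi)norm hnorm.  All integrals are Lebesgue integrals.\<close>

definition Hsp :: "nat \<Rightarrow> real \<Rightarrow> (nat \<Rightarrow> real \<Rightarrow> real) \<Rightarrow> (nat \<Rightarrow> real \<Rightarrow> complex) set" where
  "Hsp n l beta = {f. \<forall>k<n. f k \<in> borel_measurable (lebesgue_on {0..l}) \<and>
       integrable (lebesgue_on {0..l}) (\<lambda>x. \<bar>beta k x\<bar> * (cmod (f k x))\<^sup>2)}"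

definition hnorm :: "nat \<Rightarrow> real \<Rightarrow> (nat \<Rightarrow> real \<Rightarrow> real) \<Rightarrow> (nat \<Rightarrow> real \<Rightarrow> complex) \<Rightarrow> real" where
  "hnorm n l beta f = sqrt (\<Sum>k<n. integral\<^sup>L (lebesgue_on {0..l}) (\<lambda>x. \<bar>beta k x\<bar> * (cmod (f k x))\<^sup>2))"

text \<open>Graph of L_U(Q): pairs (u, f) with u in the domain and L_U(Q) u = f.  The condition
  y in AC, -i B^{-1}(y' + Q y) = f is written in the equivalent integrated form
  y(x) = y(0) + int_0^x (i B f - Q y), with the integrand in L^1.\<close>

definition Lgraph :: "nat \<Rightarrow> real \<Rightarrow> (nat \<Rightarrow> real \<Rightarrow> real) \<Rightarrow> (nat \<Rightarrow> nat \<Rightarrow> real \<Rightarrow> complex)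
     \<Rightarrow> complex mat \<Rightarrow> complex mat
     \<Rightarrow> ((nat \<Rightarrow> real \<Rightarrow> complex) \<times> (nat \<Rightarrow> real \<Rightarrow> complex)) set" where
  "Lgraph n l beta Q C D = {(u, f). u \<in> Hsp n l beta \<and> f \<in> Hsp n l beta \<and>
     (\<exists>y :: nat \<Rightarrow> real \<Rightarrow> complex.
        (\<forall>k<n. integrable (lebesgue_on {0..l})
                 (\<lambda>t. \<i> * of_real (beta k t) * f k t - (\<Sum>j<n. Q k j t * y j t)) \<and>
               (\<forall>x\<in>{0..l}. y k x = y k 0 + integral\<^sup>L (lebesgue_on {0..x})
                 (\<lambda>t. \<i> * of_real (beta k t) * f k t - (\<Sum>j<n. Q k j t * y j t)))) \<and>
        C *\<^sub>v vec n (\<lambda>j. y j 0) + D *\<^sub>v vec n (\<lambda>j. y j l) = 0\<^sub>v n \<and>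
        hnorm n l beta (\<lambda>k x. u k x - y k x) = 0)}"

primrec root_of :: "nat \<Rightarrow> real \<Rightarrow> (nat \<Rightarrow> real \<Rightarrow> real) \<Rightarrow> (nat \<Rightarrow> nat \<Rightarrow> real \<Rightarrow> complex)
     \<Rightarrow> complex mat \<Rightarrow> complex mat \<Rightarrow> complex \<Rightarrow> nat \<Rightarrow> (nat \<Rightarrow> real \<Rightarrow> complex) \<Rightarrow> bool" where
  "root_of n l beta Q C D lam 0 u = (hnorm n l beta u = 0)"
| "root_of n l beta Q C D lam (Suc m) u =
     (\<exists>f. (u, f) \<in> Lgraph n l beta Q C D \<and>
          root_of n l beta Q C D lam m (\<lambda>k x. f k x - lam * u k x))"

definition root_vectors :: "nat \<Rightarrow> real \<Rightarrow> (nat \<Rightarrow> real \<Rightarrow> real) \<Rightarrow> (nat \<Rightarrow> nat \<Rightarrow> real \<Rightarrow> complex)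
     \<Rightarrow> complex mat \<Rightarrow> complex mat \<Rightarrow> (nat \<Rightarrow> real \<Rightarrow> complex) set" where
  "root_vectors n l beta Q C D =
     {u \<in> Hsp n l beta. \<exists>lam m. root_of n l beta Q C D lam m u}"

definition roots_complete :: "nat \<Rightarrow> real \<Rightarrow> (nat \<Rightarrow> real \<Rightarrow> real) \<Rightarrow> (nat \<Rightarrow> nat \<Rightarrow> real \<Rightarrow> complex)
     \<Rightarrow> complex mat \<Rightarrow> complex mat \<Rightarrow> bool" where
  "roots_complete n l beta Q C D \<longleftrightarrow>
     (\<forall>f\<in>Hsp n l beta. \<forall>\<epsilon>>0. \<exists>(N::nat) (c::nat \<Rightarrow> complex) v.
        (\<forall>j<N. v j \<in> root_vectors n l beta Q C D) \<and>
        hnorm n l beta (\<lambda>k x. f k x - (\<Sum>j<N. c j * v j k x)) < \<epsilon>)"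

text \<open>Fundamental matrix Phi_Q(x, lam): Phi' = (i lam B - Q) Phi, Phi(0) = I (integrated form).\<close>

definition fund_solves :: "nat \<Rightarrow> real \<Rightarrow> (nat \<Rightarrow> real \<Rightarrow> real) \<Rightarrow> (nat \<Rightarrow> nat \<Rightarrow> real \<Rightarrow> complex)
     \<Rightarrow> complex \<Rightarrow> (real \<Rightarrow> nat \<Rightarrow> nat \<Rightarrow> complex) \<Rightarrow> bool" where
  "fund_solves n l beta Q lam Phi \<longleftrightarrow>
     (\<forall>k<n. \<forall>j<n.
        integrable (lebesgue_on {0..l})
          (\<lambda>t. \<i> * lam * of_real (beta k t) * Phi t k j - (\<Sum>m<n. Q k m t * Phi t m j)) \<and>
        (\<forall>x\<in>{0..l}. Phi x k j = (if k = j then 1 else 0) + integral\<^sup>L (lebesgue_on {0..x})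
          (\<lambda>t. \<i> * lam * of_real (beta k t) * Phi t k j - (\<Sum>m<n. Q k m t * Phi t m j))))"

definition Phi_end :: "nat \<Rightarrow> real \<Rightarrow> (nat \<Rightarrow> real \<Rightarrow> real) \<Rightarrow> (nat \<Rightarrow> nat \<Rightarrow> real \<Rightarrow> complex)
     \<Rightarrow> complex \<Rightarrow> complex mat" where
  "Phi_end n l beta Q lam = (THE M. M \<in> carrier_mat n n \<and>
      (\<exists>Phi. fund_solves n l beta Q lam Phi \<and> (\<forall>i<n. \<forall>j<n. M $$ (i, j) = Phi l i j)))"

definition Delta :: "nat \<Rightarrow> real \<Rightarrow> (nat \<Rightarrow> real \<Rightarrow> real) \<Rightarrow> (nat \<Rightarrow> nat \<Rightarrow> real \<Rightarrow> complex)
     \<Rightarrow> complex mat \<Rightarrow> complex mat \<Rightarrow> complex \<Rightarrow> complex" where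
  "Delta n l beta Q C D lam = det (C + D * Phi_end n l beta Q lam)"

definition bk :: "real \<Rightarrow> (nat \<Rightarrow> real \<Rightarrow> real) \<Rightarrow> nat \<Rightarrow> real" where
  "bk l beta k = integral\<^sup>L (lebesgue_on {0..l}) (beta k)"

definition bminus :: "nat \<Rightarrow> real \<Rightarrow> (nat \<Rightarrow> real \<Rightarrow> real) \<Rightarrow> real" where
  "bminus n l beta = (\<Sum>k\<in>{k. k < n \<and> bk l beta k < 0}. bk l beta k)"

definition bplus :: "nat \<Rightarrow> real \<Rightarrow> (nat \<Rightarrow> real \<Rightarrow> real) \<Rightarrow> real" where
  "bplus n l beta = (\<Sum>k\<in>{k. k < n \<and> bk l beta k > 0}. bk l beta k)"

definition Pplus :: "nat \<Rightarrow> real \<Rightarrow> (nat \<Rightarrow> real \<Rightarrow> real) \<Rightarrow> complex mat" where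
  "Pplus n l beta = mat n n (\<lambda>(i, j). if i = j \<and> bk l beta i > 0 then 1 else 0)"

definition Pminus :: "nat \<Rightarrow> real \<Rightarrow> (nat \<Rightarrow> real \<Rightarrow> real) \<Rightarrow> complex mat" where
  "Pminus n l beta = 1\<^sub>m n - Pplus n l beta"

definition regular_bc :: "nat \<Rightarrow> real \<Rightarrow> (nat \<Rightarrow> real \<Rightarrow> real) \<Rightarrow> complex mat \<Rightarrow> complex mat \<Rightarrow> bool" where
  "regular_bc n l beta C D \<longleftrightarrow>
     det (C * Pminus n l beta + D * Pplus n l beta) \<noteq> 0 \<and>
     det (C * Pplus n l beta + D * Pminus n l beta) \<noteq> 0"

definition CD_mat :: "nat \<Rightarrow> complex mat \<Rightarrow> complex mat \<Rightarrow> complex mat" where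
  "CD_mat n C D = mat n (2 * n) (\<lambda>(i, j). if j < n then C $$ (i, j) else D $$ (i, j - n))"

end

theory Submission
  imports Defs "HOL-Complex_Analysis.Complex_Analysis"
begin

text \<open>
  Suppose that the root vectors span a subspace at positive distance from some \<open>f0\<close>; separate them by
  a bounded functional \<open>\<phi>\<close>.  Cramer's rule writes the resolvent as an entire family divided by the
  characteristic determinant.  At a zero of order \<open>m\<close> of the determinant the first \<open>m\<close> Taylor coefficients
  of the family are root vectors, so \<open>F lam = \<phi> (R(lam) f)\<close> is entire.  Regularity bounds the resolvent
  for large \<open>\<bar>Im lam\<bar>\<close>: by variation of constants, each component is integrated from the endpoint
  where its exponential decays, and the potential is negligible because the integral of an \<open>L\<^sup>1\<close> function
  against \<open>exp (- \<kappa> \<bar>\<rho> x - \<rho> t\<bar>)\<close> tends to 0 uniformly in \<open>x\<close>.  A normal family argument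
  bounds \<open>F\<close> in the remaining strip, so \<open>F\<close> is constant by Liouville's theorem, and since
  \<open>- lam R(lam) f\<close> tends to \<open>f\<close> along the imaginary axis for \<open>f\<close> in a dense set, \<open>\<phi>\<close> vanishes.

  The lower bound for the determinant comes from the same estimate: up to a factor bounded away
  from 0 it is the determinant of the map from initial data to the boundary data on which each
  component decays, and this determinant satisfies a scalar equation of Liouville type.
\<close>

section \<open>Absolutely continuous functions\<close>

text \<open>The moduli of the exponentials \<open>exp (\<i> * lam * rho k x)\<close> depend on
  \<open>Im lam\<close> only, because \<open>rho k\<close> is real. All estimates are therefore made
  on horizontal lines, uniformly in \<open>Re lam\<close>, instead of as asymptotic expansions in
  sectors. A ray off the real axis leaves every horizontal strip, so the estimate on rays is a
  special case. The coefficients are merely integrable; solutions are then only absolutely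
  continuous, and every differential equation is kept as an integral equation. Holomorphy of
  function-valued maps is never defined: solutions are tested with linear functionals bounded in the
  uniform norm on continuous functions. The boundary forms are of this kind although they are in
  general not bounded in the Hilbert space, and so is the restriction of the separating functional.
  One theorem on scalar functions thus serves the entries of the determinant, the coefficients in
  Cramer's rule and the resolvent. Changing the signs of \<open>lam\<close> and of all
  \<open>beta k\<close> together leaves the homogeneous equation unchanged, so only one half plane
  has to be estimated.\<close>

lemma lebesgue_on_absint_iff:
  fixes f :: "real \<Rightarrow> 'a::euclidean_space"
  shows "integrable (lebesgue_on {a..b}) f \<longleftrightarrow> f absolutely_integrable_on {a..b}"
  unfolding set_integrable_def
  by (subst integrable_restrict_space) auto

lemma absint_integral_eq:
  fixes f :: "real \<Rightarrow> 'a::euclidean_space"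
  assumes "f absolutely_integrable_on {a..b}"
  shows "integral\<^sup>L (lebesgue_on {a..b}) f = integral {a..b} f"
  using assms by (intro lebesgue_integral_eq_integral) (auto simp: lebesgue_on_absint_iff)

lemma absint_subset:
  fixes f :: "real \<Rightarrow> 'a::euclidean_space"
  assumes "f absolutely_integrable_on {a..b}" "a \<le> c" "d \<le> b"
  shows "f absolutely_integrable_on {c..d}"
  using assms by (intro absolutely_integrable_on_subinterval[OF assms(1)]) auto

lemmas absint_integrable = set_lebesgue_integral_eq_integral(1)

lemma absint_norm:
  fixes f :: "real \<Rightarrow> 'a::euclidean_space"
  shows "f absolutely_integrable_on S \<Longrightarrow> (\<lambda>t. norm (f t)) absolutely_integrable_on S"
  by (drule absolutely_integrable_norm) (simp add: o_def)

lemma absint_mult_cont: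
  fixes f g :: "real \<Rightarrow> 'a::{real_normed_field,euclidean_space}"
  assumes "continuous_on {a..b} f" "g absolutely_integrable_on {a..b}"
  shows "(\<lambda>x. f x * g x) absolutely_integrable_on {a..b}"
proof (rule absolutely_integrable_bounded_measurable_product[OF bilinear_times])
  show "f \<in> borel_measurable (lebesgue_on {a..b})"
    using assms(1) by (intro continuous_imp_measurable_on_sets_lebesgue) auto
  show "bounded (f ` {a..b})"
    using assms(1) by (intro compact_imp_bounded compact_continuous_image) auto
qed (use assms in auto)

lemma absint_mult_cont2:
  fixes f g :: "real \<Rightarrow> 'a::{real_normed_field,euclidean_space}"
  assumes "continuous_on {a..b} f" "g absolutely_integrable_on {a..b}"
  shows "(\<lambda>x. g x * f x) absolutely_integrable_on {a..b}"
  using absint_mult_cont[OF assms] by (simp add: mult.commute)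

lemma integral_Icc_if_le:
  fixes g :: "real \<Rightarrow> 'a::euclidean_space"
  assumes "0 \<le> s" "s \<le> x"
  shows "integral {0..x} (\<lambda>t. if t \<le> s then g t else 0) = integral {0..s} g"
proof -
  have "integral {0..x} (\<lambda>t. if t \<le> s then g t else 0)
      = integral {0..x} (\<lambda>t. if t \<in> {..s} then g t else 0)"
    by (rule integral_cong) auto
  also have "\<dots> = integral ({..s} \<inter> {0..x}) g" by (rule integral_restrict_Int)
  also have "{..s} \<inter> {0..x} = {0..s}" using assms by auto
  finally show ?thesis .
qed

lemma integral_Icc_if_less:
  fixes g :: "real \<Rightarrow> 'a::euclidean_space"
  assumes "0 \<le> s" "s \<le> x"
  shows "integral {0..x} (\<lambda>t. if t < s then g t else 0) = integral {0..s} g"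
proof -
  have "integral {0..x} (\<lambda>t. if t < s then g t else 0) = integral {0..x} (\<lambda>t. if t \<le> s then g t else 0)"
    by (rule integral_spike[of "{s}"]) auto
  with integral_Icc_if_le[OF assms] show ?thesis by simp
qed

text \<open>The square is cut along its diagonal, and on each triangle the smaller variable is
  integrated first. This is integration by parts for integrable densities and carries the product
  rule \<open>ac_mult\<close>.\<close>

lemma integral_mult_Fubini:
  fixes f g :: "real \<Rightarrow> 'a::{real_normed_field,euclidean_space}"
  assumes f: "f absolutely_integrable_on {0..x}" and g: "g absolutely_integrable_on {0..x}"
  shows "integral {0..x} f * integral {0..x} g =
         integral {0..x} (\<lambda>t. f t * integral {0..t} g + integral {0..t} f * g t)"
proof -
  let ?M = "lebesgue_on {0..x}"
  interpret M: finite_measure ?M by (rule finite_measure_lebesgue_on) auto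
  interpret P: pair_sigma_finite ?M ?M ..
  have fM: "integrable ?M f" and gM: "integrable ?M g" using f g by (auto simp: lebesgue_on_absint_iff)
  have [measurable]: "f \<in> borel_measurable ?M" "g \<in> borel_measurable ?M" using fM gM by auto
  have id[measurable]: "(\<lambda>x. x) \<in> borel_measurable ?M"
    by (intro continuous_imp_measurable_on_sets_lebesgue) (auto intro: continuous_intros)
  define p where "p = (\<lambda>z::real\<times>real. f (fst z) * g (snd z))"
  have pm[measurable]: "p \<in> borel_measurable (?M \<Otimes>\<^sub>M ?M)" unfolding p_def by measurable
  have pint: "integrable (?M \<Otimes>\<^sub>M ?M) p"
  proof (rule P.Fubini_integrable)
    show "integrable ?M (\<lambda>s. \<integral>t. norm (p (s, t)) \<partial>?M)"
      unfolding p_def using fM by (simp add: norm_mult)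
    show "AE s in ?M. integrable ?M (\<lambda>t. p (s, t))"
      unfolding p_def using gM by simp
  qed simp
  \<comment> \<open>Both factors carry the Lebesgue sigma-algebra, so the measurability of the two
    triangles is obtained by comparing the coordinate projections, which are measurable by
    \<open>id\<close>.\<close>
  have S[measurable]: "Measurable.pred (?M \<Otimes>\<^sub>M ?M) (\<lambda>z. snd z \<le> fst z)"
    "Measurable.pred (?M \<Otimes>\<^sub>M ?M) (\<lambda>z. fst z < snd z)"
  proof -
    have a: "(\<lambda>z. fst z) \<in> borel_measurable (?M \<Otimes>\<^sub>M ?M)" by measurable
    have b: "(\<lambda>z. snd z) \<in> borel_measurable (?M \<Otimes>\<^sub>M ?M)" by measurable
    show "Measurable.pred (?M \<Otimes>\<^sub>M ?M) (\<lambda>z. snd z \<le> fst z)"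
      "Measurable.pred (?M \<Otimes>\<^sub>M ?M) (\<lambda>z. fst z < snd z)"
      using borel_measurable_le[OF b a] borel_measurable_less[OF a b] by (auto simp: pred_def)
  qed
  define p1 where "p1 = (\<lambda>z::real\<times>real. if snd z \<le> fst z then p z else 0)"
  define p2 where "p2 = (\<lambda>z::real\<times>real. if fst z < snd z then p z else 0)"
  have p1: "integrable (?M \<Otimes>\<^sub>M ?M) p1"
    by (rule Bochner_Integration.integrable_bound[OF pint]) (auto simp: p1_def)
  have p2: "integrable (?M \<Otimes>\<^sub>M ?M) p2"
    by (rule Bochner_Integration.integrable_bound[OF pint]) (auto simp: p2_def)
  have sub: "f absolutely_integrable_on {0..s}" "g absolutely_integrable_on {0..s}"
    if "s \<in> {0..x}" for s
    using absint_subset[OF f, of 0 s] absint_subset[OF g, of 0 s] that by auto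
  have restr: "(\<integral>t. (if t \<le> s then h t else 0) \<partial>?M) = integral {0..s} h"
    "(\<integral>t. (if t < s then h t else 0) \<partial>?M) = integral {0..s} h"
    if "s \<in> {0..x}" and h: "integrable ?M h" for s and h :: "real \<Rightarrow> 'a"
  proof -
    have [measurable]: "h \<in> borel_measurable ?M" using h by auto
    have a: "integrable ?M (\<lambda>t. if t \<le> s then h t else 0)"
      by (rule Bochner_Integration.integrable_bound[OF h]) auto
    have b: "integrable ?M (\<lambda>t. if t < s then h t else 0)"
      by (rule Bochner_Integration.integrable_bound[OF h]) auto
    show "(\<integral>t. (if t \<le> s then h t else 0) \<partial>?M) = integral {0..s} h"
      using that a by (subst lebesgue_integral_eq_integral) (auto intro: integral_Icc_if_le)
    show "(\<integral>t. (if t < s then h t else 0) \<partial>?M) = integral {0..s} h"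
      using that b by (subst lebesgue_integral_eq_integral) (auto intro: integral_Icc_if_less)
  qed
  have G: "continuous_on {0..x} (\<lambda>s. integral {0..s} g)"
    and F: "continuous_on {0..x} (\<lambda>s. integral {0..s} f)"
    using f g by (auto intro!: indefinite_integral_continuous_1 absint_integrable)
  have ai1: "(\<lambda>t. f t * integral {0..t} g) absolutely_integrable_on {0..x}"
    by (rule absint_mult_cont2[OF G f])
  have ai2: "(\<lambda>t. integral {0..t} f * g t) absolutely_integrable_on {0..x}"
    by (rule absint_mult_cont[OF F g])
  have "integral {0..x} f * integral {0..x} g = (\<integral>s. (\<integral>t. p (s,t) \<partial>?M) \<partial>?M)"
    unfolding p_def absint_integral_eq[OF f, symmetric] absint_integral_eq[OF g, symmetric] by simp
  also have "\<dots> = integral\<^sup>L (?M \<Otimes>\<^sub>M ?M) p" by (rule P.integral_fst'[OF pint])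
  also have "\<dots> = integral\<^sup>L (?M \<Otimes>\<^sub>M ?M) (\<lambda>z. p1 z + p2 z)"
    by (rule Bochner_Integration.integral_cong) (auto simp: p1_def p2_def)
  also have "\<dots> = integral\<^sup>L (?M \<Otimes>\<^sub>M ?M) p1 + integral\<^sup>L (?M \<Otimes>\<^sub>M ?M) p2"
    by (rule Bochner_Integration.integral_add[OF p1 p2])
  also have "integral\<^sup>L (?M \<Otimes>\<^sub>M ?M) p1 = (\<integral>s. (\<integral>t. p1 (s,t) \<partial>?M) \<partial>?M)"
    by (rule P.integral_fst'[OF p1, symmetric])
  also have "\<dots> = (\<integral>s. f s * integral {0..s} g \<partial>?M)"
  proof (rule Bochner_Integration.integral_cong[OF refl])
    fix s assume s: "s \<in> space ?M"
    have "(\<integral>t. p1 (s,t) \<partial>?M) = (\<integral>t. f s * (if t \<le> s then g t else 0) \<partial>?M)"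
      by (rule Bochner_Integration.integral_cong) (auto simp: p1_def p_def)
    then show "(\<integral>t. p1 (s,t) \<partial>?M) = f s * integral {0..s} g" using restr(1)[of s g] s gM by simp
  qed
  also have "integral\<^sup>L (?M \<Otimes>\<^sub>M ?M) p2 = (\<integral>t. (\<integral>s. p2 (s,t) \<partial>?M) \<partial>?M)"
    using P.integral_snd[of "\<lambda>x y. p2 (x,y)"] p2 by simp
  also have "\<dots> = (\<integral>t. integral {0..t} f * g t \<partial>?M)"
  proof (rule Bochner_Integration.integral_cong[OF refl])
    fix t assume t: "t \<in> space ?M"
    have "(\<integral>s. p2 (s,t) \<partial>?M) = (\<integral>s. (if s < t then f s else 0) * g t \<partial>?M)"
      by (rule Bochner_Integration.integral_cong) (auto simp: p2_def p_def)
    then show "(\<integral>s. p2 (s,t) \<partial>?M) = integral {0..t} f * g t" using restr(2)[of t f] t fM by simp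
  qed
  finally show ?thesis
    unfolding absint_integral_eq[OF ai1] absint_integral_eq[OF ai2]
    by (simp only: Henstock_Kurzweil_Integration.integral_add[OF absint_integrable[OF ai1]
          absint_integrable[OF ai2]])
qed

text \<open>\<open>ac l f g\<close>: \<open>f\<close> is absolutely continuous on \<open>{0..l}\<close> with a.e. derivative \<open>g\<close>.\<close>

definition ac :: "real \<Rightarrow> (real \<Rightarrow> 'a) \<Rightarrow> (real \<Rightarrow> 'a::euclidean_space) \<Rightarrow> bool" where
  "ac l f g \<longleftrightarrow> g absolutely_integrable_on {0..l} \<and> (\<forall>x\<in>{0..l}. f x = f 0 + integral {0..x} g)"

lemma acI:
  assumes "g absolutely_integrable_on {0..l}" "\<And>x. 0 \<le> x \<Longrightarrow> x \<le> l \<Longrightarrow> f x = c + integral {0..x} g"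
  shows "ac l f g"
proof (cases "0 \<le> l")
  case True
  from assms(2)[of 0] True have "f 0 = c" by simp
  then have "\<forall>x\<in>{0..l}. f x = f 0 + integral {0..x} g" using assms(2) by simp
  with assms(1) show ?thesis unfolding ac_def by blast
qed (use assms in \<open>simp add: ac_def\<close>)

lemma ac_absint: "ac l f g \<Longrightarrow> g absolutely_integrable_on {0..l}" unfolding ac_def by blast

lemma ac_eq: "ac l f g \<Longrightarrow> 0 \<le> x \<Longrightarrow> x \<le> l \<Longrightarrow> f x = f 0 + integral {0..x} g"
  unfolding ac_def by (drule conjunct2, erule bspec) simp

lemma ac_cong:
  assumes "ac l f g" "\<And>x. 0 \<le> x \<Longrightarrow> x \<le> l \<Longrightarrow> f x = f' x" "\<And>x. 0 \<le> x \<Longrightarrow> x \<le> l \<Longrightarrow> g x = g' x"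
  shows "ac l f' g'"
proof (rule acI)
  show "g' absolutely_integrable_on {0..l}"
  proof -
    have "g absolutely_integrable_on {0..l} \<longleftrightarrow> g' absolutely_integrable_on {0..l}"
      by (rule set_integrable_cong) (use assms(3) in auto)
    then show ?thesis using ac_absint[OF assms(1)] by simp
  qed
  fix x assume x: "0 \<le> x" "x \<le> l"
  have "integral {0..x} g = integral {0..x} g'" using assms(3) x by (intro integral_cong) auto
  with ac_eq[OF assms(1) x] assms(2)[OF x] show "f' x = f 0 + integral {0..x} g'" by simp
qed

lemma ac_deriv_cong:
  assumes "ac l f g" "\<And>x. 0 \<le> x \<Longrightarrow> x \<le> l \<Longrightarrow> g x = g' x"
  shows "ac l f g'"
  using ac_cong[OF assms(1) refl assms(2)] .

lemma ac_integrable: "ac l f g \<Longrightarrow> 0 \<le> x \<Longrightarrow> x \<le> l \<Longrightarrow> g integrable_on {0..x}"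
  using absint_subset[OF ac_absint, of l f g 0 x] by (auto intro: absint_integrable)

lemma ac_absint_Icc: "ac l f g \<Longrightarrow> 0 \<le> s \<Longrightarrow> x \<le> l \<Longrightarrow> g absolutely_integrable_on {s..x}"
  using absint_subset[OF ac_absint, of l f g s x] by auto

lemma ac_diff_eq:
  assumes "ac l f g" "0 \<le> s" "s \<le> x" "x \<le> l"
  shows "f x - f s = integral {s..x} g"
proof -
  have "integral {0..s} g + integral {s..x} g = integral {0..x} g"
    using assms ac_integrable[OF assms(1), of x]
      by (intro Henstock_Kurzweil_Integration.integral_combine) auto
  with ac_eq[OF assms(1), of x] ac_eq[OF assms(1), of s] assms show ?thesis by (simp add: algebra_simps)
qed

lemma ac_continuous: "ac l f g \<Longrightarrow> continuous_on {0..l} f"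
proof -
  assume a: "ac l f g"
  have "continuous_on {0..l} (\<lambda>x. f 0 + integral {0..x} g)"
    using a by (intro continuous_intros indefinite_integral_continuous_1)
      (auto intro: absint_integrable ac_absint)
  moreover have "continuous_on {0..l} (\<lambda>x. f 0 + integral {0..x} g) \<longleftrightarrow> continuous_on {0..l} f"
    by (intro continuous_on_cong refl sym[OF ac_eq[OF a]]) auto
  ultimately show ?thesis by blast
qed

lemma ac_const [simp]: "ac l (\<lambda>_. c) (\<lambda>_. 0)"
  by (rule acI[of _ _ _ c]) auto

lemma ac_integral:
  "g absolutely_integrable_on {0..l} \<Longrightarrow> ac l (\<lambda>x. c + integral {0..x} g) g"
  by (rule acI) auto

lemma ac_add:
  assumes "ac l f f'" "ac l g g'"
  shows "ac l (\<lambda>x. f x + g x) (\<lambda>x. f' x + g' x)"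
proof (rule acI[of _ _ _ "f 0 + g 0"])
  show "(\<lambda>x. f' x + g' x) absolutely_integrable_on {0..l}"
    using assms[THEN ac_absint] by auto
  fix x assume x: "0 \<le> x" "x \<le> l"
  show "f x + g x = f 0 + g 0 + integral {0..x} (\<lambda>x. f' x + g' x)"
    using ac_eq[OF assms(1) x] ac_eq[OF assms(2) x] ac_integrable[OF assms(1) x]
        ac_integrable[OF assms(2) x]
    by (simp add: Henstock_Kurzweil_Integration.integral_add algebra_simps)
qed

lemma ac_linear:
  assumes "ac l f f'" "bounded_linear h"
  shows "ac l (\<lambda>x. h (f x)) (\<lambda>x. h (f' x))"
proof (rule acI[of _ _ _ "h (f 0)"])
  interpret bounded_linear h by fact
  show "(\<lambda>x. h (f' x)) absolutely_integrable_on {0..l}"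
    using absolutely_integrable_linear[OF ac_absint[OF assms(1)] assms(2)] by (simp add: o_def)
  fix x assume x: "0 \<le> x" "x \<le> l"
  show "h (f x) = h (f 0) + integral {0..x} (\<lambda>x. h (f' x))"
    using ac_eq[OF assms(1) x] integral_linear[OF ac_integrable[OF assms(1) x] assms(2)]
    by (simp add: add o_def)
qed

lemma ac_cmult:
  fixes f :: "real \<Rightarrow> 'a::{real_normed_field,euclidean_space}"
  shows "ac l f f' \<Longrightarrow> ac l (\<lambda>x. c * f x) (\<lambda>x. c * f' x)"
  by (erule ac_linear) (rule bounded_linear_mult_right)

lemma ac_minus: "ac l f f' \<Longrightarrow> ac l (\<lambda>x. - f x) (\<lambda>x. - f' x)"
  by (erule ac_linear) (rule bounded_linear_minus[OF bounded_linear_ident])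

lemma ac_diff:
  assumes "ac l f f'" "ac l g g'"
  shows "ac l (\<lambda>x. f x - g x) (\<lambda>x. f' x - g' x)"
  using ac_add[OF assms(1) ac_minus[OF assms(2)]] by simp

lemma ac_sum:
  assumes "\<And>i. i \<in> I \<Longrightarrow> ac l (f i) (f' i)"
  shows "ac l (\<lambda>x. \<Sum>i\<in>I. f i x) (\<lambda>x. \<Sum>i\<in>I. f' i x)"
proof (cases "finite I")
  case True
  then show ?thesis using assms
    by (induction I rule: finite_induct) (auto intro: ac_add)
qed simp

text \<open>Once both functions are written as initial value plus integral, the only nonlinear
  contribution is the product of the two integrals, and \<open>integral_mult_Fubini\<close> expands
  it.\<close>

lemma ac_mult:
  fixes f g :: "real \<Rightarrow> 'a::{real_normed_field,euclidean_space}"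
  assumes "ac l f f'" "ac l g g'"
  shows "ac l (\<lambda>x. f x * g x) (\<lambda>x. f' x * g x + f x * g' x)"
proof (rule acI[of _ _ _ "f 0 * g 0"])
  note absint = ac_absint[OF assms(1)] ac_absint[OF assms(2)]
  show "(\<lambda>x. f' x * g x + f x * g' x) absolutely_integrable_on {0..l}"
    using absint_mult_cont[OF ac_continuous[OF assms(1)] absint(2)]
        absint_mult_cont2[OF ac_continuous[OF assms(2)] absint(1)]
    by auto
  fix x assume x: "0 \<le> x" "x \<le> l"
  have fx: "f' absolutely_integrable_on {0..x}" and gx: "g' absolutely_integrable_on {0..x}"
    using absint_subset[OF absint(1), of 0 x] absint_subset[OF absint(2), of 0 x] x by auto
  have G: "continuous_on {0..x} (\<lambda>s. integral {0..s} g')"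
    and F: "continuous_on {0..x} (\<lambda>s. integral {0..s} f')"
    using fx gx by (auto intro!: indefinite_integral_continuous_1 absint_integrable)
  have i: "(\<lambda>t. f' t * integral {0..t} g' + integral {0..t} f' * g' t) integrable_on {0..x}"
    using absint_mult_cont[OF F gx] absint_mult_cont2[OF G fx]
    by (intro absint_integrable) auto
  have fi: "f' integrable_on {0..x}" "g' integrable_on {0..x}"
    using fx gx by (auto intro: absint_integrable)
  have "integral {0..x} (\<lambda>x. f' x * g x + f x * g' x) =
     integral {0..x} (\<lambda>t. (f' t * g 0 + f 0 * g' t) + (f' t * integral {0..t} g' + integral {0..t} f'
         * g' t))"
  proof (rule integral_cong)
    fix t assume "t \<in> {0..x}"
    with x have t: "0 \<le> t" "t \<le> l" by auto
    show "f' t * g t + f t * g' t = f' t * g 0 + f 0 * g' t + (f' t * integral {0..t} g'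
        + integral {0..t} f' * g' t)"
      by (simp add: ac_eq[OF assms(1) t] ac_eq[OF assms(2) t] algebra_simps)
  qed
  also have "\<dots> = integral {0..x} f' * g 0 + f 0 * integral {0..x} g' + integral {0..x} f'
      * integral {0..x} g'"
    using fi i by (simp add: Henstock_Kurzweil_Integration.integral_add integrable_add
        integrable_on_mult_left integrable_on_mult_right integral_mult_Fubini[OF fx gx])
  finally show "f x * g x = f 0 * g 0 + integral {0..x} (\<lambda>x. f' x * g x + f x * g' x)"
    by (subst ac_eq[OF assms(1) x], subst ac_eq[OF assms(2) x]) (simp add: algebra_simps)
qed

lemma ac_prod:
  fixes f :: "'i \<Rightarrow> real \<Rightarrow> 'a::{real_normed_field,euclidean_space}"
  assumes "finite I" "\<And>i. i \<in> I \<Longrightarrow> ac l (f i) (f' i)"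
  shows "ac l (\<lambda>x. \<Prod>i\<in>I. f i x) (\<lambda>x. \<Sum>k\<in>I. f' k x * (\<Prod>i\<in>I-{k}. f i x))"
  using assms
proof (induction I rule: finite_induct)
  case (insert a I)
  have "ac l (\<lambda>x. f a x * (\<Prod>i\<in>I. f i x))
     (\<lambda>x. f' a x * (\<Prod>i\<in>I. f i x) + f a x * (\<Sum>k\<in>I. f' k x * (\<Prod>i\<in>I-{k}. f i x)))"
    using insert by (intro ac_mult) auto
  moreover have "(\<Sum>k\<in>I. f' k x * (\<Prod>i\<in>insert a I-{k}. f i x)) = f a x
      * (\<Sum>k\<in>I. f' k x * (\<Prod>i\<in>I-{k}. f i x))" for x
    unfolding sum_distrib_left
  proof (rule sum.cong[OF refl])
    fix k assume "k \<in> I"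
    with insert have "insert a I - {k} = insert a (I - {k})" by auto
    with insert show "f' k x * (\<Prod>i\<in>insert a I-{k}. f i x) = f a x * (f' k x * (\<Prod>i\<in>I-{k}. f i x))"
      by (simp add: algebra_simps)
  qed
  ultimately show ?case using insert by simp
qed simp

lemma ac_power:
  fixes f :: "real \<Rightarrow> 'a::{real_normed_field,euclidean_space}"
  assumes "ac l f f'"
  shows "ac l (\<lambda>x. f x ^ m) (\<lambda>x. of_nat m * f x ^ (m - 1) * f' x)"
proof (induction m)
  case (Suc m)
  have "ac l (\<lambda>x. f x * f x ^ m) (\<lambda>x. f' x * f x ^ m + f x * (of_nat m * f x ^ (m - 1) * f' x))"
    by (rule ac_mult[OF assms Suc])
  then show ?case
    by (rule ac_cong) (cases m; simp add: algebra_simps)+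
qed simp

text \<open>Dominated convergence: pointwise limits suffice, provided that one integrable function
  \<open>b\<close> majorizes all the derivatives.\<close>

lemma ac_uniform_limit:
  fixes f :: "nat \<Rightarrow> real \<Rightarrow> 'a::euclidean_space"
  assumes f: "\<And>m. ac l (f m) (f' m)"
    and lim: "\<And>x. 0 \<le> x \<Longrightarrow> x \<le> l \<Longrightarrow> (\<lambda>m. f m x) \<longlonglongrightarrow> F x"
    and lim': "\<And>x. 0 \<le> x \<Longrightarrow> x \<le> l \<Longrightarrow> (\<lambda>m. f' m x) \<longlonglongrightarrow> F' x"
    and b: "b absolutely_integrable_on {0..l}"
    and bd: "\<And>m x. 0 \<le> x \<Longrightarrow> x \<le> l \<Longrightarrow> norm (f' m x) \<le> b x"
  shows "ac l F F'"
proof (rule acI[of _ _ _ "F 0"])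
  have b': "norm (F' x) \<le> b x" if "0 \<le> x" "x \<le> l" for x
    using Lim_bounded[OF tendsto_norm[OF lim'[OF that]], of 0] bd[OF that] by auto
  show "F' absolutely_integrable_on {0..l}"
  proof (rule dominated_convergence_absolutely_integrable[OF ac_absint[OF f]])
    show "b integrable_on {0..l}" using b by (rule set_lebesgue_integral_eq_integral)
  qed (use b' lim' in auto)
  fix x assume x: "0 \<le> x" "x \<le> l"
  have "(\<lambda>m. integral {0..x} (f' m)) \<longlonglongrightarrow> integral {0..x} F'"
  proof (rule dominated_convergence(2))
    show "b integrable_on {0..x}"
      using absint_subset[OF b, of 0 x] x by (auto intro: absint_integrable)
  qed (use ac_integrable[OF f x] bd lim' x in auto)
  then have "(\<lambda>m. f m 0 + integral {0..x} (f' m)) \<longlonglongrightarrow> F 0 + integral {0..x} F'"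
    using lim[of 0] x by (intro tendsto_intros) auto
  moreover have "(\<lambda>m. f m 0 + integral {0..x} (f' m)) = (\<lambda>m. f m x)"
    using ac_eq[OF f x] by auto
  ultimately show "F x = F 0 + integral {0..x} F'"
    using LIMSEQ_unique[OF lim[OF x]] by simp
qed

text \<open>In place of a chain rule, the partial sums of the exponential series are differentiated
  by \<open>ac_power\<close>, and the limit is taken under the majorant
  \<open>exp K * norm (f' x)\<close>, where \<open>K\<close> bounds \<open>f\<close>.\<close>

lemma ac_exp:
  fixes f :: "real \<Rightarrow> 'a::{real_normed_field,euclidean_space,banach}"
  assumes f: "ac l f f'"
  shows "ac l (\<lambda>x. exp (f x)) (\<lambda>x. exp (f x) * f' x)"
proof -
  have "bounded (f ` {0..l})"
    using ac_continuous[OF f] by (intro compact_imp_bounded compact_continuous_image) auto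
  then obtain K where "K > 0" "\<forall>y\<in>f ` {0..l}. norm y \<le> K"
    unfolding bounded_pos by blast
  then have K: "\<And>x. 0 \<le> x \<Longrightarrow> x \<le> l \<Longrightarrow> norm (f x) \<le> K" "K > 0" by auto
  define p where "p m z = (\<Sum>i<m. z ^ i /\<^sub>R fact i)" for m and z :: 'a
  have lim: "(\<lambda>m. p m z) \<longlonglongrightarrow> exp z" for z
    unfolding p_def using exp_converges[of z] by (simp add: sums_def)
  \<comment> \<open>Differentiation turns the partial sum of length \<open>Suc m\<close> into the
    one of length \<open>m\<close>: the constant term drops out, and the factor \<open>i\<close>
    cancels against \<open>fact i\<close>.\<close>
  have pm: "ac l (\<lambda>x. p (Suc m) (f x)) (\<lambda>x. p m (f x) * f' x)" for m
  proof -
    have "ac l (\<lambda>x. \<Sum>i<Suc m. f x ^ i /\<^sub>R fact i) (\<lambda>x. \<Sum>i<Suc m. (of_nat i * f x ^ (i - 1) * f' x) /\<^sub>R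
        fact i)"
      by (intro ac_sum ac_linear[OF ac_power[OF f]] bounded_linear_scaleR_right)
    moreover have "(\<Sum>i<Suc m. (of_nat i * z ^ (i - 1) * w) /\<^sub>R fact i) = p m z * w" for z w :: 'a
      unfolding p_def sum.lessThan_Suc_shift
      by (simp add: sum_distrib_left sum_distrib_right fact_Suc scaleR_conv_of_real field_simps del:
          of_nat_Suc)
    ultimately show ?thesis unfolding p_def by simp
  qed
  have bd: "norm (p m z) \<le> exp K" if "norm z \<le> K" for m z
  proof -
    have "norm (p m z) \<le> (\<Sum>i<m. norm (z ^ i /\<^sub>R fact i))" unfolding p_def by (rule norm_sum)
    also have "\<dots> \<le> (\<Sum>i<m. K ^ i /\<^sub>R fact i)"
      using that by (intro sum_mono) (auto simp: norm_power intro!: mult_left_mono power_mono)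
    also have "\<dots> \<le> exp K"
      unfolding exp_def using K(2) by (intro sum_le_suminf summable_exp_generic) auto
    finally show ?thesis .
  qed
  show ?thesis
  proof (rule ac_uniform_limit[OF pm])
    show "(\<lambda>x. exp K * norm (f' x)) absolutely_integrable_on {0..l}"
      using absint_norm[OF ac_absint[OF f]] by simp
    fix m x assume x: "0 \<le> x" "x \<le> l"
    show "norm (p m (f x) * f' x) \<le> exp K * norm (f' x)"
      unfolding norm_mult using bd[OF K(1)[OF x]] by (intro mult_right_mono) auto
    show "(\<lambda>m. p (Suc m) (f x)) \<longlonglongrightarrow> exp (f x)" using lim by (rule LIMSEQ_Suc)
    show "(\<lambda>m. p m (f x) * f' x) \<longlonglongrightarrow> exp (f x) * f' x" by (intro tendsto_intros lim)
  qed
qed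

lemma ac_mono:
  fixes f g :: "real \<Rightarrow> real"
  assumes "ac l f f'" "\<And>x. 0 \<le> x \<Longrightarrow> x \<le> l \<Longrightarrow> f' x \<ge> 0" "0 \<le> s" "s \<le> x" "x \<le> l"
  shows "f s \<le> f x"
proof -
  have "integral {s..x} f' \<ge> 0"
    using assms ac_absint_Icc[OF assms(1), of s x]
    by (intro Henstock_Kurzweil_Integration.integral_nonneg) (auto intro: absint_integrable)
  with ac_diff_eq[OF assms(1,3,4,5)] show ?thesis by simp
qed

section \<open>Gronwall inequalities\<close>

lemma gronwall:
  fixes u a :: "real \<Rightarrow> real"
  assumes u: "continuous_on {0..l} u" and a: "a absolutely_integrable_on {0..l}"
    and a0: "\<And>x. 0 \<le> x \<Longrightarrow> x \<le> l \<Longrightarrow> a x \<ge> 0"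
    and le: "\<And>x. 0 \<le> x \<Longrightarrow> x \<le> l \<Longrightarrow> u x \<le> c + integral {0..x} (\<lambda>t. a t * u t)"
    and x: "0 \<le> x" "x \<le> l"
  shows "u x \<le> c * exp (integral {0..x} a)"
proof -
  \<comment> \<open>\<open>u\<close> is only continuous; its majorant \<open>v\<close> is absolutely
    continuous with derivative \<open>a * u\<close>, which is at most \<open>a * v\<close>, so
    \<open>v * e\<close> is nonincreasing.\<close>
  define v where "v x = c + integral {0..x} (\<lambda>t. a t * u t)" for x
  define e where "e x = exp (- (0 + integral {0..x} a))" for x
  have v: "ac l v (\<lambda>t. a t * u t)" unfolding v_def by (rule ac_integral[OF absint_mult_cont2[OF u a]])
  have e: "ac l e (\<lambda>t. e t * - a t)" unfolding e_def by (rule ac_exp[OF ac_minus[OF ac_integral[OF a]]])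
  have "ac l (\<lambda>x. - (v x * e x)) (\<lambda>x. - (a x * u x * e x + v x * (e x * - a x)))"
    by (rule ac_minus[OF ac_mult[OF v e]])
  then have "- (v 0 * e 0) \<le> - (v x * e x)"
  proof (rule ac_mono)
    fix t assume t: "0 \<le> t" "t \<le> l"
    have "a t * u t * e t \<le> a t * v t * e t"
      using a0[OF t] le[OF t] by (intro mult_right_mono mult_left_mono) (auto simp: v_def e_def)
    then show "0 \<le> - (a t * u t * e t + v t * (e t * - a t))" by (simp add: algebra_simps)
  qed (use x in auto)
  then have "v x * e x \<le> c" by (simp add: v_def e_def)
  then have "v x * e x * exp (integral {0..x} a) \<le> c * exp (integral {0..x} a)"
    by (intro mult_right_mono) auto
  moreover have "v x * e x * exp (integral {0..x} a) = v x"
    by (simp add: e_def exp_minus)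
  ultimately have "v x \<le> c * exp (integral {0..x} a)" by simp
  moreover have "u x \<le> v x" using le[OF x] by (simp add: v_def)
  ultimately show ?thesis by linarith
qed

text \<open>Applied with the size of a solution at \<open>l\<close> as \<open>c\<close>, it turns a
  known value at 0 into a lower bound at \<open>l\<close>; this is how the determinant is bounded
  from below.\<close>

lemma gronwall_backward:
  fixes u a :: "real \<Rightarrow> real"
  assumes l: "0 \<le> l" and u: "continuous_on {0..l} u" and a: "a absolutely_integrable_on {0..l}"
    and a0: "\<And>x. 0 \<le> x \<Longrightarrow> x \<le> l \<Longrightarrow> a x \<ge> 0"
    and le: "\<And>x. 0 \<le> x \<Longrightarrow> x \<le> l \<Longrightarrow> u x \<le> c + integral {x..l} (\<lambda>t. a t * u t)"
  shows "u 0 \<le> c * exp (integral {0..l} a)"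
proof -
  define w where "w x = 0 + integral {0..x} (\<lambda>t. a t * u t)" for x
  define v where "v x = (c + w l) - w x" for x
  define e where "e x = exp (0 + integral {0..x} a)" for x
  have w: "ac l w (\<lambda>t. a t * u t)" unfolding w_def by (rule ac_integral[OF absint_mult_cont2[OF u a]])
  have v: "ac l v (\<lambda>t. 0 - a t * u t)" unfolding v_def by (rule ac_diff[OF ac_const w])
  have e: "ac l e (\<lambda>t. e t * a t)" unfolding e_def by (rule ac_exp[OF ac_integral[OF a]])
  have le': "u x \<le> v x" if "0 \<le> x" "x \<le> l" for x
    using le[OF that] ac_diff_eq[OF w, of x l] that by (simp add: v_def)
  have "v 0 * e 0 \<le> v l * e l"
  proof (rule ac_mono[OF ac_mult[OF v e]])
    fix t assume t: "0 \<le> t" "t \<le> l"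
    have "a t * u t * e t \<le> a t * v t * e t"
      using a0[OF t] le'[OF t] by (intro mult_right_mono mult_left_mono) (auto simp: e_def)
    then show "0 \<le> (0 - a t * u t) * e t + v t * (e t * a t)" by (simp add: algebra_simps)
  qed (use l in auto)
  then show ?thesis using le'[of 0] l by (simp add: v_def e_def)
qed

section \<open>Linear initial value problems\<close>

lemma ac_norm_diff_le:
  fixes f f' :: "real \<Rightarrow> 'a::euclidean_space" and b :: "real \<Rightarrow> real"
  assumes "ac l f f'" "b absolutely_integrable_on {0..l}"
    "\<And>t. 0 \<le> t \<Longrightarrow> t \<le> l \<Longrightarrow> norm (f' t) \<le> b t" "0 \<le> s" "s \<le> x" "x \<le> l"
  shows "norm (f x - f s) \<le> integral {s..x} b"
  unfolding ac_diff_eq[OF assms(1,4,5,6)]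
proof (rule Henstock_Kurzweil_Integration.integral_norm_bound_integral)
  show "f' integrable_on {s..x}"
    using ac_absint_Icc[OF assms(1), of s x] assms by (auto intro: absint_integrable)
  show "b integrable_on {s..x}"
    using absint_subset[OF assms(2), of s x] assms by (auto intro: absint_integrable)
qed (use assms in auto)

lemma integral_Icc_mono:
  fixes b :: "real \<Rightarrow> real"
  assumes "b absolutely_integrable_on {0..l}" "\<And>t. 0 \<le> t \<Longrightarrow> t \<le> l \<Longrightarrow> b t \<ge> 0" "0 \<le> s" "x \<le> l"
  shows "integral {s..x} b \<le> integral {0..l} b"
  using assms absint_subset[OF assms(1), of s x]
  by (intro integral_subset_le) (auto intro: absint_integrable)

definition lin_sys :: "real \<Rightarrow> nat \<Rightarrow> (nat \<Rightarrow> nat \<Rightarrow> real \<Rightarrow> complex) \<Rightarrow> (nat \<Rightarrow> real \<Rightarrow> complex)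
    \<Rightarrow> (nat \<Rightarrow> real \<Rightarrow> complex) \<Rightarrow> bool" where
  "lin_sys l n A h y \<longleftrightarrow> (\<forall>k<n. ac l (y k) (\<lambda>t. (\<Sum>j<n. A k j t * y j t) + h k t))"

lemma lin_sysD: "lin_sys l n A h y \<Longrightarrow> k < n \<Longrightarrow> ac l (y k) (\<lambda>t. (\<Sum>j<n. A k j t * y j t) + h k t)"
  unfolding lin_sys_def by blast

lemma lin_sys_add_scaled:
  assumes "lin_sys l n A h y" "lin_sys l n A h' y'"
  shows "lin_sys l n A (\<lambda>k t. h k t + c * h' k t) (\<lambda>k t. y k t + c * y' k t)"
  unfolding lin_sys_def
proof (intro allI impI)
  fix k assume k: "k < n"
  show "ac l (\<lambda>t. y k t + c * y' k t) (\<lambda>t. (\<Sum>j<n. A k j t * (y j t + c * y' j t)) + (h k t + c * h' k t))"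
    by (rule ac_deriv_cong[OF ac_add[OF lin_sysD[OF assms(1) k] ac_cmult[OF lin_sysD[OF assms(2) k]]]])
      (simp add: algebra_simps sum.distrib sum_distrib_left)
qed

lemma lin_sys_zero: "lin_sys l n A (\<lambda>_ _. 0) (\<lambda>_ _. 0)"
  by (simp add: lin_sys_def)

lemma lin_sys_sum_scaled:
  assumes "\<And>i. i \<in> I \<Longrightarrow> lin_sys l n A (h i) (y i)"
  shows "lin_sys l n A (\<lambda>k t. \<Sum>i\<in>I. c i * h i k t) (\<lambda>k t. \<Sum>i\<in>I. c i * y i k t)"
proof (cases "finite I")
  case True
  then show ?thesis using assms
  proof (induction I rule: finite_induct)
    case (insert a I)
    have "lin_sys l n A (\<lambda>k t. (\<Sum>i\<in>I. c i * h i k t) + c a * h a k t) (\<lambda>k t. (\<Sum>i\<in>I. c i * y i k t)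
        + c a * y a k t)"
      by (rule lin_sys_add_scaled) (use insert in auto)
    then show ?case using insert by (simp add: add.commute)
  qed (simp add: lin_sys_zero)
qed (simp add: lin_sys_zero)

lemma lin_sys_cong:
  assumes "lin_sys l n A h y" "\<And>k t. k < n \<Longrightarrow> 0 \<le> t \<Longrightarrow> t \<le> l \<Longrightarrow> y k t = y' k t"
    "\<And>k t. k < n \<Longrightarrow> 0 \<le> t \<Longrightarrow> t \<le> l \<Longrightarrow>
       (\<Sum>j<n. A k j t * y j t) + h k t = (\<Sum>j<n. A' k j t * y' j t) + h' k t"
  shows "lin_sys l n A' h' y'"
  unfolding lin_sys_def using assms(2,3) by (intro allI impI ac_cong[OF lin_sysD[OF assms(1)]]) auto

locale lin_sys_coeffs =
  fixes l :: real and n :: nat and A :: "nat \<Rightarrow> nat \<Rightarrow> real \<Rightarrow> complex"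
  assumes A_absint: "\<And>k j. k < n \<Longrightarrow> j < n \<Longrightarrow> A k j absolutely_integrable_on {0..l}"
    and l_nonneg: "0 \<le> l"
begin

definition anorm :: "real \<Rightarrow> real" where "anorm t = (\<Sum>k<n. \<Sum>j<n. cmod (A k j t))"

lemma anorm_absint: "anorm absolutely_integrable_on {0..l}"
proof -
  have "(\<lambda>t. \<Sum>k<n. \<Sum>j<n. cmod (A k j t)) absolutely_integrable_on {0..l}"
    using absolutely_integrable_norm[OF A_absint] by (intro absolutely_integrable_sum) (auto simp: o_def)
  then show ?thesis by (simp add: anorm_def[abs_def])
qed

lemma anorm_nonneg: "anorm t \<ge> 0" unfolding anorm_def by (intro sum_nonneg) auto

lemma A_mult_le: "(\<Sum>k<n. cmod (\<Sum>j<n. A k j t * v j)) \<le> anorm t * (\<Sum>j<n. cmod (v j))"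
proof -
  have "cmod (\<Sum>j<n. A k j t * v j) \<le> (\<Sum>j<n. cmod (A k j t)) * (\<Sum>j<n. cmod (v j))" for k
  proof -
    have "cmod (\<Sum>j<n. A k j t * v j) \<le> (\<Sum>j<n. cmod (A k j t) * cmod (v j))"
      by (rule order_trans[OF norm_sum]) (simp add: norm_mult)
    also have "\<dots> \<le> (\<Sum>j<n. cmod (A k j t) * (\<Sum>j<n. cmod (v j)))"
      by (intro sum_mono mult_left_mono member_le_sum) auto
    finally show ?thesis by (simp add: sum_distrib_right)
  qed
  then show ?thesis unfolding anorm_def sum_distrib_right
    by (intro sum_mono) (simp add: sum_distrib_right)
qed

lemma A_mult_absint:
  assumes "\<And>j. j < n \<Longrightarrow> continuous_on {0..l} (v j)" "k < n"
  shows "(\<lambda>t. \<Sum>j<n. A k j t * v j t) absolutely_integrable_on {0..l}"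
  using assms A_absint by (intro absolutely_integrable_sum absint_mult_cont2) auto

text \<open>The sum of the moduli satisfies a Gronwall inequality with weight \<open>anorm\<close>,
  in which the forcing term enters only through its L1 norm.\<close>

lemma lin_sys_bound:
  assumes y: "lin_sys l n A h y" and h: "\<And>k. k < n \<Longrightarrow> h k absolutely_integrable_on {0..l}"
    and x: "0 \<le> x" "x \<le> l"
  shows "(\<Sum>k<n. cmod (y k x)) \<le> ((\<Sum>k<n. cmod (y k 0)) + (\<Sum>k<n. integral {0..l} (\<lambda>t. cmod (h k t))))
      * exp (integral {0..l} anorm)"
proof -
  define u where "u x = (\<Sum>k<n. cmod (y k x))" for x
  define c where "c = (\<Sum>k<n. cmod (y k 0)) + (\<Sum>k<n. integral {0..l} (\<lambda>t. cmod (h k t)))"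
  have yc: "continuous_on {0..l} (y k)" if "k < n" for k using ac_continuous[OF lin_sysD[OF y that]] .
  have u: "continuous_on {0..l} u" unfolding u_def by (intro continuous_intros yc) auto
  have hn: "(\<lambda>t. cmod (h k t)) absolutely_integrable_on {0..l}" if "k < n" for k
    using absint_norm[OF h[OF that]] by simp
  have An: "(\<lambda>t. cmod (\<Sum>j<n. A k j t * y j t)) absolutely_integrable_on {0..l}" if "k < n" for k
    using absint_norm[OF A_mult_absint[of y, OF yc that]] by simp
  have le: "u x \<le> c + integral {0..x} (\<lambda>t. anorm t * u t)" if x: "0 \<le> x" "x \<le> l" for x
  proof -
    have sub: "f integrable_on {0..x}" if "f absolutely_integrable_on {0..l}" for f :: "real \<Rightarrow> real"
      using absint_subset[OF that, of 0 x] x by (auto intro: absint_integrable)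
    have 1: "cmod (y k x) \<le> cmod (y k 0) + integral {0..l} (\<lambda>t. cmod (h k t))
        + integral {0..x} (\<lambda>t. cmod (\<Sum>j<n. A k j t * y j t))" if k: "k < n" for k
    proof -
      have "cmod (y k x - y k 0) \<le> integral {0..x} (\<lambda>t. cmod (\<Sum>j<n. A k j t * y j t) + cmod (h k t))"
        using x by (intro ac_norm_diff_le[OF lin_sysD[OF y k]] set_integral_add An hn k)
            (auto intro: norm_triangle_ineq)
      also have "\<dots> = integral {0..x} (\<lambda>t. cmod (\<Sum>j<n. A k j t * y j t))
          + integral {0..x} (\<lambda>t. cmod (h k t))"
        by (intro Henstock_Kurzweil_Integration.integral_add sub An hn k)
      also have "integral {0..x} (\<lambda>t. cmod (h k t)) \<le> integral {0..l} (\<lambda>t. cmod (h k t))"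
        using x by (intro integral_Icc_mono hn k) auto
      finally show ?thesis using norm_triangle_sub[of "y k x" "y k 0"] by linarith
    qed
    have "u x \<le> (\<Sum>k<n. cmod (y k 0) + integral {0..l} (\<lambda>t. cmod (h k t))
        + integral {0..x} (\<lambda>t. cmod (\<Sum>j<n. A k j t * y j t)))"
      unfolding u_def by (intro sum_mono 1) auto
    also have "\<dots> = c + (\<Sum>k<n. integral {0..x} (\<lambda>t. cmod (\<Sum>j<n. A k j t * y j t)))"
      by (simp add: sum.distrib c_def)
    also have "(\<Sum>k<n. integral {0..x} (\<lambda>t. cmod (\<Sum>j<n. A k j t * y j t)))
        = integral {0..x} (\<lambda>t. \<Sum>k<n. cmod (\<Sum>j<n. A k j t * y j t))"
      by (rule Henstock_Kurzweil_Integration.integral_sum[symmetric]) (auto intro: sub An)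
    also have "\<dots> \<le> integral {0..x} (\<lambda>t. anorm t * u t)"
    proof (rule integral_le)
      show "(\<lambda>t. \<Sum>k<n. cmod (\<Sum>j<n. A k j t * y j t)) integrable_on {0..x}"
        by (intro integrable_sum sub An) auto
      show "(\<lambda>t. anorm t * u t) integrable_on {0..x}"
        by (intro sub absint_mult_cont2 u anorm_absint)
    qed (auto simp: u_def intro: A_mult_le)
    finally show ?thesis by simp
  qed
  have "u x \<le> c * exp (integral {0..x} anorm)"
    by (rule gronwall[OF u anorm_absint anorm_nonneg le x])
  also have "\<dots> \<le> c * exp (integral {0..l} anorm)"
  proof (intro mult_left_mono)
    show "exp (integral {0..x} anorm) \<le> exp (integral {0..l} anorm)"
      using x integral_Icc_mono[OF anorm_absint anorm_nonneg, of 0 x] by simp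
    show "0 \<le> c" unfolding c_def
      by (intro add_nonneg_nonneg sum_nonneg Henstock_Kurzweil_Integration.integral_nonneg
          absint_integrable[OF hn]) auto
  qed
  finally show ?thesis unfolding u_def c_def .
qed

lemma lin_sys_unique:
  assumes "lin_sys l n A h y" "lin_sys l n A h z" "\<And>k. k < n \<Longrightarrow> y k 0 = z k 0" "k < n" "0 \<le> x" "x \<le> l"
  shows "y k x = z k x"
proof -
  have d: "lin_sys l n A (\<lambda>_ _. 0) (\<lambda>k t. y k t + (-1) * z k t)"
    using lin_sys_add_scaled[OF assms(1,2), of "-1"] by simp
  have "(\<Sum>k<n. cmod (y k x + (-1) * z k x)) \<le> 0"
    using lin_sys_bound[OF d _ assms(5,6)] assms(3) by simp
  then have "(\<Sum>k<n. cmod (y k x + (-1) * z k x)) = 0"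
    by (intro antisym sum_nonneg) auto
  then show ?thesis using assms(4) by (subst (asm) sum_nonneg_eq_0_iff) auto
qed

text \<open>Picard iteration. Integrable coefficients have no Lipschitz constant, but measured by
  \<alpha>, the integral of \<open>anorm\<close>, the increment number \<open>m\<close> is at most a
  constant times \<open>\<alpha> x ^ m / fact m\<close>, which is summable uniformly on the
  interval.\<close>

lemma lin_sys_exists:
  assumes h: "\<And>k. k < n \<Longrightarrow> h k absolutely_integrable_on {0..l}"
  shows "\<exists>y. lin_sys l n A h y \<and> (\<forall>k<n. y k 0 = c k)"
proof -
  define s where "s = rec_nat (\<lambda>k (x::real). c k) (\<lambda>_ y k x. c k
      + integral {0..x} (\<lambda>t. (\<Sum>j<n. A k j t * y j t) + h k t))"
  have s0: "s 0 = (\<lambda>k x. c k)" and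
    sS: "s (Suc m) = (\<lambda>k x. c k + integral {0..x} (\<lambda>t. (\<Sum>j<n. A k j t * s m j t) + h k t))" for m
    by (auto simp: s_def)
  have cont: "\<forall>k<n. continuous_on {0..l} (s m k)"
    and acS: "\<forall>k<n. ac l (s (Suc m) k) (\<lambda>t. (\<Sum>j<n. A k j t * s m j t) + h k t)" for m
  proof -
    have step: "\<forall>k<n. ac l (s (Suc m) k) (\<lambda>t. (\<Sum>j<n. A k j t * s m j t) + h k t)"
      if "\<forall>k<n. continuous_on {0..l} (s m k)" for m
      unfolding sS using that by (intro allI impI ac_integral set_integral_add A_mult_absint h) auto
    show c: "\<forall>k<n. continuous_on {0..l} (s m k)"
    proof (induction m)
      case (Suc m)
      show ?case using step[OF Suc] ac_continuous by blast
    qed (simp add: s0)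
    show "\<forall>k<n. ac l (s (Suc m) k) (\<lambda>t. (\<Sum>j<n. A k j t * s m j t) + h k t)"
      by (rule step[OF c])
  qed
  have s_at0: "s m k 0 = c k" for m k by (cases m) (auto simp: s0 sS)
  define \<alpha> where "\<alpha> x = 0 + integral {0..x} anorm" for x
  have \<alpha>: "ac l \<alpha> anorm" unfolding \<alpha>_def by (rule ac_integral[OF anorm_absint])
  define \<delta> where "\<delta> m x = (\<Sum>k<n. cmod (s (Suc m) k x - s m k x))" for m x
  have \<delta>c: "continuous_on {0..l} (\<delta> m)" for m
    unfolding \<delta>_def using cont by (intro continuous_intros) auto
  have "bounded (\<delta> 0 ` {0..l})"
    by (intro compact_imp_bounded compact_continuous_image \<delta>c) auto
  then obtain B where B: "B > 0" "\<forall>y\<in>\<delta> 0 ` {0..l}. norm y \<le> B" unfolding bounded_pos by blast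
  have \<delta>: "\<delta> m x \<le> B * (\<alpha> x ^ m / fact m)" if "0 \<le> x" "x \<le> l" for m x
    using that
  proof (induction m arbitrary: x)
    case 0
    then have "norm (\<delta> 0 x) \<le> B" using B(2) by auto
    then show ?case by simp
  next
    case (Suc m)
    define p where "p k x = s (Suc (Suc m)) k x - s (Suc m) k x" for k x
    define q where "q k t = (\<Sum>j<n. A k j t * (s (Suc m) j t - s m j t))" for k t
    have pq: "ac l (p k) (q k)" if k: "k < n" for k
      unfolding p_def q_def
      by (rule ac_deriv_cong[OF ac_diff[OF acS[rule_format, OF k] acS[rule_format, OF k]]])
        (simp add: algebra_simps sum_subtractf)
    have qn: "(\<lambda>t. cmod (q k t)) absolutely_integrable_on {0..l}" if "k < n" for k
      using absint_norm[OF ac_absint[OF pq[OF that]]] by simp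
    have sub: "f integrable_on {0..x}" if "f absolutely_integrable_on {0..l}" for f :: "real \<Rightarrow> real"
      using absint_subset[OF that, of 0 x] Suc.prems by (auto intro: absint_integrable)
    \<comment> \<open>The antiderivative of the next bound: \<open>\<alpha> ^ m * anorm\<close>
      integrates to \<open>\<alpha> ^ Suc m / Suc m\<close>, and this produces the
      factorial.\<close>
    have fin: "ac l (\<lambda>x. (B / fact (Suc m)) * \<alpha> x ^ Suc m) (\<lambda>x. (B / fact (Suc m))
        * (of_nat (Suc m) * \<alpha> x ^ (Suc m - 1) * anorm x))"
      by (rule ac_cmult[OF ac_power[OF \<alpha>]])
    have "\<delta> (Suc m) x \<le> (\<Sum>k<n. integral {0..x} (\<lambda>t. cmod (q k t)))"
      unfolding \<delta>_def
    proof (rule sum_mono)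
      fix k assume "k \<in> {..<n}"
      then have k: "k < n" by simp
      have "cmod (p k x - p k 0) \<le> integral {0..x} (\<lambda>t. cmod (q k t))"
        using Suc.prems by (intro ac_norm_diff_le[OF pq[OF k] qn[OF k]]) auto
      then show "cmod (s (Suc (Suc m)) k x - s (Suc m) k x) \<le> integral {0..x} (\<lambda>t. cmod (q k t))"
        by (simp add: p_def s_at0)
    qed
    also have "\<dots> = integral {0..x} (\<lambda>t. \<Sum>k<n. cmod (q k t))"
      by (rule Henstock_Kurzweil_Integration.integral_sum[symmetric]) (auto intro: sub qn)
    also have "\<dots> \<le> integral {0..x} (\<lambda>x. (B / fact (Suc m)) * (of_nat (Suc m) * \<alpha> x ^ (Suc m - 1)
        * anorm x))"
    proof (rule integral_le)
      show "(\<lambda>t. \<Sum>k<n. cmod (q k t)) integrable_on {0..x}"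
        by (intro integrable_sum sub qn) auto
      show "(\<lambda>x. (B / fact (Suc m)) * (of_nat (Suc m) * \<alpha> x ^ (Suc m - 1) * anorm x)) integrable_on
          {0..x}"
        by (rule sub[OF ac_absint[OF fin]])
      fix t assume t: "t \<in> {0..x}"
      have "(\<Sum>k<n. cmod (q k t)) \<le> anorm t * \<delta> m t"
        unfolding q_def \<delta>_def by (rule A_mult_le)
      also have "\<dots> \<le> anorm t * (B * (\<alpha> t ^ m / fact m))"
        using t Suc.prems by (intro mult_left_mono anorm_nonneg Suc.IH) auto
      also have "\<dots> = (B / fact (Suc m)) * (of_nat (Suc m) * \<alpha> t ^ (Suc m - 1) * anorm t)"
        by (simp add: fact_Suc field_simps del: of_nat_Suc)
      finally show "(\<Sum>k<n. cmod (q k t)) \<le> (B / fact (Suc m))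
          * (of_nat (Suc m) * \<alpha> t ^ (Suc m - 1) * anorm t)" .
    qed
    also have "\<dots> = (B / fact (Suc m)) * \<alpha> x ^ Suc m"
      using ac_eq[OF fin, of x] Suc.prems by (simp add: \<alpha>_def)
    finally show ?case by simp
  qed
  have \<alpha>0: "\<alpha> x \<ge> 0" "\<alpha> x \<le> \<alpha> l" if "0 \<le> x" "x \<le> l" for x
    using ac_mono[OF \<alpha> anorm_nonneg, of 0 x] ac_mono[OF \<alpha> anorm_nonneg, of x l] that l_nonneg
    by (auto simp: \<alpha>_def)
  have diff: "cmod (s (Suc m) k x - s m k x) \<le> B * (\<alpha> l ^ m / fact m)" if "k < n" "0 \<le> x" "x \<le> l"
    for m k x
  proof -
    have "cmod (s (Suc m) k x - s m k x) \<le> \<delta> m x" unfolding \<delta>_def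
      using that by (intro member_le_sum[of k "{..<n}" "\<lambda>k. cmod (s (Suc m) k x - s m k x)"]) auto
    also have "\<dots> \<le> B * (\<alpha> x ^ m / fact m)" by (rule \<delta>[OF that(2,3)])
    also have "\<dots> \<le> B * (\<alpha> l ^ m / fact m)"
      using B(1) \<alpha>0[OF that(2,3)] by (intro mult_left_mono divide_right_mono power_mono) auto
    finally show ?thesis .
  qed
  have summ: "summable (\<lambda>m. B * (\<alpha> l ^ m / fact m))"
    using summable_exp_generic[of "\<alpha> l"] by (intro summable_mult) (simp add: field_simps)
  define y where "y k x = c k + (\<Sum>m. s (Suc m) k x - s m k x)" for k x
  have tele: "s m k x = c k + (\<Sum>i<m. s (Suc i) k x - s i k x)" for m k x
    using sum_lessThan_telescope[of "\<lambda>i. s i k x" m] by (simp add: s0)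
  have lim: "(\<lambda>m. s m k x) \<longlonglongrightarrow> y k x" if "k < n" "0 \<le> x" "x \<le> l" for k x
  proof -
    have "summable (\<lambda>m. s (Suc m) k x - s m k x)"
      by (rule summable_comparison_test'[OF summ, of 0]) (use diff[OF that] in auto)
    then have "(\<lambda>m. c k + (\<Sum>i<m. s (Suc i) k x - s i k x)) \<longlonglongrightarrow> y k x"
      unfolding y_def by (intro tendsto_intros summable_LIMSEQ)
    then show ?thesis by (simp flip: tele)
  qed
  \<comment> \<open>\<open>K\<close> bounds all iterates at once and so gives the integrable
    majorant under which the integral equation passes to the limit.\<close>
  define K where "K = (\<Sum>k<n. cmod (c k)) + (\<Sum>m. B * (\<alpha> l ^ m / fact m))"
  have bd: "cmod (s m k x) \<le> K" if "k < n" "0 \<le> x" "x \<le> l" for m k x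
  proof -
    have "cmod (s m k x) \<le> cmod (c k) + cmod (\<Sum>i<m. s (Suc i) k x - s i k x)"
      by (subst tele) (rule norm_triangle_ineq)
    also have "cmod (\<Sum>i<m. s (Suc i) k x - s i k x) \<le> (\<Sum>i<m. B * (\<alpha> l ^ i / fact i))"
      by (rule sum_norm_le) (use diff[OF that] in auto)
    also have "\<dots> \<le> (\<Sum>m. B * (\<alpha> l ^ m / fact m))"
      using B(1) \<alpha>0[of l] l_nonneg by (intro sum_le_suminf summ) auto
    also have "cmod (c k) \<le> (\<Sum>k<n. cmod (c k))"
      using that by (intro member_le_sum[of k "{..<n}" "\<lambda>k. cmod (c k)"]) auto
    finally show ?thesis by (simp add: K_def)
  qed
  have K0: "K \<ge> 0" unfolding K_def
    using B(1) \<alpha>0[of l] l_nonneg by (intro add_nonneg_nonneg sum_nonneg suminf_nonneg summ) auto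
  have "lin_sys l n A h y"
    unfolding lin_sys_def
  proof (intro allI impI)
    fix k assume k: "k < n"
    show "ac l (y k) (\<lambda>t. (\<Sum>j<n. A k j t * y j t) + h k t)"
    proof (rule ac_uniform_limit[OF acS[rule_format, OF k]])
      show "(\<lambda>t. (\<Sum>j<n. cmod (A k j t) * K) + cmod (h k t)) absolutely_integrable_on {0..l}"
        using absolutely_integrable_norm[OF A_absint[OF k]] absolutely_integrable_norm[OF h[OF k]]
        by (intro set_integral_add absolutely_integrable_sum) (auto simp: o_def)
      fix m x assume x: "0 \<le> x" "x \<le> l"
      show "(\<lambda>m. s (Suc m) k x) \<longlonglongrightarrow> y k x" by (rule LIMSEQ_Suc[OF lim[OF k x]])
      show "(\<lambda>m. (\<Sum>j<n. A k j x * s m j x) + h k x) \<longlonglongrightarrow> (\<Sum>j<n. A k j x * y j x) + h k x"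
        using x by (intro tendsto_intros lim) auto
      show "norm ((\<Sum>j<n. A k j x * s m j x) + h k x) \<le> (\<Sum>j<n. cmod (A k j x) * K) + cmod (h k x)"
        using bd x
        by (intro norm_triangle_mono sum_norm_le) (auto simp: norm_mult intro!: mult_left_mono)
    qed
  qed
  moreover have "\<forall>k<n. y k 0 = c k" by (simp add: y_def s_at0)
  ultimately show ?thesis by blast
qed

end

section \<open>Dependence on the spectral parameter\<close>

text \<open>Division by \<open>z - z0\<close> is repeated \<open>m\<close> times; each quotient
  stays entire because its singularity at \<open>z0\<close> is removable. What matters later is that
  the factor \<open>h\<close> of the remainder is entire.\<close>

lemma entire_Taylor_remainder:
  assumes "f holomorphic_on UNIV"
  shows "\<exists>a h. h holomorphic_on UNIV \<and> (\<forall>z. f z = (\<Sum>p<m. a p * (z - z0) ^ p) + (z - z0) ^ m * h z)"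
proof (induction m)
  case 0
  show ?case using assms by (intro exI[of _ "\<lambda>_. 0"] exI[of _ f]) simp
next
  case (Suc m)
  then obtain a h where h: "h holomorphic_on UNIV"
    and f: "\<And>z. f z = (\<Sum>p<m. a p * (z - z0) ^ p) + (z - z0) ^ m * h z" by blast
  define h1 where "h1 z = (if z = z0 then deriv h z0 else (h z - h z0) / (z - z0))" for z
  have "h1 holomorphic_on UNIV"
    unfolding h1_def using pole_lemma[OF h, of z0] by simp
  moreover have "f z = (\<Sum>p<Suc m. (a(m := h z0)) p * (z - z0) ^ p) + (z - z0) ^ Suc m * h1 z" for z
  proof -
    have e: "h z = h z0 + (z - z0) * h1 z" by (auto simp: h1_def)
    have "(z - z0) ^ m * h z = h z0 * (z - z0) ^ m + (z - z0) ^ Suc m * h1 z"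
      by (subst e) (simp add: algebra_simps)
    moreover have "(\<Sum>p<m. (a(m := h z0)) p * (z - z0) ^ p) = (\<Sum>p<m. a p * (z - z0) ^ p)"
      by (rule sum.cong) auto
    ultimately show ?thesis by (subst f) simp
  qed
  ultimately show ?case by blast
qed

text \<open>Letting \<open>z\<close> tend to 0 removes the constant term, and division by
  \<open>z\<close> lowers the degree. It will show that the boundary forms vanish on Taylor
  coefficients.\<close>

lemma poly_coeffs_zero_if_small:
  fixes c :: "nat \<Rightarrow> complex"
  assumes "r > 0" "\<And>z. 0 < cmod z \<Longrightarrow> cmod z < r \<Longrightarrow> cmod (\<Sum>i<m. c i * z ^ i) \<le> K * cmod z ^ m" "i < m"
  shows "c i = 0"
  using assms(2,3)
proof (induction m arbitrary: c i)
  case (Suc m)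
  have split: "(\<Sum>i<Suc m. c i * z ^ i) = c 0 + z * (\<Sum>i<m. c (Suc i) * z ^ i)" for z
    unfolding sum.lessThan_Suc_shift by (simp add: sum_distrib_left algebra_simps)
  have c0: "c 0 = 0"
  proof -
    have "((\<lambda>z. \<Sum>i<Suc m. c i * z ^ i) \<longlongrightarrow> (\<Sum>i<Suc m. c i * 0 ^ i)) (at 0)"
      by (intro tendsto_intros)
    moreover have "(\<Sum>i<Suc m. c i * 0 ^ i) = c 0" by (subst split) simp
    moreover have "((\<lambda>z. \<Sum>i<Suc m. c i * z ^ i) \<longlongrightarrow> 0) (at 0)"
    proof (rule Lim_null_comparison)
      show "\<forall>\<^sub>F z in at 0. norm (\<Sum>i<Suc m. c i * z ^ i) \<le> K * cmod z ^ Suc m"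
        unfolding eventually_at using assms(1) Suc.prems(1) by (intro exI[of _ r]) (auto simp: dist_norm)
      have "((\<lambda>z::complex. K * cmod z ^ Suc m) \<longlongrightarrow> K * cmod 0 ^ Suc m) (at 0)"
        by (intro tendsto_intros)
      then show "((\<lambda>z::complex. K * cmod z ^ Suc m) \<longlongrightarrow> 0) (at 0)" by simp
    qed
    ultimately show ?thesis using tendsto_unique[OF at_neq_bot] by metis
  qed
  have "cmod (\<Sum>i<m. c (Suc i) * z ^ i) \<le> K * cmod z ^ m" if "0 < cmod z" "cmod z < r" for z
  proof -
    have "cmod z * cmod (\<Sum>i<m. c (Suc i) * z ^ i) \<le> cmod z * (K * cmod z ^ m)"
      using Suc.prems(1)[OF that] unfolding split c0 by (simp add: norm_mult algebra_simps)
    then show ?thesis using that by simp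
  qed
  then have "c (Suc i) = 0" if "i < m" for i
    using Suc.IH[of "\<lambda>i. c (Suc i)" i] that by blast
  then show ?case using c0 Suc.prems(2) by (cases i) auto
qed simp

section \<open>Functionals bounded in the uniform norm\<close>

definition cont_comps :: "real \<Rightarrow> nat \<Rightarrow> (nat \<Rightarrow> real \<Rightarrow> complex) \<Rightarrow> bool" where
  "cont_comps l n u \<longleftrightarrow> (\<forall>k<n. continuous_on {0..l} (u k))"

text \<open>A common class for the boundary forms, which are point evaluations and make sense for
  continuous functions only, and for bounded functionals on the Hilbert space. The bound is stated
  with an arbitrary majorant \<open>B\<close> in place of a supremum.\<close>

definition sup_functional :: "real \<Rightarrow> nat \<Rightarrow> ((nat \<Rightarrow> real \<Rightarrow> complex) \<Rightarrow> complex) \<Rightarrow> bool" where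
  "sup_functional l n \<phi> \<longleftrightarrow>
     (\<forall>u v c. cont_comps l n u \<longrightarrow> cont_comps l n v \<longrightarrow> \<phi> (\<lambda>k x. u k x + c * v k x) = \<phi> u + c * \<phi> v) \<and>
     (\<exists>K\<ge>0. \<forall>u B. cont_comps l n u \<longrightarrow> B \<ge> 0 \<longrightarrow> (\<forall>k<n. \<forall>x\<in>{0..l}. cmod (u k x) \<le> B) \<longrightarrow> cmod (\<phi> u) \<le> K * B)"

lemma cont_comps_add_scaled: "cont_comps l n u \<Longrightarrow> cont_comps l n v
    \<Longrightarrow> cont_comps l n (\<lambda>k x. u k x + c * v k x)"
  unfolding cont_comps_def by (intro allI impI continuous_intros) auto

lemma cont_comps_zero [simp]: "cont_comps l n (\<lambda>_ _. 0)" by (simp add: cont_comps_def)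

lemma cont_comps_sum_scaled: "(\<And>i. i \<in> I \<Longrightarrow> cont_comps l n (u i))
    \<Longrightarrow> cont_comps l n (\<lambda>k x. \<Sum>i\<in>I. c i * u i k x)"
  unfolding cont_comps_def by (intro allI impI continuous_intros) auto

lemma lin_sys_cont_comps: "lin_sys l n A h y \<Longrightarrow> cont_comps l n y"
  unfolding cont_comps_def lin_sys_def using ac_continuous by blast

lemma sup_functional_add_scaled: "sup_functional l n \<phi> \<Longrightarrow> cont_comps l n u \<Longrightarrow> cont_comps l n v
    \<Longrightarrow> \<phi> (\<lambda>k x. u k x + c * v k x) = \<phi> u + c * \<phi> v"
  unfolding sup_functional_def by blast

lemma sup_functional_bound:
  assumes "sup_functional l n \<phi>"
  obtains K where "K \<ge> 0" "\<And>u B. cont_comps l n u \<Longrightarrow> B \<ge> 0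
      \<Longrightarrow> (\<And>k x. k < n \<Longrightarrow> 0 \<le> x \<Longrightarrow> x \<le> l \<Longrightarrow> cmod (u k x) \<le> B) \<Longrightarrow> cmod (\<phi> u) \<le> K * B"
proof -
  obtain K where K: "K \<ge> 0" "\<forall>u B. cont_comps l n u \<longrightarrow> B \<ge> 0 \<longrightarrow> (\<forall>k<n. \<forall>x\<in>{0..l}. cmod (u k x) \<le> B)
      \<longrightarrow> cmod (\<phi> u) \<le> K * B"
    using assms unfolding sup_functional_def by blast
  show ?thesis by (rule that[OF K(1)]) (use K(2) in auto)
qed

text \<open>Solutions are determined only on the interval and for indices below \<open>n\<close>, so
  a functional has to ignore all other values; its bound with \<open>B\<close> equal to 0 ensures
  this.\<close>

lemma sup_functional_cong:
  assumes "sup_functional l n \<phi>" "cont_comps l n u" "cont_comps l n v" "\<And>k x. k < n \<Longrightarrow> 0 \<le> x \<Longrightarrow> x \<le> l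
      \<Longrightarrow> u k x = v k x"
  shows "\<phi> u = \<phi> v"
proof -
  obtain K where K: "\<And>u B. cont_comps l n u \<Longrightarrow> B \<ge> 0 \<Longrightarrow> (\<And>k x. k < n \<Longrightarrow> 0 \<le> x \<Longrightarrow> x \<le> l \<Longrightarrow> cmod (u k x) \<le> B)
      \<Longrightarrow> cmod (\<phi> u) \<le> K * B"
    using sup_functional_bound[OF assms(1)] by blast
  have "cmod (\<phi> (\<lambda>k x. u k x + (-1) * v k x)) \<le> K * 0"
    by (rule K[OF cont_comps_add_scaled[OF assms(2,3)]]) (use assms(4) in auto)
  then show ?thesis using sup_functional_add_scaled[OF assms(1-3), of "-1"] by simp
qed

lemma sup_functional_zero: "sup_functional l n \<phi> \<Longrightarrow> \<phi> (\<lambda>_ _. 0) = 0"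
  using sup_functional_add_scaled[of l n \<phi> "\<lambda>_ _. 0" "\<lambda>_ _. 0" 1] by simp

lemma sup_functional_sum_scaled:
  assumes "sup_functional l n \<phi>" "\<And>i. i \<in> I \<Longrightarrow> cont_comps l n (u i)"
  shows "\<phi> (\<lambda>k x. \<Sum>i\<in>I. c i * u i k x) = (\<Sum>i\<in>I. c i * \<phi> (u i))"
proof (cases "finite I")
  case True
  then show ?thesis using assms(2)
  proof (induction I rule: finite_induct)
    case (insert a I)
    have "\<phi> (\<lambda>k x. (\<Sum>i\<in>I. c i * u i k x) + c a * u a k x) = \<phi> (\<lambda>k x. \<Sum>i\<in>I. c i * u i k x) + c a * \<phi> (u a)"
      using insert by (intro sup_functional_add_scaled[OF assms(1)] cont_comps_sum_scaled) auto
    then show ?case using insert by (simp add: add.commute)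
  qed (simp add: sup_functional_zero[OF assms(1)])
qed (simp add: sup_functional_zero[OF assms(1)])

lemma absint_of_real:
  fixes f :: "real \<Rightarrow> real"
  shows "f absolutely_integrable_on S \<Longrightarrow> (\<lambda>x. complex_of_real (f x)) absolutely_integrable_on S"
  by (drule absolutely_integrable_linear[OF _ bounded_linear_of_real]) (simp add: o_def)

lemma absint_minus:
  fixes f :: "real \<Rightarrow> 'a::euclidean_space"
  shows "f absolutely_integrable_on S \<Longrightarrow> (\<lambda>x. - f x) absolutely_integrable_on S"
  by (drule absolutely_integrable_linear[OF _ bounded_linear_minus[OF bounded_linear_ident]])
      (simp add: o_def)

lemma absint_cmult:
  fixes f :: "real \<Rightarrow> 'a::{real_normed_field,euclidean_space}"
  shows "f absolutely_integrable_on S \<Longrightarrow> (\<lambda>x. c * f x) absolutely_integrable_on S"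
  by (rule set_integrable_mult_right) auto

section \<open>Initial value problems with a spectral parameter\<close>

locale first_order_system =
  fixes n :: nat and l :: real and beta :: "nat \<Rightarrow> real \<Rightarrow> real" and Q :: "nat \<Rightarrow> nat \<Rightarrow> real \<Rightarrow> complex"
  assumes l_pos: "l > 0"
    and beta_absint: "\<And>k. k < n \<Longrightarrow> beta k absolutely_integrable_on {0..l}"
    and Q_absint: "\<And>k j. k < n \<Longrightarrow> j < n \<Longrightarrow> Q k j absolutely_integrable_on {0..l}"
begin

definition A :: "complex \<Rightarrow> nat \<Rightarrow> nat \<Rightarrow> real \<Rightarrow> complex" where
  "A lam k j t = (if k = j then \<i> * lam * of_real (beta k t) else 0) - Q k j t"

text \<open>Multiplying \<open>- \<i> B^-1 (y' + Q y) - lam y = g\<close> by \<open>\<i> B\<close>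
  gives \<open>y' = A lam y + src g\<close>.\<close>

definition src :: "(nat \<Rightarrow> real \<Rightarrow> complex) \<Rightarrow> nat \<Rightarrow> real \<Rightarrow> complex" where
  "src g k t = \<i> * of_real (beta k t) * g k t"

definition rho :: "nat \<Rightarrow> real \<Rightarrow> real" where "rho k x = 0 + integral {0..x} (beta k)"

lemma A_sum: "k < n \<Longrightarrow> (\<Sum>j<n. A lam k j t * v j) = \<i> * lam * of_real (beta k t) * v k
    - (\<Sum>j<n. Q k j t * v j)"
  by (simp add: A_def sum_subtractf left_diff_distrib if_distrib[of "\<lambda>x. x * _"] sum.delta cong: if_cong)

lemma coeffs: "lin_sys_coeffs l n (A lam)"
proof
  fix k j assume "k < n" "j < n"
  then show "A lam k j absolutely_integrable_on {0..l}"
    using beta_absint[of k] Q_absint[of k j] unfolding A_def[abs_def]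
    by (cases "k = j") (auto intro!: set_integral_diff absint_minus absint_cmult absint_of_real)
qed (use l_pos in auto)

lemmas ivp_unique = lin_sys_coeffs.lin_sys_unique[OF coeffs]

lemma rho_ac: "k < n \<Longrightarrow> ac l (rho k) (beta k)" unfolding rho_def[abs_def]
  by (rule ac_integral[OF beta_absint])

lemma rho_0 [simp]: "rho k 0 = 0" by (simp add: rho_def)

lemma src_absint: "cont_comps l n g \<Longrightarrow> k < n \<Longrightarrow> src g k absolutely_integrable_on {0..l}"
  unfolding src_def[abs_def] cont_comps_def
  by (intro absint_mult_cont2 absint_cmult absint_of_real beta_absint) auto

lemma src_add: "src (\<lambda>k t. g k t + c * g' k t) = (\<lambda>k t. src g k t + c * src g' k t)"
  by (auto simp: src_def fun_eq_iff algebra_simps)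

text \<open>The choice depends only on \<open>A lam\<close>, \<open>c\<close> and \<open>h\<close>.
  Two problems with equal coefficients, data and forcing therefore have literally the same chosen
  solution, which the reflection of the spectral parameter exploits.\<close>

definition ivp :: "complex \<Rightarrow> (nat \<Rightarrow> complex) \<Rightarrow> (nat \<Rightarrow> real \<Rightarrow> complex) \<Rightarrow> nat \<Rightarrow> real \<Rightarrow> complex" where
  "ivp lam c h = (SOME y. lin_sys l n (A lam) h y \<and> (\<forall>k<n. y k 0 = c k))"

lemma
  assumes "\<And>k. k < n \<Longrightarrow> h k absolutely_integrable_on {0..l}"
  shows ivp_lin_sys: "lin_sys l n (A lam) h (ivp lam c h)" and ivp_0: "k < n \<Longrightarrow> ivp lam c h k 0 = c k"
  using someI_ex[OF lin_sys_coeffs.lin_sys_exists[OF coeffs, of h lam c]] assms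
  unfolding ivp_def[symmetric] by blast+

definition E :: "nat \<Rightarrow> complex \<Rightarrow> nat \<Rightarrow> real \<Rightarrow> complex" where
  "E j lam = ivp lam (\<lambda>k. if k = j then 1 else 0) (\<lambda>_ _. 0)"

text \<open>The Volterra operator solving the inhomogeneous equation with zero data at 0. Unlike the
  resolvent of the boundary problem it exists for every \<open>lam\<close>, and its powers yield the
  Taylor coefficients in \<open>lam\<close>.\<close>

definition T :: "complex \<Rightarrow> (nat \<Rightarrow> real \<Rightarrow> complex) \<Rightarrow> nat \<Rightarrow> real \<Rightarrow> complex" where
  "T lam g = ivp lam (\<lambda>_. 0) (src g)"

lemma E_lin_sys: "lin_sys l n (A lam) (\<lambda>_ _. 0) (E j lam)" unfolding E_def by (rule ivp_lin_sys) simp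

lemma E_0: "k < n \<Longrightarrow> E j lam k 0 = (if k = j then 1 else 0)" unfolding E_def by (rule ivp_0) auto

lemma T_lin_sys: "cont_comps l n g \<Longrightarrow> lin_sys l n (A lam) (src g) (T lam g)" unfolding T_def
  by (rule ivp_lin_sys[OF src_absint])

lemma T_0: "cont_comps l n g \<Longrightarrow> k < n \<Longrightarrow> T lam g k 0 = 0" unfolding T_def by (rule ivp_0[OF src_absint])

lemma E_cont_comps: "cont_comps l n (E j lam)" by (rule lin_sys_cont_comps[OF E_lin_sys])
lemma T_cont_comps: "cont_comps l n g \<Longrightarrow> cont_comps l n (T lam g)"
  by (rule lin_sys_cont_comps[OF T_lin_sys])

lemma T_add_scaled:
  assumes "cont_comps l n u" "cont_comps l n v" "k < n" "0 \<le> x" "x \<le> l"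
  shows "T lam (\<lambda>k x. u k x + c * v k x) k x = T lam u k x + c * T lam v k x"
  using assms ivp_unique[OF T_lin_sys[OF cont_comps_add_scaled[OF assms(1,2)]]
      lin_sys_add_scaled[OF T_lin_sys[OF assms(1)] T_lin_sys[OF assms(2)], folded src_add] _ assms(3-5)]
  by (simp add: T_0 cont_comps_add_scaled)

text \<open>Conjugating by the diagonal exponential removes the real part of \<open>lam\<close> from the size of the
  coefficients, so the bound is uniform on horizontal strips.\<close>

lemma strip_bound:
  "\<exists>K\<ge>0. \<forall>lam h y x. \<bar>Im lam\<bar> \<le> S \<longrightarrow> lin_sys l n (A lam) h y
      \<longrightarrow> (\<forall>k<n. h k absolutely_integrable_on {0..l}) \<longrightarrow>
     0 \<le> x \<longrightarrow> x \<le> l \<longrightarrow> (\<Sum>k<n. cmod (y k x)) \<le> K * ((\<Sum>k<n. cmod (y k 0))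
         + (\<Sum>k<n. integral {0..l} (\<lambda>t. cmod (h k t))))"
proof -
  define b where "b = (\<Sum>k<n. integral {0..l} (\<lambda>t. \<bar>beta k t\<bar>))"
  define e where "e = exp (\<bar>S\<bar> * b)"
  define q where "q t = (\<Sum>k<n. \<Sum>j<n. cmod (Q k j t))" for t
  \<comment> \<open>One factor \<open>e\<close> comes from \<open>y = p * w\<close>, one from the
    transformed forcing term, and \<open>e * e\<close> in the exponent from the transformed
    potential \<open>r * Q * p\<close>.\<close>
  define K where "K = e * (e * exp (e * e * integral {0..l} q))"
  have babs: "(\<lambda>t. \<bar>beta k t\<bar>) absolutely_integrable_on {0..l}" if "k < n" for k
    using absint_norm[OF beta_absint[OF that]] by simp
  have Qn: "(\<lambda>t. cmod (Q k j t)) absolutely_integrable_on {0..l}" if "k < n" "j < n" for k j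
    using absint_norm[OF Q_absint[OF that]] by simp
  have q_absint: "q absolutely_integrable_on {0..l}" unfolding q_def[abs_def]
    by (intro absolutely_integrable_sum Qn) auto
  have rho_b: "\<bar>rho k x\<bar> \<le> b" if "k < n" "0 \<le> x" "x \<le> l" for k x
  proof -
    have "norm (rho k x - rho k 0) \<le> integral {0..x} (\<lambda>t. \<bar>beta k t\<bar>)"
      using that by (intro ac_norm_diff_le[OF rho_ac babs]) auto
    also have "\<dots> \<le> integral {0..l} (\<lambda>t. \<bar>beta k t\<bar>)"
      using that by (intro integral_Icc_mono babs) auto
    also have "\<dots> \<le> b" unfolding b_def
      using that by (intro member_le_sum[of k "{..<n}" "\<lambda>k. integral {0..l} (\<lambda>t. \<bar>beta k t\<bar>)"])
        (auto intro!: Henstock_Kurzweil_Integration.integral_nonneg absint_integrable[OF babs])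
    finally show ?thesis by simp
  qed
  have e0: "e > 0" by (simp add: e_def)
  show ?thesis
  proof (intro exI[of _ K] conjI allI impI)
    show "K \<ge> 0" using e0 by (simp add: K_def)
    fix lam h y x
    assume lam: "\<bar>Im lam\<bar> \<le> S" and y: "lin_sys l n (A lam) h y"
      and h: "\<forall>k<n. h k absolutely_integrable_on {0..l}" and x: "0 \<le> x" "x \<le> l"
    define p where "p k x = exp (\<i> * lam * of_real (rho k x))" for k x
    define r where "r k x = exp (- (\<i> * lam * of_real (rho k x)))" for k x
    have pr: "p k x * r k x = 1" for k x by (simp add: p_def r_def exp_minus)
    have pe: "cmod (p k x) \<le> e" and re: "cmod (r k x) \<le> e" if "k < n" "0 \<le> x" "x \<le> l" for k x
    proof -
      have "\<bar>Im lam * rho k x\<bar> \<le> \<bar>S\<bar> * b"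
        unfolding abs_mult using lam rho_b[OF that] by (intro mult_mono) auto
      then show "cmod (p k x) \<le> e" "cmod (r k x) \<le> e" by (auto simp: p_def r_def e_def)
    qed
    have rho_c: "continuous_on {0..l} (rho k)" if "k < n" for k using ac_continuous[OF rho_ac[OF that]] .
    have pc: "continuous_on {0..l} (p k)" and rc: "continuous_on {0..l} (r k)" if "k < n" for k
      unfolding p_def r_def by (intro continuous_intros rho_c that)+
    have r_ac: "ac l (r k) (\<lambda>t. r k t * - (\<i> * lam * of_real (beta k t)))" if "k < n" for k
      unfolding r_def
      by (rule ac_exp[OF ac_minus[OF ac_cmult[OF ac_linear[OF rho_ac[OF that] bounded_linear_of_real]]]])
    \<comment> \<open>For \<open>w = r * y\<close> the diagonal term
      \<open>\<i> * lam * beta k\<close> cancels; only the potential, conjugated by exponentials of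
      modulus at most \<open>e\<close>, is left.\<close>
    define A' where "A' k j t = - (r k t * (Q k j t * p j t))" for k j t
    define h' where "h' k t = r k t * h k t" for k t
    define w where "w k t = r k t * y k t" for k t
    interpret A': lin_sys_coeffs l n A'
    proof
      fix k j assume "k < n" "j < n"
      then show "A' k j absolutely_integrable_on {0..l}" unfolding A'_def[abs_def]
        by (intro absint_minus absint_mult_cont[OF rc] absint_mult_cont2[OF pc] Q_absint)
    qed (use l_pos in auto)
    have h'_absint: "h' k absolutely_integrable_on {0..l}" if "k < n" for k
      unfolding h'_def[abs_def] using that h by (intro absint_mult_cont[OF rc]) auto
    have w: "lin_sys l n A' h' w"
      unfolding lin_sys_def
    proof (intro allI impI)
      fix k assume k: "k < n"
      show "ac l (w k) (\<lambda>t. (\<Sum>j<n. A' k j t * w j t) + h' k t)"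
        unfolding w_def
      proof (rule ac_deriv_cong[OF ac_mult[OF r_ac[OF k] lin_sysD[OF y k]]])
        fix t
        have "A' k j t * (r j t * y j t) = - (r k t * (Q k j t * y j t))" for j
        proof -
          have "A' k j t * (r j t * y j t) = - (r k t * (Q k j t * y j t)) * (p j t * r j t)"
            unfolding A'_def by (simp add: algebra_simps)
          then show ?thesis by (simp add: pr)
        qed
        then have "(\<Sum>j<n. A' k j t * (r j t * y j t)) = - (r k t * (\<Sum>j<n. Q k j t * y j t))"
          by (simp add: sum_negf sum_distrib_left)
        then show "r k t * - (\<i> * lam * of_real (beta k t)) * y k t + r k t
            * ((\<Sum>j<n. A lam k j t * y j t) + h k t)
            = (\<Sum>j<n. A' k j t * (r j t * y j t)) + h' k t"
          unfolding A_sum[OF k] h'_def by (simp add: algebra_simps)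
      qed
    qed
    have an: "A'.anorm t \<le> e * e * q t" if "0 \<le> t" "t \<le> l" for t
    proof -
      have "cmod (A' k j t) \<le> e * e * cmod (Q k j t)" if "k < n" "j < n" for k j
      proof -
        have "cmod (A' k j t) = cmod (r k t) * cmod (p j t) * cmod (Q k j t)"
          by (simp add: A'_def norm_mult)
        also have "\<dots> \<le> e * e * cmod (Q k j t)"
          using re pe that \<open>0 \<le> t\<close> \<open>t \<le> l\<close> e0 by (intro mult_right_mono mult_mono) auto
        finally show ?thesis .
      qed
      then show ?thesis unfolding A'.anorm_def q_def sum_distrib_left by (intro sum_mono) auto
    qed
    have ian: "integral {0..l} A'.anorm \<le> e * e * integral {0..l} q"
    proof -
      have "integral {0..l} A'.anorm \<le> integral {0..l} (\<lambda>t. e * e * q t)"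
        using an q_absint A'.anorm_absint
        by (intro integral_le) (auto intro!: absint_integrable absint_cmult)
      then show ?thesis by simp
    qed
    have hi: "integral {0..l} (\<lambda>t. cmod (h' k t)) \<le> e * integral {0..l} (\<lambda>t. cmod (h k t))"
      if k: "k < n" for k
    proof -
      have "integral {0..l} (\<lambda>t. cmod (h' k t)) \<le> integral {0..l} (\<lambda>t. e * cmod (h k t))"
        using absolutely_integrable_norm[OF h'_absint[OF k]]
            absolutely_integrable_norm[OF h[rule_format, OF k]] re[OF k]
        by (intro integral_le absint_integrable absint_cmult)
          (auto simp: o_def h'_def norm_mult intro!: mult_right_mono)
      then show ?thesis by simp
    qed
    have "(\<Sum>k<n. cmod (y k x)) \<le> (\<Sum>k<n. e * cmod (w k x))"
    proof (rule sum_mono)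
      fix k assume "k \<in> {..<n}"
      then have k: "k < n" by simp
      have "y k x = y k x * (p k x * r k x)" by (simp add: pr)
      also have "\<dots> = p k x * w k x" by (simp add: w_def algebra_simps)
      finally have "cmod (y k x) = cmod (p k x) * cmod (w k x)" by (simp add: norm_mult)
      also have "\<dots> \<le> e * cmod (w k x)" using pe[OF k x] by (intro mult_right_mono) auto
      finally show "cmod (y k x) \<le> e * cmod (w k x)" .
    qed
    also have "\<dots> = e * (\<Sum>k<n. cmod (w k x))" by (simp add: sum_distrib_left)
    also have "\<dots> \<le> e * (((\<Sum>k<n. cmod (w k 0)) + (\<Sum>k<n. integral {0..l} (\<lambda>t. cmod (h' k t))))
        * exp (integral {0..l} A'.anorm))"
      using e0 by (intro mult_left_mono A'.lin_sys_bound[OF w h'_absint x]) auto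
    also have "\<dots> \<le> e * (e * ((\<Sum>k<n. cmod (y k 0)) + (\<Sum>k<n. integral {0..l} (\<lambda>t. cmod (h k t))))
        * exp (e * e * integral {0..l} q))"
    proof (intro mult_left_mono mult_mono)
      have e1: "e \<ge> 1"
        unfolding e_def b_def
        by (intro one_le_exp_iff[THEN iffD2] mult_nonneg_nonneg sum_nonneg
            Henstock_Kurzweil_Integration.integral_nonneg absint_integrable[OF babs]) auto
      show "(\<Sum>k<n. cmod (w k 0)) + (\<Sum>k<n. integral {0..l} (\<lambda>t. cmod (h' k t)))
          \<le> e * ((\<Sum>k<n. cmod (y k 0)) + (\<Sum>k<n. integral {0..l} (\<lambda>t. cmod (h k t))))"
        unfolding distrib_left sum_distrib_left
      proof (intro add_mono sum_mono hi)
        show "cmod (w k 0) \<le> e * cmod (y k 0)" for k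
          using mult_right_mono[OF e1, of "cmod (y k 0)"] by (simp add: w_def r_def)
      qed auto
      have "0 \<le> integral {0..l} (\<lambda>t. cmod (h k t))" if "k < n" for k
        using absolutely_integrable_norm[OF h[rule_format, OF that]]
        by (intro Henstock_Kurzweil_Integration.integral_nonneg absint_integrable) (auto simp: o_def)
      then show "0 \<le> e * ((\<Sum>k<n. cmod (y k 0)) + (\<Sum>k<n. integral {0..l} (\<lambda>t. cmod (h k t))))"
        using e0 by (intro mult_nonneg_nonneg add_nonneg_nonneg sum_nonneg) auto
    qed (use ian e0 in auto)
    finally show "(\<Sum>k<n. cmod (y k x)) \<le> K * ((\<Sum>k<n. cmod (y k 0))
        + (\<Sum>k<n. integral {0..l} (\<lambda>t. cmod (h k t))))"
      by (simp add: K_def algebra_simps)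
  qed
qed

lemma ivp_strip_bounded:
  assumes h: "\<And>k. k < n \<Longrightarrow> h k absolutely_integrable_on {0..l}"
  shows "\<exists>K\<ge>0. \<forall>lam k x. \<bar>Im lam\<bar> \<le> S \<longrightarrow> k < n \<longrightarrow> 0 \<le> x \<longrightarrow> x \<le> l \<longrightarrow> cmod (ivp lam c h k x) \<le> K"
proof -
  obtain K where K: "K \<ge> 0" "\<And>lam h y x. \<bar>Im lam\<bar> \<le> S \<Longrightarrow> lin_sys l n (A lam) h y
      \<Longrightarrow> (\<forall>k<n. h k absolutely_integrable_on {0..l}) \<Longrightarrow>
     0 \<le> x \<Longrightarrow> x \<le> l \<Longrightarrow> (\<Sum>k<n. cmod (y k x)) \<le> K * ((\<Sum>k<n. cmod (y k 0))
         + (\<Sum>k<n. integral {0..l} (\<lambda>t. cmod (h k t))))"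
    using strip_bound[of S] by blast
  have "0 \<le> integral {0..l} (\<lambda>t. cmod (h k t))" if "k < n" for k
    using absolutely_integrable_norm[OF h[OF that]]
    by (intro Henstock_Kurzweil_Integration.integral_nonneg absint_integrable) (auto simp: o_def)
  then have nn: "0 \<le> K * ((\<Sum>k<n. cmod (c k)) + (\<Sum>k<n. integral {0..l} (\<lambda>t. cmod (h k t))))"
    using K(1) by (intro mult_nonneg_nonneg add_nonneg_nonneg sum_nonneg) auto
  have "cmod (ivp lam c h k x) \<le> K * ((\<Sum>k<n. cmod (c k)) + (\<Sum>k<n. integral {0..l} (\<lambda>t. cmod (h k t))))"
    if "\<bar>Im lam\<bar> \<le> S" "k < n" "0 \<le> x" "x \<le> l" for lam k x
  proof -
    have "cmod (ivp lam c h k x) \<le> (\<Sum>k<n. cmod (ivp lam c h k x))"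
      using that by (intro member_le_sum[of k "{..<n}" "\<lambda>k. cmod (ivp lam c h k x)"]) auto
    with K(2)[OF that(1) ivp_lin_sys[of h lam c] _ that(3,4)] h ivp_0[of h _ lam c]
    show ?thesis by simp
  qed
  with nn show ?thesis by blast
qed

text \<open>The L1 norm of \<open>src g\<close> is at most the bound of \<open>g\<close> times the
  total mass \<open>b\<close> of the weights. Functionals may therefore be composed with
  \<open>T lam\<close> any number of times.\<close>

lemma T_bounded:
  "\<exists>K\<ge>0. \<forall>g B. cont_comps l n g \<longrightarrow> B \<ge> 0 \<longrightarrow> (\<forall>k<n. \<forall>x\<in>{0..l}. cmod (g k x) \<le> B) \<longrightarrow>
     (\<forall>k<n. \<forall>x\<in>{0..l}. cmod (T lam g k x) \<le> K * B)"
proof -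
  obtain K where K: "K \<ge> 0" "\<And>h y x. lin_sys l n (A lam) h y
      \<Longrightarrow> (\<forall>k<n. h k absolutely_integrable_on {0..l}) \<Longrightarrow>
     0 \<le> x \<Longrightarrow> x \<le> l \<Longrightarrow> (\<Sum>k<n. cmod (y k x)) \<le> K * ((\<Sum>k<n. cmod (y k 0))
         + (\<Sum>k<n. integral {0..l} (\<lambda>t. cmod (h k t))))"
    using strip_bound[of "\<bar>Im lam\<bar>"] by blast
  define b where "b = (\<Sum>k<n. integral {0..l} (\<lambda>t. \<bar>beta k t\<bar>))"
  have babs: "(\<lambda>t. \<bar>beta k t\<bar>) absolutely_integrable_on {0..l}" if "k < n" for k
    using absint_norm[OF beta_absint[OF that]] by simp
  have b0: "b \<ge> 0" unfolding b_def
    by (intro sum_nonneg Henstock_Kurzweil_Integration.integral_nonneg absint_integrable[OF babs]) auto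
  show ?thesis
  proof (intro exI[of _ "K * b"] conjI allI impI ballI)
    show "0 \<le> K * b" using K b0 by simp
    fix g B k x assume g: "cont_comps l n g" and B: "B \<ge> 0" "\<forall>k<n. \<forall>x\<in>{0..l}. cmod (g k x) \<le> B"
      and k: "k < n" and x: "x \<in> {0..l}"
    have "integral {0..l} (\<lambda>t. cmod (src g k t)) \<le> B * integral {0..l} (\<lambda>t. \<bar>beta k t\<bar>)" if "k < n" for k
    proof -
      have "integral {0..l} (\<lambda>t. cmod (src g k t)) \<le> integral {0..l} (\<lambda>t. B * \<bar>beta k t\<bar>)"
        using absolutely_integrable_norm[OF src_absint[OF g that]] babs[OF that] B that
        by (intro integral_le absint_integrable absint_cmult)
          (auto simp: o_def src_def norm_mult mult.commute[of B] intro!: mult_left_mono)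
      then show ?thesis by simp
    qed
    then have s: "(\<Sum>k<n. integral {0..l} (\<lambda>t. cmod (src g k t))) \<le> B * b"
      unfolding b_def sum_distrib_left by (intro sum_mono) auto
    have "cmod (T lam g k x) \<le> (\<Sum>k<n. cmod (T lam g k x))"
      using k by (intro member_le_sum[of k "{..<n}" "\<lambda>k. cmod (T lam g k x)"]) auto
    also have "\<dots> \<le> K * ((\<Sum>k<n. cmod (T lam g k 0)) + (\<Sum>k<n. integral {0..l} (\<lambda>t. cmod (src g k t))))"
      using x by (intro K(2)[OF T_lin_sys[OF g]]) (auto intro: src_absint[OF g])
    also have "\<dots> \<le> K * (B * b)"
      using s K(1) T_0[OF g] by (intro mult_left_mono) auto
    finally show "cmod (T lam g k x) \<le> K * b * B" by (simp add: algebra_simps)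
  qed
qed

lemma sup_functional_T: assumes "sup_functional l n \<phi>" shows "sup_functional l n (\<lambda>u. \<phi> (T lam u))"
  unfolding sup_functional_def
proof (intro conjI allI impI)
  fix u v c assume u: "cont_comps l n u" and v: "cont_comps l n v"
  have "\<phi> (T lam (\<lambda>k x. u k x + c * v k x)) = \<phi> (\<lambda>k x. T lam u k x + c * T lam v k x)"
    by (rule sup_functional_cong[OF assms]) (auto intro!: T_cont_comps cont_comps_add_scaled u v
        T_add_scaled)
  then show "\<phi> (T lam (\<lambda>k x. u k x + c * v k x)) = \<phi> (T lam u) + c * \<phi> (T lam v)"
    using sup_functional_add_scaled[OF assms T_cont_comps[OF u] T_cont_comps[OF v]] by simp
next
  obtain K where K: "K \<ge> 0" "\<And>u B. cont_comps l n u \<Longrightarrow> B \<ge> 0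
      \<Longrightarrow> (\<And>k x. k < n \<Longrightarrow> 0 \<le> x \<Longrightarrow> x \<le> l \<Longrightarrow> cmod (u k x) \<le> B) \<Longrightarrow> cmod (\<phi> u) \<le> K * B"
    using sup_functional_bound[OF assms] by blast
  obtain K' where K': "K' \<ge> 0" "\<And>g B k x. cont_comps l n g \<Longrightarrow> B \<ge> 0 \<Longrightarrow> (\<forall>k<n. \<forall>x\<in>{0..l}. cmod (g k x) \<le> B) \<Longrightarrow>
     k < n \<Longrightarrow> x\<in>{0..l} \<Longrightarrow> cmod (T lam g k x) \<le> K' * B" using T_bounded[of lam] by blast
  show "\<exists>K\<ge>0. \<forall>u B. cont_comps l n u \<longrightarrow> 0 \<le> B \<longrightarrow> (\<forall>k<n. \<forall>x\<in>{0..l}. cmod (u k x) \<le> B) \<longrightarrow> cmod (\<phi> (T lam u))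
      \<le> K * B"
  proof (intro exI[of _ "K * K'"] conjI allI impI)
    fix u B assume "cont_comps l n u" "0 \<le> B" "\<forall>k<n. \<forall>x\<in>{0..l}. cmod (u k x) \<le> B"
    then have "cmod (\<phi> (T lam u)) \<le> K * (K' * B)"
      using K'(1) by (intro K(2) T_cont_comps) (auto intro!: K'(2))
    then show "cmod (\<phi> (T lam u)) \<le> K * K' * B" by simp
  qed (use K K' in auto)
qed

lemma sup_functional_Tpow: "sup_functional l n \<phi> \<Longrightarrow> sup_functional l n (\<lambda>u. \<phi> ((T lam ^^ m) u))"
proof (induction m)
  case (Suc m)
  from sup_functional_T[OF Suc.IH[OF Suc.prems], of lam] show ?case by (simp add: funpow_swap1)
qed simp

section \<open>Taylor expansion and holomorphy in the spectral parameter\<close>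

context
  fixes c :: "nat \<Rightarrow> complex" and h :: "nat \<Rightarrow> real \<Rightarrow> complex"
  assumes h: "\<And>k. k < n \<Longrightarrow> h k absolutely_integrable_on {0..l}"
begin

lemma ivp_lsys': "lin_sys l n (A lam) h (ivp lam c h)"
  using ivp_lin_sys[where h = h and c = c] h by blast

lemma ivp_0': "k < n \<Longrightarrow> ivp lam c h k 0 = c k"
  using ivp_0[where h = h and c = c and k = k] h by blast

lemma ivp_cont_comps: "cont_comps l n (ivp lam c h)" by (rule lin_sys_cont_comps[OF ivp_lsys'])

text \<open>A resolvent identity: the solution at \<open>lam\<close> solves the equation at
  \<open>lam0\<close> with the additional forcing
  \<open>(lam - lam0) * src (ivp lam c h)\<close>.\<close>

lemma ivp_perturb:
  assumes "k < n" "0 \<le> x" "x \<le> l"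
  shows "ivp lam c h k x = ivp lam0 c h k x + (lam - lam0) * T lam0 (ivp lam c h) k x"
proof (rule ivp_unique[OF _ lin_sys_add_scaled[OF ivp_lsys' T_lin_sys[OF ivp_cont_comps]] _ assms])
  show "lin_sys l n (A lam0) (\<lambda>k t. h k t + (lam - lam0) * src (ivp lam c h) k t) (ivp lam c h)"
    by (rule lin_sys_cong[OF ivp_lsys']) (auto simp: A_sum src_def algebra_simps)
qed (simp add: ivp_0' T_0[OF ivp_cont_comps])

lemma sup_functional_ivp_perturb:
  assumes "sup_functional l n \<phi>"
  shows "\<phi> (ivp lam c h) = \<phi> (ivp lam0 c h) + (lam - lam0) * \<phi> (T lam0 (ivp lam c h))"
proof -
  have "\<phi> (ivp lam c h) = \<phi> (\<lambda>k x. ivp lam0 c h k x + (lam - lam0) * T lam0 (ivp lam c h) k x)"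
    by (rule sup_functional_cong[OF assms]) (auto intro!: ivp_perturb cont_comps_add_scaled
        T_cont_comps ivp_cont_comps)
  then show ?thesis using sup_functional_add_scaled[OF assms ivp_cont_comps
      T_cont_comps[OF ivp_cont_comps]] by simp
qed

text \<open>Iterating \<open>ivp_perturb\<close> inside the functional gives a Taylor polynomial
  with an exact remainder. The remainder contains the solution at \<open>lam\<close>, which the
  strip bound controls.\<close>

lemma sup_functional_ivp_expand:
  assumes "sup_functional l n \<phi>"
  shows "\<phi> (ivp lam c h) = (\<Sum>q<m. (lam - lam0) ^ q * \<phi> ((T lam0 ^^ q) (ivp lam0 c h)))
     + (lam - lam0) ^ m * \<phi> ((T lam0 ^^ m) (ivp lam c h))"
proof (induction m)
  case (Suc m)
  have "\<phi> ((T lam0 ^^ m) (ivp lam c h)) = \<phi> ((T lam0 ^^ m) (ivp lam0 c h)) + (lam - lam0)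
      * \<phi> ((T lam0 ^^ Suc m) (ivp lam c h))"
    using sup_functional_ivp_perturb[OF sup_functional_Tpow[OF assms, where m = m], of lam0 lam lam0]
      by (simp add: funpow_swap1)
  then show ?case unfolding Suc.IH
    by (simp only: sum.lessThan_Suc power_Suc2 distrib_left mult.assoc add.assoc)
qed simp

lemma sup_functional_ivp_strip_bounded:
  assumes "sup_functional l n \<phi>"
  shows "\<exists>K\<ge>0. \<forall>lam. \<bar>Im lam\<bar> \<le> S \<longrightarrow> cmod (\<phi> (ivp lam c h)) \<le> K"
proof -
  obtain K where K: "K \<ge> 0" "\<And>u B. cont_comps l n u \<Longrightarrow> B \<ge> 0
      \<Longrightarrow> (\<And>k x. k < n \<Longrightarrow> 0 \<le> x \<Longrightarrow> x \<le> l \<Longrightarrow> cmod (u k x) \<le> B) \<Longrightarrow> cmod (\<phi> u) \<le> K * B"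
    using sup_functional_bound[OF assms] by blast
  obtain K' where K': "K' \<ge> 0" "\<And>lam k x. \<bar>Im lam\<bar> \<le> S \<Longrightarrow> k < n \<Longrightarrow> 0 \<le> x \<Longrightarrow> x \<le> l \<Longrightarrow> cmod (ivp lam c h k x)
      \<le> K'"
    using ivp_strip_bounded[where h = h and S = S and c = c, OF h] by blast
  show ?thesis
    by (intro exI[of _ "K * K'"] conjI allI impI K ivp_cont_comps) (use K K' in auto)
qed

text \<open>In the expansion of order 2 the remainder factor is bounded on a strip around
  \<open>lam0\<close>, so the difference quotient converges to
  \<open>\<phi> (T lam0 (ivp lam0 c h))\<close>.\<close>

lemma sup_functional_ivp_holomorphic:
  assumes "sup_functional l n \<phi>"
  shows "(\<lambda>lam. \<phi> (ivp lam c h)) holomorphic_on UNIV"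
proof -
  have "((\<lambda>lam. \<phi> (ivp lam c h)) has_field_derivative \<phi> (T lam0 (ivp lam0 c h))) (at lam0)" for lam0
  proof -
    obtain K where K: "K \<ge> 0" "\<And>lam. \<bar>Im lam\<bar> \<le> \<bar>Im lam0\<bar> + 1 \<Longrightarrow> cmod (\<phi> ((T lam0 ^^ 2) (ivp lam c h)))
        \<le> K"
      using sup_functional_ivp_strip_bounded[OF sup_functional_Tpow[OF assms, where m = 2
        and lam = lam0], of "\<bar>Im lam0\<bar> + 1"] by blast
    have ex: "\<phi> (ivp lam c h) = \<phi> (ivp lam0 c h) + (lam - lam0) * \<phi> (T lam0 (ivp lam0 c h))
        + (lam - lam0)^2 * \<phi> ((T lam0 ^^ 2) (ivp lam c h))" for lam
      using sup_functional_ivp_expand[OF assms, where m = 2 and lam = lam and lam0 = lam0]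
        by (simp add: eval_nat_numeral)
    have "((\<lambda>lam. (\<phi> (ivp lam c h) - \<phi> (ivp lam0 c h)) / (lam - lam0) - \<phi> (T lam0 (ivp lam0 c h))) \<longlongrightarrow> 0)
        (at lam0)"
    proof (rule Lim_null_comparison)
      show "\<forall>\<^sub>F lam in at lam0. norm ((\<phi> (ivp lam c h) - \<phi> (ivp lam0 c h)) / (lam - lam0)
          - \<phi> (T lam0 (ivp lam0 c h))) \<le> K * cmod (lam - lam0)"
        unfolding eventually_at
      proof (intro exI[of _ 1] conjI ballI impI)
        fix lam assume a: "lam \<noteq> lam0 \<and> dist lam lam0 < 1"
        have "\<bar>Im (lam - lam0)\<bar> \<le> cmod (lam - lam0)" by (rule abs_Im_le_cmod)
        then have "\<bar>Im lam\<bar> \<le> \<bar>Im lam0\<bar> + 1" using a by (auto simp: dist_norm)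
        note k = K(2)[OF this]
        have "(\<phi> (ivp lam c h) - \<phi> (ivp lam0 c h)) / (lam - lam0) - \<phi> (T lam0 (ivp lam0 c h))
            = (lam - lam0) * \<phi> ((T lam0 ^^ 2) (ivp lam c h))"
          using a by (subst ex) (simp add: field_simps power2_eq_square)
        then show "norm ((\<phi> (ivp lam c h) - \<phi> (ivp lam0 c h)) / (lam - lam0)
            - \<phi> (T lam0 (ivp lam0 c h))) \<le> K * cmod (lam - lam0)"
          using mult_right_mono[OF k, of "cmod (lam - lam0)"] by (simp add: norm_mult mult.commute)
      qed simp
      have "((\<lambda>lam. K * cmod (lam - lam0)) \<longlongrightarrow> K * cmod (lam0 - lam0)) (at lam0)" by (intro tendsto_intros)
      then show "((\<lambda>lam. K * cmod (lam - lam0)) \<longlongrightarrow> 0) (at lam0)" by simp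
    qed
    then show ?thesis unfolding has_field_derivative_iff by (simp add: LIM_zero_iff)
  qed
  then show ?thesis unfolding holomorphic_on_def field_differentiable_def
    by (auto intro: has_field_derivative_at_within)
qed

end

end

section \<open>The boundary value problem and its root vectors\<close>

text \<open>Boundedness on horizontal strips survives sums and products, hence determinants, and it
  is invariant under real translations; the latter makes the translates a normal family in
  \<open>strip_quotient_bounded\<close>.\<close>

definition strip_entire :: "(complex \<Rightarrow> complex) \<Rightarrow> bool" where
  "strip_entire f \<longleftrightarrow> f holomorphic_on UNIV \<and> (\<forall>S. \<exists>K\<ge>0. \<forall>z. \<bar>Im z\<bar> \<le> S \<longrightarrow> cmod (f z) \<le> K)"

lemma strip_entire_holomorphic: "strip_entire f \<Longrightarrow> f holomorphic_on UNIV" by (simp add: strip_entire_def)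

lemma strip_entire_strip: "strip_entire f \<Longrightarrow> \<exists>K\<ge>0. \<forall>z. \<bar>Im z\<bar> \<le> S \<longrightarrow> cmod (f z) \<le> K"
  unfolding strip_entire_def by blast

lemma strip_entire_const: "strip_entire (\<lambda>_. c)"
  unfolding strip_entire_def by (auto intro!: exI[of _ "cmod c"])

lemma strip_entire_add:
  assumes "strip_entire f" "strip_entire g" shows "strip_entire (\<lambda>z. f z + g z)"
  unfolding strip_entire_def
proof (intro conjI allI)
  show "(\<lambda>z. f z + g z) holomorphic_on UNIV" using assms
    by (intro holomorphic_intros strip_entire_holomorphic)
  fix S
  obtain K K' where "K \<ge> 0" "\<And>z. \<bar>Im z\<bar> \<le> S \<Longrightarrow> cmod (f z) \<le> K" "K' \<ge> 0" "\<And>z. \<bar>Im z\<bar> \<le> S \<Longrightarrow> cmod (g z) \<le> K'"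
    using strip_entire_strip[OF assms(1)] strip_entire_strip[OF assms(2)] by metis
  then show "\<exists>K\<ge>0. \<forall>z. \<bar>Im z\<bar> \<le> S \<longrightarrow> cmod (f z + g z) \<le> K"
    by (intro exI[of _ "K + K'"]) (auto intro: norm_triangle_mono)
qed

lemma strip_entire_mult:
  assumes "strip_entire f" "strip_entire g" shows "strip_entire (\<lambda>z. f z * g z)"
  unfolding strip_entire_def
proof (intro conjI allI)
  show "(\<lambda>z. f z * g z) holomorphic_on UNIV" using assms
    by (intro holomorphic_intros strip_entire_holomorphic)
  fix S
  obtain K K' where "K \<ge> 0" "\<And>z. \<bar>Im z\<bar> \<le> S \<Longrightarrow> cmod (f z) \<le> K" "K' \<ge> 0" "\<And>z. \<bar>Im z\<bar> \<le> S \<Longrightarrow> cmod (g z) \<le> K'"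
    using strip_entire_strip[OF assms(1)] strip_entire_strip[OF assms(2)] by metis
  then show "\<exists>K\<ge>0. \<forall>z. \<bar>Im z\<bar> \<le> S \<longrightarrow> cmod (f z * g z) \<le> K"
    by (intro exI[of _ "K * K'"]) (auto intro!: mult_mono simp: norm_mult)
qed

lemma strip_entire_sum: "(\<And>i. i \<in> I \<Longrightarrow> strip_entire (f i)) \<Longrightarrow> strip_entire (\<lambda>z. \<Sum>i\<in>I. f i z)"
  by (induction I rule: infinite_finite_induct) (auto intro: strip_entire_add strip_entire_const)

lemma strip_entire_prod: "(\<And>i. i \<in> I \<Longrightarrow> strip_entire (f i)) \<Longrightarrow> strip_entire (\<lambda>z. \<Prod>i\<in>I. f i z)"
  by (induction I rule: infinite_finite_induct) (auto intro: strip_entire_mult strip_entire_const)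

lemma det_mat_Leibniz:
  "Determinant.det (Matrix.mat n n f) = (\<Sum>p | p permutes {0..<n}. signof p * (\<Prod>i=0..<n. f (i, p i)))"
proof -
  have "(\<Prod>i=0..<n. Matrix.mat n n f $$ (i, p i)) = (\<Prod>i=0..<n. f (i, p i))" if "p permutes {0..<n}" for p
    by (rule prod.cong) (use permutes_in_image[OF that] in auto)
  then show ?thesis by (simp add: Determinant.det_def)
qed

lemma strip_entire_det:
  assumes "\<And>i j. i < n \<Longrightarrow> j < n \<Longrightarrow> strip_entire (\<lambda>z. f z (i, j))"
  shows "strip_entire (\<lambda>z. Determinant.det (Matrix.mat n n (f z)))"
  unfolding det_mat_Leibniz
proof (intro strip_entire_sum strip_entire_mult strip_entire_const strip_entire_prod)
  fix p i assume p: "p \<in> {p. p permutes {0..<n}}" and i: "i \<in> {0..<n}"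
  then have "p i < n" using permutes_in_image[of p "{0..<n}" i] by auto
  with i show "strip_entire (\<lambda>z. f z (i, p i))" by (intro assms) auto
qed

lemma strip_entire_cofactor:
  assumes "\<And>i j. i < n \<Longrightarrow> j < n \<Longrightarrow> strip_entire (\<lambda>z. f z (i, j))" "r < n" "s < n"
  shows "strip_entire (\<lambda>z. cofactor (Matrix.mat n n (f z)) r s)"
proof -
  \<comment> \<open>A minor is again a determinant of entries of the same kind; \<open>?up\<close>
    skips the deleted row or column.\<close>
  let ?up = "\<lambda>a i. if i < a then i else Suc i"
  have "mat_delete (Matrix.mat n n (f z)) r s = Matrix.mat (n-1) (n-1)
      (\<lambda>(i,j). f z (?up r i, ?up s j))" for z
    unfolding mat_delete_def using assms(2,3) by (intro eq_matI) auto
  moreover have "strip_entire (\<lambda>z. Determinant.det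
      (Matrix.mat (n-1) (n-1) (\<lambda>(i,j). f z (?up r i, ?up s j))))"
    by (rule strip_entire_det) (use assms in auto)
  ultimately show ?thesis unfolding cofactor_def by (intro strip_entire_mult strip_entire_const) simp
qed

lemma cont_mult_integrable:
  "cont_comps l n u \<Longrightarrow> k < n \<Longrightarrow> beta absolutely_integrable_on {0..l} \<Longrightarrow>
    (\<lambda>x. \<bar>beta x\<bar> * (cmod (u k x))\<^sup>2) absolutely_integrable_on {0..l}"
  unfolding cont_comps_def
  by (drule absolutely_integrable_norm) (intro absint_mult_cont2, auto intro!: continuous_intros simp:
      o_def)

section \<open>Boundary forms and Cramer's rule\<close>

locale boundary_problem = first_order_system +
  fixes C D :: "complex mat"
  assumes C_car: "C \<in> carrier_mat n n" and D_car: "D \<in> carrier_mat n n"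
begin

definition U :: "nat \<Rightarrow> (nat \<Rightarrow> real \<Rightarrow> complex) \<Rightarrow> complex" where
  "U i y = (\<Sum>j<n. C $$ (i, j) * y j 0 + D $$ (i, j) * y j l)"

lemma sup_functional_U: "sup_functional l n (U i)"
  unfolding sup_functional_def
proof (intro conjI allI impI)
  show "U i (\<lambda>k x. u k x + c * v k x) = U i u + c * U i v" for u v c
    unfolding U_def by (simp add: sum.distrib sum_distrib_left algebra_simps)
  define K where "K = (\<Sum>j<n. cmod (C $$ (i, j)) + cmod (D $$ (i, j)))"
  show "\<exists>K\<ge>0. \<forall>u B. cont_comps l n u \<longrightarrow> 0 \<le> B \<longrightarrow> (\<forall>k<n. \<forall>x\<in>{0..l}. cmod (u k x) \<le> B) \<longrightarrow> cmod (U i u) \<le> K * B"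
  proof (intro exI[of _ K] conjI allI impI)
    show "K \<ge> 0" unfolding K_def by (intro sum_nonneg add_nonneg_nonneg) auto
    fix u B assume B: "\<forall>k<n. \<forall>x\<in>{0..l}. cmod (u k x) \<le> B"
    have "cmod (U i u) \<le> (\<Sum>j<n. (cmod (C $$ (i, j)) + cmod (D $$ (i, j))) * B)"
      unfolding U_def
    proof (intro sum_norm_le)
      fix j assume "j \<in> {..<n}"
      then have "cmod (u j 0) \<le> B" "cmod (u j l) \<le> B" using B l_pos by auto
      then show "cmod (C $$ (i, j) * u j 0 + D $$ (i, j) * u j l)
          \<le> (cmod (C $$ (i, j)) + cmod (D $$ (i, j))) * B"
        unfolding distrib_right by (intro norm_triangle_mono)
            (auto simp: norm_mult intro!: mult_left_mono)
    qed
    then show "cmod (U i u) \<le> K * B" unfolding K_def sum_distrib_right .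
  qed
qed

text \<open>Since the \<open>E j lam\<close> are the columns of the fundamental matrix, this is
  \<open>C + D * Phi_end\<close>, as the proof of \<open>Delta_eq_char_det\<close> confirms.\<close>

definition bc_mat :: "complex \<Rightarrow> complex mat" where
  "bc_mat lam = Matrix.mat n n (\<lambda>(i, j). U i (E j lam))"

definition char_det :: "complex \<Rightarrow> complex" where "char_det lam = Determinant.det (bc_mat lam)"

lemma bc_mat_car [simp]: "bc_mat lam \<in> carrier_mat n n" by (simp add: bc_mat_def)

lemma sup_functional_strip_entire_E: "sup_functional l n \<phi> \<Longrightarrow> strip_entire (\<lambda>lam. \<phi> (E j lam))"
  unfolding E_def strip_entire_def
    by (intro conjI allI sup_functional_ivp_holomorphic sup_functional_ivp_strip_bounded) auto

lemma sup_functional_strip_entire_T: "sup_functional l n \<phi> \<Longrightarrow> cont_comps l n g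
    \<Longrightarrow> strip_entire (\<lambda>lam. \<phi> (T lam g))"
  unfolding T_def strip_entire_def
    by (intro conjI allI sup_functional_ivp_holomorphic sup_functional_ivp_strip_bounded)
      (auto intro: src_absint)

lemma char_det_strip_entire: "strip_entire char_det"
  unfolding char_det_def[abs_def] bc_mat_def
    by (rule strip_entire_det) (auto intro: sup_functional_strip_entire_E sup_functional_U)

text \<open>The adjugate replaces the inverse of \<open>bc_mat lam\<close>, so these coefficients
  remain entire at the eigenvalues.\<close>

definition cramer_coef :: "(nat \<Rightarrow> real \<Rightarrow> complex) \<Rightarrow> nat \<Rightarrow> complex \<Rightarrow> complex" where
  "cramer_coef g j lam = (\<Sum>r<n. adj_mat (bc_mat lam) $$ (j, r) * U r (T lam g))"

lemma cramer_coef_strip_entire: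
  assumes "cont_comps l n g" "j < n" shows "strip_entire (cramer_coef g j)"
  unfolding cramer_coef_def[abs_def]
proof (intro strip_entire_sum strip_entire_mult sup_functional_strip_entire_T sup_functional_U assms)
  fix r assume r: "r \<in> {..<n}"
  have "strip_entire (\<lambda>lam. cofactor (bc_mat lam) r j)"
    unfolding bc_mat_def by (rule strip_entire_cofactor)
        (use r assms in \<open>auto intro: sup_functional_strip_entire_E sup_functional_U\<close>)
  moreover have "adj_mat (bc_mat lam) $$ (j, r) = cofactor (bc_mat lam) r j" for lam
    using r assms by (simp add: adj_mat_def bc_mat_def)
  ultimately show "strip_entire (\<lambda>lam. adj_mat (bc_mat lam) $$ (j, r))" by simp
qed

lemma bc_mat_cramer_coef: "i < n \<Longrightarrow> (\<Sum>j<n. U i (E j lam) * cramer_coef g j lam) = char_det lam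
    * U i (T lam g)"
proof -
  assume i: "i < n"
  have adj: "(\<Sum>j<n. U i (E j lam) * adj_mat (bc_mat lam) $$ (j, r))
      = (if i = r then char_det lam else 0)" if r: "r < n" for r
  proof -
    have ac: "adj_mat (bc_mat lam) \<in> carrier_mat n n" by (rule adj_mat(1)) simp
    have "(bc_mat lam * adj_mat (bc_mat lam)) $$ (i, r)
        = (\<Sum>j<n. U i (E j lam) * adj_mat (bc_mat lam) $$ (j, r))"
      using i r ac by (simp add: scalar_prod_def bc_mat_def lessThan_atLeast0)
    moreover have "(bc_mat lam * adj_mat (bc_mat lam)) $$ (i, r) = (if i = r then char_det lam else 0)"
      using i r by (simp add: adj_mat(2)[OF bc_mat_car] char_det_def)
    ultimately show ?thesis by simp
  qed
  have "(\<Sum>j<n. U i (E j lam) * cramer_coef g j lam)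
      = (\<Sum>j<n. \<Sum>r<n. U i (E j lam) * adj_mat (bc_mat lam) $$ (j, r) * U r (T lam g))"
    unfolding cramer_coef_def by (simp add: sum_distrib_left mult.assoc)
  also have "\<dots> = (\<Sum>r<n. (\<Sum>j<n. U i (E j lam) * adj_mat (bc_mat lam) $$ (j, r)) * U r (T lam g))"
    by (subst sum.swap) (simp add: sum_distrib_right)
  also have "\<dots> = (\<Sum>r<n. (if i = r then char_det lam else 0) * U r (T lam g))" using adj by simp
  also have "\<dots> = char_det lam * U i (T lam g)" using i
    by (simp add: if_distrib[of "\<lambda>x. x * _"] sum.delta cong: if_cong)
  finally show ?thesis .
qed

text \<open>Cramer's rule: \<open>N g lam\<close> is the resolvent at \<open>lam\<close> applied to \<open>g\<close>, times the determinant \<open>char_det lam\<close>.\<close>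

definition N :: "(nat \<Rightarrow> real \<Rightarrow> complex) \<Rightarrow> complex \<Rightarrow> nat \<Rightarrow> real \<Rightarrow> complex" where
  "N g lam = (\<lambda>k x. (\<Sum>j<n. - cramer_coef g j lam * E j lam k x) + char_det lam * T lam g k x)"

lemma N_lin_sys: assumes "cont_comps l n g"
  shows "lin_sys l n (A lam) (\<lambda>k t. char_det lam * src g k t) (N g lam)"
proof -
  have "lin_sys l n (A lam) (\<lambda>k t. (\<Sum>j<n. - cramer_coef g j lam * 0) + char_det lam * src g k t)
      (N g lam)"
    unfolding N_def by (intro lin_sys_add_scaled lin_sys_sum_scaled E_lin_sys T_lin_sys assms)
  then show ?thesis by simp
qed

lemma N_cont_comps: "cont_comps l n g \<Longrightarrow> cont_comps l n (N g lam)"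
  by (rule lin_sys_cont_comps[OF N_lin_sys])

lemma sup_functional_N:
  assumes "sup_functional l n \<phi>" "cont_comps l n g"
  shows "\<phi> (N g lam) = char_det lam * \<phi> (T lam g) - (\<Sum>j<n. cramer_coef g j lam * \<phi> (E j lam))"
proof -
  have "\<phi> (N g lam) = \<phi> (\<lambda>k x. \<Sum>j<n. - cramer_coef g j lam * E j lam k x) + char_det lam * \<phi> (T lam g)"
    unfolding N_def by (intro sup_functional_add_scaled[OF assms(1)] cont_comps_sum_scaled E_cont_comps
        T_cont_comps assms)
  also have "\<phi> (\<lambda>k x. \<Sum>j<n. - cramer_coef g j lam * E j lam k x)
      = (\<Sum>j<n. - cramer_coef g j lam * \<phi> (E j lam))"
    by (rule sup_functional_sum_scaled[OF assms(1) E_cont_comps])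
  finally show ?thesis by (simp add: sum_negf)
qed

lemma U_N: "cont_comps l n g \<Longrightarrow> i < n \<Longrightarrow> U i (N g lam) = 0"
  using bc_mat_cramer_coef[of i lam g] by (simp add: sup_functional_N[OF sup_functional_U] mult.commute)

lemma sup_functional_N_strip_entire:
  assumes "sup_functional l n \<phi>" "cont_comps l n g" shows "strip_entire (\<lambda>lam. \<phi> (N g lam))"
proof -
  have "strip_entire (\<lambda>lam. char_det lam * \<phi> (T lam g) + (-1)
      * (\<Sum>j<n. cramer_coef g j lam * \<phi> (E j lam)))"
    by (intro strip_entire_add strip_entire_mult strip_entire_const strip_entire_sum
        char_det_strip_entire cramer_coef_strip_entire sup_functional_strip_entire_E
        sup_functional_strip_entire_T assms) auto
  then show ?thesis by (simp add: sup_functional_N[OF assms])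
qed

section \<open>Root vectors as Taylor coefficients\<close>

lemma cont_comps_Hsp: "cont_comps l n u \<Longrightarrow> u \<in> Hsp n l beta"
  unfolding Hsp_def mem_Collect_eq lebesgue_on_absint_iff
  by (intro allI impI conjI cont_mult_integrable beta_absint
      continuous_imp_measurable_on_sets_lebesgue) (auto simp: cont_comps_def)

text \<open>At \<open>lam = 0\<close> the coefficient matrix is \<open>- Q\<close> and
  \<open>src f\<close> is \<open>\<i> B f\<close>, so the system is the integrated equation of the
  graph; a continuous \<open>u\<close> is its own representative.\<close>

lemma Lgraph_I:
  assumes u: "cont_comps l n u" and f: "cont_comps l n f" and s: "lin_sys l n (A 0) (src f) u"
    and bc: "\<And>i. i < n \<Longrightarrow> U i u = 0"
  shows "(u, f) \<in> Lgraph n l beta Q C D"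
proof -
  have eq: "(\<Sum>j<n. A 0 k j t * u j t) + src f k t = \<i> * of_real (beta k t) * f k t
      - (\<Sum>j<n. Q k j t * u j t)"
    if "k < n" for k t using that by (simp add: A_sum src_def)
  have ac: "ac l (u k) (\<lambda>t. \<i> * of_real (beta k t) * f k t - (\<Sum>j<n. Q k j t * u j t))" if "k < n" for k
    by (rule ac_deriv_cong[OF lin_sysD[OF s that]]) (simp add: eq that)
  have "C *\<^sub>v Matrix.vec n (\<lambda>j. u j 0) + D *\<^sub>v Matrix.vec n (\<lambda>j. u j l) = 0\<^sub>v n"
  proof (rule eq_vecI)
    fix i assume "i < dim_vec (0\<^sub>v n :: complex vec)"
    then have i: "i < n" by simp
    show "vec_index (C *\<^sub>v Matrix.vec n (\<lambda>j. u j 0) + D *\<^sub>v Matrix.vec n (\<lambda>j. u j l)) i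
        = vec_index (0\<^sub>v n) i"
      using bc[OF i] i C_car D_car by (simp add: scalar_prod_def U_def sum.distrib lessThan_atLeast0)
  qed (use D_car in auto)
  moreover have "integrable (lebesgue_on {0..l}) (\<lambda>t. \<i> * of_real (beta k t) * f k t
      - (\<Sum>j<n. Q k j t * u j t))"
    "u k x = u k 0 + integral\<^sup>L (lebesgue_on {0..x}) (\<lambda>t. \<i> * of_real (beta k t) * f k t
        - (\<Sum>j<n. Q k j t * u j t))"
    if "k < n" "x \<in> {0..l}" for k x
    using ac_absint[OF ac[OF that(1)]] ac_eq[OF ac[OF that(1)], of x]
        ac_absint_Icc[OF ac[OF that(1)], of 0 x] that(2)
    by (auto simp only: lebesgue_on_absint_iff absint_integral_eq atLeastAtMost_iff order_refl)
  moreover have "hnorm n l beta (\<lambda>k x. u k x - u k x) = 0" by (simp add: hnorm_def)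
  moreover have "0 \<in> {0..l}" using l_pos by simp
  ultimately show ?thesis
    unfolding Lgraph_def mem_Collect_eq prod.case
    using cont_comps_Hsp[OF u] cont_comps_Hsp[OF f] by (intro conjI exI[of _ u]) blast+
qed

text \<open>The equation at \<open>lam0\<close> forced by \<open>w\<close> says
  \<open>L v = w + lam0 v\<close>, that is, \<open>L - lam0\<close> maps \<open>v\<close> to
  \<open>w\<close>.\<close>

lemma root_step:
  assumes "cont_comps l n w" "lin_sys l n (A lam0) (src w) v" "\<And>i. i < n \<Longrightarrow> U i v
      = 0" "root_of n l beta Q C D lam0 m w"
  shows "root_of n l beta Q C D lam0 (Suc m) v"
proof -
  have v: "cont_comps l n v" by (rule lin_sys_cont_comps[OF assms(2)])
  have "(v, \<lambda>k x. w k x + lam0 * v k x) \<in> Lgraph n l beta Q C D"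
  proof (rule Lgraph_I[OF v cont_comps_add_scaled[OF assms(1) v] _ assms(3)])
    show "lin_sys l n (A 0) (src (\<lambda>k x. w k x + lam0 * v k x)) v"
      by (rule lin_sys_cong[OF assms(2)]) (simp, simp only: A_sum, simp add: src_def algebra_simps)
  qed
  then show ?thesis using assms(4) by (auto intro!: exI[of _ "\<lambda>k x. w k x + lam0 * v k x"])
qed

text \<open>The Taylor coefficients at \<open>lam0\<close> of a combination of the \<open>E j\<close> whose scalar coefficients
  have Taylor coefficients \<open>a j\<close>.\<close>

primrec chain :: "complex \<Rightarrow> (nat \<Rightarrow> nat \<Rightarrow> complex) \<Rightarrow> nat \<Rightarrow> nat \<Rightarrow> real \<Rightarrow> complex" where
  "chain lam0 a 0 = (\<lambda>k x. \<Sum>j<n. a j 0 * E j lam0 k x)"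
| "chain lam0 a (Suc i) = (\<lambda>k x. (\<Sum>j<n. a j (Suc i) * E j lam0 k x) + 1 * T lam0 (chain lam0 a i) k x)"

lemma chain_cont_comps: "cont_comps l n (chain lam0 a i)"
  by (induction i) (auto intro!: cont_comps_add_scaled[where c = 1, simplified] cont_comps_sum_scaled
      E_cont_comps T_cont_comps)

lemma chain_lin_sys_0: "lin_sys l n (A lam0) (src (\<lambda>_ _. 0)) (chain lam0 a 0)"
proof -
  have "lin_sys l n (A lam0) (\<lambda>k t. \<Sum>j<n. a j 0 * 0) (\<lambda>k x. \<Sum>j<n. a j 0 * E j lam0 k x)"
    by (intro lin_sys_sum_scaled E_lin_sys)
  then show ?thesis by (simp add: src_def[abs_def])
qed

lemma chain_lin_sys_Suc: "lin_sys l n (A lam0) (src (chain lam0 a i)) (chain lam0 a (Suc i))"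
proof -
  have "lin_sys l n (A lam0) (\<lambda>k t. (\<Sum>j<n. a j (Suc i) * 0) + 1 * src (chain lam0 a i) k t)
     (\<lambda>k x. (\<Sum>j<n. a j (Suc i) * E j lam0 k x) + 1 * T lam0 (chain lam0 a i) k x)"
    by (intro lin_sys_add_scaled lin_sys_sum_scaled E_lin_sys T_lin_sys chain_cont_comps)
  then show ?thesis by simp
qed

lemma chain_root:
  assumes "\<And>i r. i < m \<Longrightarrow> r < n \<Longrightarrow> U r (chain lam0 a i) = 0" "i < m"
  shows "root_of n l beta Q C D lam0 (Suc i) (chain lam0 a i)"
  using assms(2)
proof (induction i)
  case 0
  have "root_of n l beta Q C D lam0 0 (\<lambda>_ _. 0)" by (simp add: hnorm_def)
  from root_step[OF cont_comps_zero chain_lin_sys_0 assms(1)[OF 0] this] show ?case .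
next
  case (Suc i)
  then show ?case by (intro root_step[OF chain_cont_comps chain_lin_sys_Suc assms(1)[OF Suc.prems]]) auto
qed

text \<open>The Cauchy product of the coefficients \<open>a j\<close> with the Taylor coefficients
  \<open>(T lam0 ^^ q) (E j lam0)\<close>. The functional must vary in the induction, because each
  step moves one \<open>T lam0\<close> into it.\<close>

lemma sup_functional_chain:
  "sup_functional l n \<psi> \<Longrightarrow> \<psi> (chain lam0 a i) = (\<Sum>j<n. \<Sum>p\<le>i. a j p * \<psi> ((T lam0 ^^ (i - p)) (E j lam0)))"
proof (induction i arbitrary: \<psi>)
  case 0
  then show ?case using sup_functional_sum_scaled[OF 0 E_cont_comps] by simp
next
  case (Suc i)
  have "\<psi> (chain lam0 a (Suc i)) = (\<Sum>j<n. a j (Suc i) * \<psi> (E j lam0)) + \<psi> (T lam0 (chain lam0 a i))"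
  proof -
    have "\<psi> (chain lam0 a (Suc i)) = \<psi> (\<lambda>k x. \<Sum>j<n. a j (Suc i) * E j lam0 k x) + 1
        * \<psi> (T lam0 (chain lam0 a i))"
      unfolding chain.simps by (intro sup_functional_add_scaled[OF Suc.prems] cont_comps_sum_scaled
          E_cont_comps T_cont_comps chain_cont_comps)
    also have "\<psi> (\<lambda>k x. \<Sum>j<n. a j (Suc i) * E j lam0 k x) = (\<Sum>j<n. a j (Suc i) * \<psi> (E j lam0))"
      by (rule sup_functional_sum_scaled[OF Suc.prems E_cont_comps])
    finally show ?thesis by simp
  qed
  also have "\<psi> (T lam0 (chain lam0 a i)) = (\<Sum>j<n. \<Sum>p\<le>i. a j p
      * \<psi> (T lam0 ((T lam0 ^^ (i - p)) (E j lam0))))"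
    by (rule Suc.IH[OF sup_functional_T[OF Suc.prems]])
  also have "\<dots> = (\<Sum>j<n. \<Sum>p\<le>i. a j p * \<psi> ((T lam0 ^^ (Suc i - p)) (E j lam0)))"
    by (intro sum.cong refl) (simp add: Suc_diff_le)
  finally show ?case by (simp add: sum.distrib add.commute)
qed

text \<open>The term of degree \<open>p\<close> of \<open>d j\<close> is multiplied with
  \<open>E j\<close> expanded to order \<open>m - p\<close>, so that every remainder carries exactly
  the factor \<open>(z - lam0) ^ m\<close>.\<close>

lemma comb_expand:
  assumes \<psi>: "sup_functional l n \<psi>" and h: "\<And>j. j < n \<Longrightarrow> h j holomorphic_on UNIV"
    and d: "\<And>j z. j < n \<Longrightarrow> d j z = (\<Sum>p<m. a j p * (z - lam0) ^ p) + (z - lam0) ^ m * h j z"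
  shows "\<exists>r. r holomorphic_on UNIV \<and> (\<forall>z. (\<Sum>j<n. d j z * \<psi> (E j z)) =
     (\<Sum>i<m. \<psi> (chain lam0 a i) * (z - lam0) ^ i) + (z - lam0) ^ m * r z)"
proof -
  let ?T = "T lam0"
  define r where "r z = (\<Sum>j<n. (\<Sum>p<m. a j p * \<psi> ((?T ^^ (m - p)) (E j z))) + h j z * \<psi> (E j z))" for z
  have "r holomorphic_on UNIV" unfolding r_def
    by (intro holomorphic_intros h strip_entire_holomorphic[OF
        sup_functional_strip_entire_E[OF sup_functional_Tpow[OF \<psi>]]]
        strip_entire_holomorphic[OF sup_functional_strip_entire_E[OF \<psi>]]) auto
  moreover have "(\<Sum>j<n. d j z * \<psi> (E j z)) = (\<Sum>i<m. \<psi> (chain lam0 a i) * (z - lam0) ^ i)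
      + (z - lam0) ^ m * r z" for z
  proof -
    let ?u = "z - lam0"
    have expE: "?u ^ p * \<psi> (E j z) = (\<Sum>q<m-p. ?u ^ (p + q) * \<psi> ((?T ^^ q) (E j lam0))) + ?u ^ m
        * \<psi> ((?T ^^ (m - p)) (E j z))"
      if "p < m" for p j
    proof -
      have "\<psi> (E j z) = (\<Sum>q<m-p. ?u ^ q * \<psi> ((?T ^^ q) (E j lam0))) + ?u ^ (m - p)
          * \<psi> ((?T ^^ (m - p)) (E j z))"
        unfolding E_def by (rule sup_functional_ivp_expand[OF _ \<psi>]) simp
      then have "?u ^ p * \<psi> (E j z) = (\<Sum>q<m-p. ?u ^ p * ?u ^ q * \<psi> ((?T ^^ q) (E j lam0)))
         + ?u ^ p * ?u ^ (m - p) * \<psi> ((?T ^^ (m - p)) (E j z))"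
        by (simp add: distrib_left sum_distrib_left mult.assoc)
      then show ?thesis using that by (simp flip: power_add)
    qed
    have "d j z * \<psi> (E j z) = (\<Sum>i<m. (\<Sum>p\<le>i. a j p * \<psi> ((?T ^^ (i - p)) (E j lam0))) * ?u ^ i)
        + ?u ^ m * ((\<Sum>p<m. a j p * \<psi> ((?T ^^ (m - p)) (E j z))) + h j z * \<psi> (E j z))" if j: "j < n" for j
    proof -
      have "(\<Sum>p<m. a j p * ?u ^ p) * \<psi> (E j z) = (\<Sum>p<m. a j p * (?u ^ p * \<psi> (E j z)))"
        by (simp add: sum_distrib_right mult.assoc)
      also have "\<dots> = (\<Sum>p<m. (\<Sum>q<m-p. a j p * (?u ^ (p + q) * \<psi> ((?T ^^ q) (E j lam0))))
           + ?u ^ m * (a j p * \<psi> ((?T ^^ (m - p)) (E j z))))"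
        by (intro sum.cong refl) (simp add: expE distrib_left sum_distrib_left mult.left_commute)
      also have "\<dots> = (\<Sum>p<m. \<Sum>q<m-p. a j p * (?u ^ (p + q) * \<psi> ((?T ^^ q) (E j lam0))))
           + ?u ^ m * (\<Sum>p<m. a j p * \<psi> ((?T ^^ (m - p)) (E j z)))"
        by (simp add: sum.distrib sum_distrib_left)
      \<comment> \<open>Reindexing by the total degree \<open>i = p + q\<close> turns the triangle
        into Cauchy products.\<close>
      also have "(\<Sum>p<m. \<Sum>q<m-p. a j p * (?u ^ (p + q) * \<psi> ((?T ^^ q) (E j lam0))))
          = (\<Sum>(p,q)\<in>{(p,q). p + q < m}. a j p * (?u ^ (p + q) * \<psi> ((?T ^^ q) (E j lam0))))"
        by (subst sum.Sigma) (auto intro!: sum.cong)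
      also have "\<dots> = (\<Sum>i<m. \<Sum>p\<le>i. a j p * (?u ^ (p + (i - p)) * \<psi> ((?T ^^ (i - p)) (E j lam0))))"
        by (rule sum.triangle_reindex)
      also have "\<dots> = (\<Sum>i<m. (\<Sum>p\<le>i. a j p * \<psi> ((?T ^^ (i - p)) (E j lam0))) * ?u ^ i)"
        by (intro sum.cong refl) (simp add: sum_distrib_left sum_distrib_right mult_ac)
      finally show ?thesis unfolding d[OF j] by (simp add: algebra_simps)
    qed
    then have "(\<Sum>j<n. d j z * \<psi> (E j z)) = (\<Sum>j<n. (\<Sum>i<m. (\<Sum>p\<le>i. a j p * \<psi> ((?T ^^ (i - p)) (E j lam0)))
        * ?u ^ i)
        + ?u ^ m * ((\<Sum>p<m. a j p * \<psi> ((?T ^^ (m - p)) (E j z))) + h j z * \<psi> (E j z)))"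
      by (intro sum.cong) auto
    also have "\<dots> = (\<Sum>j<n. \<Sum>i<m. (\<Sum>p\<le>i. a j p * \<psi> ((?T ^^ (i - p)) (E j lam0))) * ?u ^ i) + ?u ^ m * r z"
      by (subst sum.distrib) (simp only: r_def sum_distrib_left)
    also have "(\<Sum>j<n. \<Sum>i<m. (\<Sum>p\<le>i. a j p * \<psi> ((?T ^^ (i - p)) (E j lam0))) * ?u ^ i)
        = (\<Sum>i<m. \<psi> (chain lam0 a i) * ?u ^ i)"
      by (subst sum.swap) (simp add: sup_functional_chain[OF \<psi>] sum_distrib_right)
    finally show ?thesis .
  qed
  ultimately show ?thesis by blast
qed

lemma holomorphic_bounded_ball:
  assumes "r holomorphic_on UNIV"
  shows "\<exists>K\<ge>0. \<forall>z. cmod (z - z0) \<le> 1 \<longrightarrow> cmod (r z) \<le> K"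
proof -
  have "bounded (r ` cball z0 1)"
    using assms by (intro compact_imp_bounded compact_continuous_image holomorphic_on_imp_continuous_on)
      (auto intro: holomorphic_on_subset)
  then obtain K where "K > 0" "\<forall>y\<in>r ` cball z0 1. cmod y \<le> K" unfolding bounded_pos by blast
  then show ?thesis by (intro exI[of _ K]) (auto simp: dist_norm norm_minus_commute)
qed

text \<open>In \<open>\<phi> (N g z)\<close> the term \<open>char_det z * \<phi> (T z g)\<close> is
  divisible by the determinant, so only the combination of the \<open>E j\<close> is expanded. Its
  Taylor coefficients form a chain for the differential equation by construction. They satisfy the
  boundary conditions because \<open>U s (N g z)\<close> vanishes identically and the determinant
  has order \<open>m\<close>. Being root vectors, they are annihilated by \<phi>, and the remainder
  of order \<open>m\<close> is bounded by a multiple of the determinant. The point \<open>z1\<close>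
  guarantees that the order is finite.\<close>

lemma pole_removal:
  assumes \<phi>: "sup_functional l n \<phi>" and g: "cont_comps l n g"
    and roots: "\<And>u m. cont_comps l n u \<Longrightarrow> root_of n l beta Q C D lam0 m u \<Longrightarrow> \<phi> u = 0"
    and z: "char_det lam0 = 0" and nz: "char_det z1 \<noteq> 0"
  shows "\<exists>K r. r > 0 \<and> (\<forall>z. cmod (z - lam0) < r \<longrightarrow> cmod (\<phi> (N g z)) \<le> K * cmod (char_det z))"
proof -
  obtain \<delta> r0 m where r0: "r0 > 0" "\<delta> holomorphic_on ball lam0 r0"
    "\<And>w. w \<in> ball lam0 r0 \<Longrightarrow> char_det w = (w - lam0) ^ m * \<delta> w" "\<And>w. w \<in> ball lam0 r0 \<Longrightarrow> \<delta> w \<noteq> 0"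
  proof (rule holomorphic_factor_zero_nonconstant[OF
      strip_entire_holomorphic[OF char_det_strip_entire], of lam0])
    show "\<not> char_det constant_on UNIV" unfolding constant_on_def using z nz by (metis UNIV_I)
  qed (use z in auto)
  have "\<forall>j\<in>{..<n}. \<exists>a h. h holomorphic_on UNIV \<and> (\<forall>z. cramer_coef g j z = (\<Sum>p<m. a p * (z - lam0) ^ p)
      + (z - lam0) ^ m * h z)"
    by (auto intro!: entire_Taylor_remainder strip_entire_holomorphic cramer_coef_strip_entire g)
  then obtain a h where h: "\<And>j. j < n \<Longrightarrow> h j holomorphic_on UNIV"
    and d: "\<And>j z. j < n \<Longrightarrow> cramer_coef g j z = (\<Sum>p<m. a j p * (z - lam0) ^ p) + (z - lam0) ^ m * h j z"
    unfolding bchoice_iff by (metis lessThan_iff)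
  have exp: "\<exists>r. r holomorphic_on UNIV \<and> (\<forall>z. \<psi> (N g z) = char_det z * \<psi> (T z g) -
     ((\<Sum>i<m. \<psi> (chain lam0 a i) * (z - lam0) ^ i) + (z - lam0) ^ m * r z))" if \<psi>: "sup_functional l n
         \<psi>" for \<psi>
  proof -
    obtain r where "r holomorphic_on UNIV" "\<And>z. (\<Sum>j<n. cramer_coef g j z * \<psi> (E j z)) =
     (\<Sum>i<m. \<psi> (chain lam0 a i) * (z - lam0) ^ i) + (z - lam0) ^ m * r z"
      using comb_expand[OF \<psi>, where h = h and d = "cramer_coef g" and m = m and a = a
        and ?lam0.0 = lam0] h d by blast
    then show ?thesis unfolding sup_functional_N[OF \<psi> g] by (intro exI[of _ r]) simp
  qed
  define r1 where "r1 = min (r0/2) 1"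
  have r1: "r1 > 0" "r1 \<le> 1" "r1 < r0" using r0(1) by (auto simp: r1_def)
  have "bounded (\<delta> ` cball lam0 r1)"
    using r0(2) r1 by (intro compact_imp_bounded compact_continuous_image
        holomorphic_on_imp_continuous_on)
      (auto intro: holomorphic_on_subset)
  then obtain L where L: "L > 0" "\<forall>y\<in>\<delta> ` cball lam0 r1. cmod y \<le> L" unfolding bounded_pos by blast
  have DlL: "char_det z = (z - lam0) ^ m * \<delta> z" "cmod (\<delta> z) \<le> L" if "cmod (z - lam0) < r1" for z
    using that r0(3)[of z] L(2) r1 by (auto simp: dist_norm norm_minus_commute)
  have bcs: "U s (chain lam0 a i) = 0" if i: "i < m" and s: "s < n" for i s
  proof -
    obtain r where r: "r holomorphic_on UNIV" and e: "\<And>z. U s (N g z) = char_det z * U s (T z g) -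
       ((\<Sum>i<m. U s (chain lam0 a i) * (z - lam0) ^ i) + (z - lam0) ^ m * r z)" using
           exp[OF sup_functional_U] by blast
    obtain K where K: "K \<ge> 0" "\<And>z. cmod (z - lam0) \<le> 1 \<Longrightarrow> cmod (r z) \<le> K"
      using holomorphic_bounded_ball[OF r] by blast
    obtain K' where K': "K' \<ge> 0" "\<And>z. cmod (z - lam0) \<le> 1 \<Longrightarrow> cmod (U s (T z g)) \<le> K'"
      using holomorphic_bounded_ball[OF strip_entire_holomorphic[OF
          sup_functional_strip_entire_T[OF sup_functional_U g]]] by blast
    show ?thesis
    proof (rule poly_coeffs_zero_if_small[OF r1(1) _ i])
      fix w assume w: "0 < cmod w" "cmod w < r1"
      define z where "z = lam0 + w"
      have zw: "z - lam0 = w" "cmod (z - lam0) < r1" "cmod (z - lam0) \<le> 1" using w r1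
        by (auto simp: z_def)
      \<comment> \<open>The identity \<open>U s (N g z) = 0\<close> leaves a polynomial of degree
        below \<open>m\<close> that equals \<open>w ^ m\<close> times a bounded function.\<close>
      have "(\<Sum>i<m. U s (chain lam0 a i) * w ^ i) = w ^ m * (\<delta> z * U s (T z g) - r z)"
        using e[of z] U_N[OF g s, of z] DlL(1)[OF zw(2)] zw(1) by (simp add: algebra_simps)
      then have "cmod (\<Sum>i<m. U s (chain lam0 a i) * w ^ i) = cmod w ^ m * cmod (\<delta> z * U s (T z g) - r z)"
        by (simp add: norm_mult norm_power)
      moreover have "cmod (\<delta> z * U s (T z g) - r z) \<le> L * K' + K"
        using DlL(2)[OF zw(2)] K(2)[OF zw(3)] K'(2)[OF zw(3)] L(1)
        by (intro norm_triangle_le_diff add_mono) (auto simp: norm_mult intro!: mult_mono)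
      ultimately show "cmod (\<Sum>i<m. U s (chain lam0 a i) * w ^ i) \<le> (L * K' + K) * cmod w ^ m"
        by (simp only: mult.commute[of _ "cmod w ^ m"] mult_left_mono norm_ge_zero zero_le_power)
    qed
  qed
  have \<phi>0: "\<phi> (chain lam0 a i) = 0" if "i < m" for i
    by (rule roots[OF chain_cont_comps chain_root[OF bcs that]])
  obtain r where r: "r holomorphic_on UNIV" and e: "\<And>z. \<phi> (N g z) = char_det z * \<phi> (T z g) -
     ((\<Sum>i<m. \<phi> (chain lam0 a i) * (z - lam0) ^ i) + (z - lam0) ^ m * r z)" using exp[OF \<phi>] by blast
  obtain K where K: "K \<ge> 0" "\<And>z. cmod (z - lam0) \<le> 1 \<Longrightarrow> cmod (r z) \<le> K"
    using holomorphic_bounded_ball[OF r] by blast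
  obtain K' where K': "K' \<ge> 0" "\<And>z. cmod (z - lam0) \<le> 1 \<Longrightarrow> cmod (\<phi> (T z g)) \<le> K'"
    using holomorphic_bounded_ball[OF strip_entire_holomorphic[OF
        sup_functional_strip_entire_T[OF \<phi> g]]] by blast
  have "continuous_on (cball lam0 r1) (\<lambda>z. inverse (\<delta> z))"
    using r0(2,4) r1 by (intro continuous_on_inverse holomorphic_on_imp_continuous_on)
      (auto intro: holomorphic_on_subset)
  then have "bounded ((\<lambda>z. inverse (\<delta> z)) ` cball lam0 r1)"
    by (intro compact_imp_bounded compact_continuous_image) auto
  then obtain L' where L': "L' > 0" "\<forall>y\<in>(\<lambda>z. inverse (\<delta> z)) ` cball lam0 r1. cmod y \<le> L'"
    unfolding bounded_pos by blast
  have "cmod (\<phi> (N g z)) \<le> (K' + K * L') * cmod (char_det z)" if zr: "cmod (z - lam0) < r1" for z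
  proof -
    have z1: "cmod (z - lam0) \<le> 1" using zr r1 by simp
    have dz: "\<delta> z \<noteq> 0" using r0(4)[of z] zr r1 by (auto simp: dist_norm norm_minus_commute)
    have l': "cmod (inverse (\<delta> z)) \<le> L'" using L'(2) zr by (auto simp: dist_norm norm_minus_commute)
    have "(z - lam0) ^ m = char_det z * inverse (\<delta> z)" using DlL(1)[OF zr] dz by simp
    then have "\<phi> (N g z) = char_det z * (\<phi> (T z g) - inverse (\<delta> z) * r z)"
      using e[of z] \<phi>0 by (simp add: algebra_simps)
    then have "cmod (\<phi> (N g z)) = cmod (char_det z) * cmod (\<phi> (T z g) - inverse (\<delta> z) * r z)"
      by (simp add: norm_mult)
    moreover have "cmod (\<phi> (T z g) - inverse (\<delta> z) * r z) \<le> K' + K * L'"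
      unfolding mult.commute[of K]
      using K(2)[OF z1] K'(2)[OF z1] l' L'(1)
      by (intro norm_triangle_le_diff add_mono) (auto simp only: norm_mult norm_ge_zero intro!: mult_mono)
    ultimately show ?thesis
      by (simp only: mult.commute[of _ "cmod (char_det z)"] mult_left_mono norm_ge_zero)
  qed
  then show ?thesis using r1(1) by blast
qed

end

section \<open>A priori estimates in a half plane\<close>

lemma integral_pos_if_AE_pos:
  fixes f :: "real \<Rightarrow> real"
  assumes f: "f absolutely_integrable_on {0..l}" and pos: "AE x in lebesgue_on {0..l}. f x > 0"
    and sx: "0 \<le> s" "s < x" "x \<le> l"
  shows "integral {s..x} f > 0"
proof -
  let ?M = "lebesgue_on {s..x}"
  have fsx: "f absolutely_integrable_on {s..x}" using absint_subset[OF f] sx by auto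
  then have int: "integrable ?M f" by (simp add: lebesgue_on_absint_iff)
  have "AE t in lebesgue. t \<in> {0..l} \<longrightarrow> f t > 0" using pos by (subst (asm) AE_restrict_space_iff) auto
  then have "AE t in lebesgue. t \<in> {s..x} \<longrightarrow> f t > 0" by eventually_elim (use sx in auto)
  then have ae: "AE t in ?M. f t > 0" by (subst AE_restrict_space_iff) auto
  then have ae0: "AE t in ?M. f t \<ge> 0" by eventually_elim auto
  have "integral\<^sup>L ?M f \<noteq> 0"
  proof
    assume "integral\<^sup>L ?M f = 0"
    then have "AE t in ?M. f t = 0" using integral_nonneg_eq_0_iff_AE[OF int ae0] by simp
    with ae have "AE t in ?M. False" by eventually_elim auto
    then have "emeasure ?M (space ?M) = 0" by (subst (asm) AE_iff_measurable[of "space ?M"]) auto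
    then show False using sx by (simp add: emeasure_restrict_space)
  qed
  moreover have "integral\<^sup>L ?M f \<ge> 0" using ae0 by (rule integral_nonneg_AE)
  ultimately show ?thesis using absint_integral_eq[OF fsx] by simp
qed

lemma exp_neg_mult_tendsto_0:
  fixes c :: real assumes "c > 0" shows "((\<lambda>\<kappa>. exp (- \<kappa> * c)) \<longlongrightarrow> 0) at_top"
proof -
  have "filterlim (\<lambda>\<kappa>. c * \<kappa>) at_top at_top"
    by (rule filterlim_tendsto_pos_mult_at_top[OF tendsto_const assms filterlim_ident])
  then have "((\<lambda>\<kappa>. inverse (exp (c * \<kappa>))) \<longlongrightarrow> 0) at_top"
    by (intro tendsto_inverse_0_at_top filterlim_compose[OF exp_at_top])
  then show ?thesis by (simp add: exp_minus mult.commute)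
qed

text \<open>The mass of \<open>q\<close> near \<open>x\<close> is small by absolute continuity of the integral, and away from \<open>x\<close> the
  exponential is small because \<open>r\<close> is injective on a compact interval.\<close>

lemma exp_kernel_small:
  fixes r q :: "real \<Rightarrow> real"
  assumes r: "continuous_on {0..l} r" "inj_on r {0..l}" and q: "q absolutely_integrable_on {0..l}"
    and q0: "\<And>t. 0 \<le> t \<Longrightarrow> t \<le> l \<Longrightarrow> q t \<ge> 0" and e: "e > 0"
  shows "\<forall>\<^sub>F \<kappa> in at_top. \<forall>x\<in>{0..l}. integral {0..l} (\<lambda>t. exp (- \<kappa> * \<bar>r x - r t\<bar>) * q t) \<le> e"
proof -
  define F where "F x = 0 + integral {0..x} q" for x
  have F: "ac l F q" unfolding F_def by (rule ac_integral[OF q])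
  have "uniformly_continuous_on {0..l} F" using ac_continuous[OF F]
    by (intro compact_uniformly_continuous) auto
  then obtain d where d: "d > 0" "\<And>x t. x \<in> {0..l} \<Longrightarrow> t \<in> {0..l} \<Longrightarrow> dist t x < d \<Longrightarrow> dist (F t) (F x) < e/2"
    unfolding uniformly_continuous_on_def using e by (metis half_gt_zero)
  \<comment> \<open>Pairs at distance at least \<open>d / 3\<close> form a compact set, on which the
    injective \<open>r\<close> separates points by a fixed \<eta>.\<close>
  define S where "S = ({0..l} \<times> {0..l}) \<inter> {z. d / 3 \<le> \<bar>fst z - snd z\<bar>}"
  have "closed {z::real\<times>real. d / 3 \<le> \<bar>fst z - snd z\<bar>}" by (intro closed_Collect_le continuous_intros)
  then have S: "compact S" unfolding S_def by (intro compact_Int_closed compact_Times) auto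
  obtain \<eta> where \<eta>: "\<eta> > 0" "\<And>x t. (x, t) \<in> S \<Longrightarrow> \<eta> \<le> \<bar>r x - r t\<bar>"
  proof (cases "S = {}")
    case True
    then show ?thesis using that[of 1] by auto
  next
    case False
    have "continuous_on S (\<lambda>z. \<bar>r (fst z) - r (snd z)\<bar>)"
      by (intro continuous_intros continuous_on_compose2[OF r(1)]) (auto simp: S_def)
    from continuous_attains_inf[OF S False this] obtain z where z: "z \<in> S"
      "\<forall>y\<in>S. \<bar>r (fst z) - r (snd z)\<bar> \<le> \<bar>r (fst y) - r (snd y)\<bar>" by blast
    have "r (fst z) \<noteq> r (snd z)" using z(1) d(1) inj_onD[OF r(2), of "fst z" "snd z"]
      by (auto simp: S_def)
    then show ?thesis using z(2) by (intro that[of "\<bar>r (fst z) - r (snd z)\<bar>"]) (auto dest: bspec)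
  qed
  define I where "I = integral {0..l} q"
  have q_int: "q integrable_on {0..l}" using q by (rule absint_integrable)
  have I0: "I \<ge> 0" unfolding I_def using q0
    by (intro Henstock_Kurzweil_Integration.integral_nonneg q_int) auto
  have "((\<lambda>\<kappa>. exp (- \<kappa> * \<eta>) * I) \<longlongrightarrow> 0 * I) at_top"
    using \<eta>(1) by (intro tendsto_intros exp_neg_mult_tendsto_0)
  then have "\<forall>\<^sub>F \<kappa> in at_top. exp (- \<kappa> * \<eta>) * I < e/2" using e by (intro order_tendstoD(2)) auto
  with eventually_ge_at_top[of 0] show ?thesis
  proof eventually_elim
    case (elim \<kappa>)
    show ?case
    proof
      fix x assume x: "x \<in> {0..l}"
      \<comment> \<open>The window of radius \<open>d / 3\<close> around \<open>x\<close> has length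
        below \<open>d\<close>, so its \<open>q\<close>-mass, an increment of \<open>F\<close>, is
        less than \<open>e / 2\<close>.\<close>
      define a b where "a = max 0 (x - d/3)" and "b = min l (x + d/3)"
      have ab: "0 \<le> a" "a \<le> b" "b \<le> l" "b - a < d" using x d(1) by (auto simp: a_def b_def)
      define k where "k t = exp (- \<kappa> * \<bar>r x - r t\<bar>)" for t
      have "continuous_on {0..l} k" unfolding k_def by (intro continuous_intros r(1))
      then have kq: "(\<lambda>t. k t * q t) absolutely_integrable_on {0..l}" by (rule absint_mult_cont[OF _ q])
      have kqi: "(\<lambda>t. k t * q t) integrable_on {0..l}" using kq by (rule absint_integrable)
      have qab: "(\<lambda>t. if t \<in> {a..b} then q t else 0) integrable_on {0..l}"
      proof -
        have "{a..b} \<inter> {0..l} = {a..b}" using ab by auto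
        moreover have "q integrable_on {a..b}"
          using absint_subset[OF q ab(1,3)] by (rule absint_integrable)
        ultimately show ?thesis by (simp only: integrable_restrict_Int)
      qed
      have "integral {0..l} (\<lambda>t. k t * q t) \<le> integral {0..l} (\<lambda>t. (if t \<in> {a..b} then q t else 0)
          + exp (- \<kappa> * \<eta>) * q t)"
      proof (rule integral_le)
        fix t assume t: "t \<in> {0..l}"
        show "k t * q t \<le> (if t \<in> {a..b} then q t else 0) + exp (- \<kappa> * \<eta>) * q t"
        proof (cases "t \<in> {a..b}")
          case True
          have qt: "q t \<ge> 0" using t q0 by simp
          then have "k t * q t \<le> 1 * q t" using elim(1) by (intro mult_right_mono) (simp_all add: k_def)
          moreover have "0 \<le> exp (- \<kappa> * \<eta>) * q t" using qt by simp
          ultimately show ?thesis using True by simp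
        next
          case False
          then have "d / 3 \<le> \<bar>x - t\<bar>" using t x unfolding a_def b_def atLeastAtMost_iff by linarith
          then have "(x, t) \<in> S" using t x by (simp add: S_def)
          then have "\<kappa> * \<eta> \<le> \<kappa> * \<bar>r x - r t\<bar>" using elim by (intro mult_left_mono \<eta>(2)) auto
          moreover have "q t \<ge> 0" using t q0 by simp
          ultimately have "k t * q t \<le> exp (- \<kappa> * \<eta>) * q t" unfolding k_def
            by (intro mult_right_mono) simp_all
          then show ?thesis unfolding if_not_P[OF False] by simp
        qed
      qed (intro kqi integrable_add qab integrable_on_mult_right q_int)+
      also have "\<dots> = integral {0..l} (\<lambda>t. if t \<in> {a..b} then q t else 0)
          + integral {0..l} (\<lambda>t. exp (- \<kappa> * \<eta>) * q t)"
        by (intro Henstock_Kurzweil_Integration.integral_add qab integrable_on_mult_right q_int)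
      also have "integral {0..l} (\<lambda>t. if t \<in> {a..b} then q t else 0) = integral {a..b} q"
      proof -
        have "{a..b} \<inter> {0..l} = {a..b}" using ab by auto
        with Henstock_Kurzweil_Integration.integral_restrict_Int[of "{0..l}" "{a..b}" q] show ?thesis
          by (simp only:)
      qed
      also have "\<dots> = F b - F a" using ac_diff_eq[OF F, of a b] ab by simp
      also have "\<dots> \<le> e/2" using d(2)[of a b] ab abs_ge_self[of "F b - F a"] by (auto simp: dist_norm)
      also have "integral {0..l} (\<lambda>t. exp (- \<kappa> * \<eta>) * q t) \<le> e/2" using elim by (simp add: I_def)
      finally show "integral {0..l} (\<lambda>t. exp (- \<kappa> * \<bar>r x - r t\<bar>) * q t) \<le> e" by (simp add: k_def)
    qed
  qed
qed

text \<open>Up to the determinant the adjugate is the inverse; the constant is the sum of the moduli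
  of its entries divided by that of the determinant.\<close>

lemma inverse_matrix_bound:
  fixes S :: "complex mat"
  assumes S: "S \<in> carrier_mat n n" and d: "Determinant.det S \<noteq> 0"
  shows "\<exists>K\<ge>0. \<forall>v. (\<Sum>k<n. cmod (v k)) \<le> K * (\<Sum>i<n. cmod (\<Sum>j<n. S $$ (i, j) * v j))"
proof -
  define B where "B = adj_mat S"
  have B: "B \<in> carrier_mat n n" unfolding B_def by (rule adj_mat(1)[OF S])
  have BS: "(\<Sum>i<n. B $$ (k, i) * S $$ (i, j)) = (if k = j then Determinant.det S else 0)"
    if "k < n" "j < n" for k j
  proof -
    have "(B * S) $$ (k, j) = (\<Sum>i<n. B $$ (k, i) * S $$ (i, j))"
      using that S B by (simp add: scalar_prod_def lessThan_atLeast0)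
    moreover have "(B * S) $$ (k, j) = (if k = j then Determinant.det S else 0)"
      using that by (simp add: B_def adj_mat(3)[OF S])
    ultimately show ?thesis by simp
  qed
  define K where "K = (\<Sum>k<n. \<Sum>i<n. cmod (B $$ (k, i))) / cmod (Determinant.det S)"
  show ?thesis
  proof (intro exI[of _ K] conjI allI)
    show "K \<ge> 0" unfolding K_def by (intro divide_nonneg_nonneg sum_nonneg) auto
    fix v
    define w where "w i = (\<Sum>j<n. S $$ (i, j) * v j)" for i
    have "v k * Determinant.det S = (\<Sum>i<n. B $$ (k, i) * w i)" if k: "k < n" for k
    proof -
      have "(\<Sum>i<n. B $$ (k, i) * w i) = (\<Sum>j<n. (\<Sum>i<n. B $$ (k, i) * S $$ (i, j)) * v j)"
        unfolding w_def sum_distrib_left sum_distrib_right by (subst sum.swap) (simp add: mult.assoc)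
      also have "\<dots> = (\<Sum>j<n. (if k = j then Determinant.det S else 0) * v j)" using BS k by simp
      also have "\<dots> = v k * Determinant.det S" using k
        by (simp add: if_distrib[of "\<lambda>x. x * _"] sum.delta cong: if_cong)
      finally show ?thesis ..
    qed
    note vk = this
    have le: "cmod (v k) * cmod (Determinant.det S) \<le> (\<Sum>i<n. cmod (B $$ (k, i))) * (\<Sum>i<n. cmod (w i))"
      if "k < n" for k
    proof -
      have "cmod (v k) * cmod (Determinant.det S) \<le> (\<Sum>i<n. cmod (B $$ (k, i)) * cmod (w i))"
        unfolding norm_mult[symmetric] vk[OF that] by (rule norm_sum)
      also have "\<dots> \<le> (\<Sum>i<n. cmod (B $$ (k, i)) * (\<Sum>i<n. cmod (w i)))"
        by (intro sum_mono mult_left_mono member_le_sum) auto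
      finally show ?thesis by (simp add: sum_distrib_right)
    qed
    have "(\<Sum>k<n. cmod (v k)) * cmod (Determinant.det S) \<le> (\<Sum>k<n. \<Sum>i<n. cmod (B $$ (k, i)))
        * (\<Sum>i<n. cmod (w i))"
    proof -
      have "(\<Sum>k<n. cmod (v k)) * cmod (Determinant.det S) = (\<Sum>k<n. cmod (v k) * cmod (Determinant.det S))"
        by (rule sum_distrib_right)
      also have "\<dots> \<le> (\<Sum>k<n. (\<Sum>i<n. cmod (B $$ (k, i))) * (\<Sum>i<n. cmod (w i)))"
        using le by (intro sum_mono) auto
      also have "\<dots> = (\<Sum>k<n. \<Sum>i<n. cmod (B $$ (k, i))) * (\<Sum>i<n. cmod (w i))"
        by (rule sum_distrib_right[symmetric])
      finally show ?thesis .
    qed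
    then show "(\<Sum>k<n. cmod (v k)) \<le> K * (\<Sum>i<n. cmod (\<Sum>j<n. S $$ (i, j) * v j))"
      using d by (simp add: K_def w_def field_simps)
  qed
qed

section \<open>Variation of constants along decaying exponentials\<close>

locale signed_problem = boundary_problem +
  assumes beta_sign: "\<And>k. k < n \<Longrightarrow> (AE x in lebesgue_on {0..l}. beta k x > 0) \<or>
      (AE x in lebesgue_on {0..l}. beta k x < 0)"
begin

definition pos :: "nat \<Rightarrow> bool" where "pos k \<longleftrightarrow> rho k l > 0"

text \<open>A weight of constant sign almost everywhere has a strictly monotone primitive, and its
  sign can be read off from \<open>rho k l\<close>. Injectivity of \<open>rho k\<close>, as
  \<open>exp_kernel_small\<close> demands, follows.\<close>

lemma rho_strict:
  assumes "k < n" "0 \<le> s" "s < x" "x \<le> l"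
  shows "if pos k then rho k s < rho k x else rho k x < rho k s"
proof -
  have d: "rho k x - rho k s = integral {s..x} (beta k)" if "0 \<le> s" "s < x" "x \<le> l" for s x
    using ac_diff_eq[OF rho_ac[OF assms(1)], of s x] that by simp
  consider "AE x in lebesgue_on {0..l}. beta k x > 0" | "AE x in lebesgue_on {0..l}. beta k x < 0"
    using beta_sign[OF assms(1)] by blast
  then show ?thesis
  proof cases
    case 1
    have "integral {s..x} (beta k) > 0" if "0 \<le> s" "s < x" "x \<le> l" for s x
      by (rule integral_pos_if_AE_pos[OF beta_absint[OF assms(1)] 1 that])
    from this[OF assms(2-4)] this[of 0 l] d[OF assms(2-4)] d[of 0 l] l_pos show ?thesis
      by (auto simp: pos_def)
  next
    case 2
    then have 2: "AE x in lebesgue_on {0..l}. - beta k x > 0" by simp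
    have "integral {s..x} (beta k) < 0" if "0 \<le> s" "s < x" "x \<le> l" for s x
      using integral_pos_if_AE_pos[OF absint_minus[OF beta_absint[OF assms(1)]] 2 that] by simp
    from this[OF assms(2-4)] this[of 0 l] d[OF assms(2-4)] d[of 0 l] l_pos show ?thesis
      by (auto simp: pos_def)
  qed
qed

lemma rho_mono:
  assumes "k < n" "0 \<le> s" "s \<le> x" "x \<le> l"
  shows "\<bar>rho k x - rho k s\<bar> = (if pos k then rho k x - rho k s else rho k s - rho k x)"
  using rho_strict[OF assms(1,2) _ assms(4)] assms(3) by (cases "s = x") (auto split: if_splits)

lemma rho_inj: "k < n \<Longrightarrow> inj_on (rho k) {0..l}"
proof (rule linorder_inj_onI)
  fix x y assume "k < n" "x < y" "x \<in> {0..l}" "y \<in> {0..l}"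
  then show "rho k x \<noteq> rho k y" using rho_strict[of k x y] by (auto split: if_splits)
qed auto

lemma rho_l_neq_0: "k < n \<Longrightarrow> rho k l \<noteq> 0"
  using rho_strict[of k 0 l] l_pos by (auto split: if_splits)

text \<open>With \<open>\<kappa> = Im lam\<close> this is the modulus of
  \<open>exp (\<i> * lam * (rho k x - rho k t))\<close> whenever \<open>t\<close> lies on the side
  of \<open>x\<close> from which the solution is integrated. The absolute value extends the decay to
  all \<open>t\<close>, so that integrals may be enlarged to the whole interval.\<close>

definition kern :: "real \<Rightarrow> nat \<Rightarrow> real \<Rightarrow> real \<Rightarrow> real" where
  "kern \<kappa> k x t = exp (- \<kappa> * \<bar>rho k x - rho k t\<bar>)"

lemma kern_cont: "k < n \<Longrightarrow> continuous_on {0..l} (kern \<kappa> k x)"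
  unfolding kern_def[abs_def] by (intro continuous_intros ac_continuous[OF rho_ac])

lemma kern_absint:
  "k < n \<Longrightarrow> f absolutely_integrable_on {0..l} \<Longrightarrow> (\<lambda>t. kern \<kappa> k x t * f t) absolutely_integrable_on {0..l}"
  by (rule absint_mult_cont[OF kern_cont])

text \<open>Variation of constants. The pair \<open>(s, x)\<close> is ordered so that
  \<open>rho k\<close> increases from \<open>s\<close> to \<open>x\<close>: to the right for
  positive weights and to the left for negative ones.\<close>

lemma scalar_estimate:
  assumes k: "k < n" and y: "ac l y (\<lambda>t. \<i> * lam * of_real (beta k t) * y t + h t)"
    and h: "h absolutely_integrable_on {0..l}"
    and sx: "0 \<le> a" "a \<le> b" "b \<le> l" "(s, x) = (if pos k then (a, b) else (b, a))"
  shows "cmod (y x) \<le> kern (Im lam) k x s * cmod (y s) + integral {a..b} (\<lambda>t. kern (Im lam) k x t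
      * cmod (h t))"
proof -
  define r where "r t = exp (- (\<i> * lam * of_real (rho k t)))" for t
  define w where "w t = r t * y t" for t
  have r_ac: "ac l r (\<lambda>t. r t * - (\<i> * lam * of_real (beta k t)))"
    unfolding r_def
    by (rule ac_exp[OF ac_minus[OF ac_cmult[OF ac_linear[OF rho_ac[OF k] bounded_linear_of_real]]]])
  have w: "ac l w (\<lambda>t. r t * h t)"
    unfolding w_def by (rule ac_deriv_cong[OF ac_mult[OF r_ac y]]) (simp add: algebra_simps)
  have rn: "cmod (r t) = exp (Im lam * rho k t)" for t by (simp add: r_def)
  have wn: "cmod (w t) = exp (Im lam * rho k t) * cmod (y t)" for t by (simp add: w_def norm_mult rn)
  have rhoc: "continuous_on {0..l} (rho k)" using ac_continuous[OF rho_ac[OF k]] .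
  have hn: "(\<lambda>t. cmod (h t)) absolutely_integrable_on {0..l}"
    using absint_norm[OF h] by simp
  have b_absint: "(\<lambda>t. exp (Im lam * rho k t) * cmod (h t)) absolutely_integrable_on {0..l}"
    by (intro absint_mult_cont[OF _ hn] continuous_intros rhoc)
  have "cmod (w b - w a) \<le> integral {a..b} (\<lambda>t. exp (Im lam * rho k t) * cmod (h t))"
    using sx by (intro ac_norm_diff_le[OF w b_absint]) (auto simp: norm_mult rn)
  moreover have "cmod (w x) \<le> cmod (w s) + cmod (w b - w a)"
    using sx(4) norm_triangle_sub[of "w b" "w a"] norm_triangle_sub[of "w a" "w b"]
    by (auto split: if_splits simp: norm_minus_commute)
  ultimately have "cmod (w x) \<le> cmod (w s) + integral {a..b} (\<lambda>t. exp (Im lam * rho k t) * cmod (h t))"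
    by simp
  then have "exp (- (Im lam * rho k x)) * cmod (w x) \<le> exp (- (Im lam * rho k x))
      * (cmod (w s) + integral {a..b} (\<lambda>t. exp (Im lam * rho k t) * cmod (h t)))"
    by (intro mult_left_mono) auto
  also have "exp (- (Im lam * rho k x)) * cmod (w x) = cmod (y x)" by (simp add: wn exp_minus)
  also have "exp (- (Im lam * rho k x)) * (cmod (w s) + integral {a..b} (\<lambda>t. exp (Im lam * rho k t)
      * cmod (h t)))
     = exp (- (Im lam * rho k x)) * exp (Im lam * rho k s) * cmod (y s)
         + integral {a..b} (\<lambda>t. exp (- (Im lam * rho k x)) * (exp (Im lam * rho k t) * cmod (h t)))"
    by (simp add: wn distrib_left)
  also have "integral {a..b} (\<lambda>t. exp (- (Im lam * rho k x)) * (exp (Im lam * rho k t) * cmod (h t)))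
      = integral {a..b} (\<lambda>t. kern (Im lam) k x t * cmod (h t))"
  proof (rule integral_cong)
    fix t assume t: "t \<in> {a..b}"
    have "\<bar>rho k x - rho k t\<bar> = rho k x - rho k t"
      using rho_mono[OF k, of t x] rho_mono[OF k, of x t] t sx by (auto split: if_splits)
    then show "exp (- (Im lam * rho k x)) * (exp (Im lam * rho k t) * cmod (h t)) = kern (Im lam) k x t
        * cmod (h t)"
      by (simp add: kern_def algebra_simps flip: exp_add)
  qed
  also have "exp (- (Im lam * rho k x)) * exp (Im lam * rho k s) = kern (Im lam) k x s"
  proof -
    have "\<bar>rho k x - rho k s\<bar> = rho k x - rho k s"
      using rho_mono[OF k, of s x] rho_mono[OF k, of x s] sx by (auto split: if_splits)
    then show ?thesis by (simp add: kern_def algebra_simps flip: exp_add)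
  qed
  finally show ?thesis .
qed

definition qrow :: "nat \<Rightarrow> real \<Rightarrow> real" where "qrow k t = (\<Sum>j<n. cmod (Q k j t))"

lemma qrow_absint: "k < n \<Longrightarrow> qrow k absolutely_integrable_on {0..l}"
  unfolding qrow_def[abs_def] using absolutely_integrable_norm[OF Q_absint]
  by (intro absolutely_integrable_sum) (auto simp: o_def)

text \<open>The endpoint of \<open>{0..x0}\<close> from which the \<open>k\<close>-th exponential decays in the upper half plane.\<close>

definition src_end :: "real \<Rightarrow> nat \<Rightarrow> real" where "src_end x0 k = (if pos k then 0 else x0)"

definition bdata :: "real \<Rightarrow> (nat \<Rightarrow> real \<Rightarrow> complex) \<Rightarrow> real" where
  "bdata x0 y = (\<Sum>k<n. cmod (y k (src_end x0 k)))"

text \<open>The coupling through \<open>Q\<close> is treated as part of the forcing. Because the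
  integrands are nonnegative, the integral may be extended to the whole interval, where
  \<open>exp_kernel_small\<close> will make the coupling factor \<open>e\<close> small.\<close>

lemma component_estimate:
  assumes y: "lin_sys l n (A lam) h y" and h: "\<And>k. k < n \<Longrightarrow> h k absolutely_integrable_on {0..l}"
    and k: "k < n" and x: "0 \<le> x" "x \<le> x0" "x0 \<le> l"
    and Y: "\<And>t. 0 \<le> t \<Longrightarrow> t \<le> x0 \<Longrightarrow> (\<Sum>j<n. cmod (y j t)) \<le> Y"
    and e: "integral {0..l} (\<lambda>t. kern (Im lam) k x t * qrow k t) \<le> e"
    and G: "integral {0..l} (\<lambda>t. kern (Im lam) k x t * cmod (h k t)) \<le> G"
  shows "cmod (y k x) \<le> kern (Im lam) k x (src_end x0 k) * cmod (y k (src_end x0 k)) + e * Y + G"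
proof -
  define f where "f t = h k t - (\<Sum>j<n. Q k j t * y j t)" for t
  have yc: "continuous_on {0..l} (y j)" if "j < n" for j using ac_continuous[OF lin_sysD[OF y that]] .
  have f: "f absolutely_integrable_on {0..l}"
    unfolding f_def using k by (intro set_integral_diff h absolutely_integrable_sum
        absint_mult_cont2[OF yc Q_absint]) auto
  have yk: "ac l (y k) (\<lambda>t. \<i> * lam * of_real (beta k t) * y k t + f t)"
    by (rule ac_deriv_cong[OF lin_sysD[OF y k]]) (simp add: A_sum[OF k] f_def)
  define a b where "a = (if pos k then 0 else x)" and "b = (if pos k then x else x0)"
  have ab: "0 \<le> a" "a \<le> b" "b \<le> x0" "b \<le> l" using x by (auto simp: a_def b_def)
  have Y0: "Y \<ge> 0" using Y[OF x(1,2)] sum_nonneg[of "{..<n}" "\<lambda>j. cmod (y j x)"] by simp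
  have hn: "(\<lambda>t. cmod (h k t)) absolutely_integrable_on {0..l}"
    using absint_norm[OF h[OF k]] by simp
  have fn: "(\<lambda>t. cmod (f t)) absolutely_integrable_on {0..l}"
    using absint_norm[OF f] by simp
  have q0: "qrow k t \<ge> 0" for t unfolding qrow_def by (intro sum_nonneg) auto
  let ?g = "\<lambda>t. kern (Im lam) k x t * qrow k t * Y + kern (Im lam) k x t * cmod (h k t)"
  have g1: "(\<lambda>t. kern (Im lam) k x t * qrow k t * Y) absolutely_integrable_on {0..l}"
    using absint_cmult[OF kern_absint[OF k qrow_absint[OF k]], of Y "Im lam" x]
      by (simp add: mult.commute)
  have g2: "(\<lambda>t. kern (Im lam) k x t * cmod (h k t)) absolutely_integrable_on {0..l}"
    by (rule kern_absint[OF k hn])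
  have g: "?g absolutely_integrable_on {0..l}" by (intro set_integral_add g1 g2)
  have int: "u integrable_on {c..d}" if "u absolutely_integrable_on {0..l}" "0 \<le> c" "d \<le> l"
    for u :: "real \<Rightarrow> real" and c d
    using absint_subset[OF that] by (auto intro: absint_integrable)
  have g0: "?g t \<ge> 0" for t using Y0 q0
    by (intro add_nonneg_nonneg mult_nonneg_nonneg) (auto simp: kern_def)
  have "cmod (y k x) \<le> kern (Im lam) k x (src_end x0 k) * cmod (y k (src_end x0 k))
      + integral {a..b} (\<lambda>t. kern (Im lam) k x t * cmod (f t))"
    by (rule scalar_estimate[OF k yk f ab(1,2,4)]) (auto simp: a_def b_def src_end_def)
  also have "integral {a..b} (\<lambda>t. kern (Im lam) k x t * cmod (f t)) \<le> integral {a..b} ?g"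
  proof (rule integral_le)
    fix t assume t: "t \<in> {a..b}"
    have "cmod (f t) \<le> cmod (h k t) + cmod (\<Sum>j<n. Q k j t * y j t)" unfolding f_def
      by (rule norm_triangle_ineq4)
    also have "cmod (\<Sum>j<n. Q k j t * y j t) \<le> (\<Sum>j<n. cmod (Q k j t) * Y)"
    proof (rule sum_norm_le)
      fix j assume j: "j \<in> {..<n}"
      have "cmod (y j t) \<le> (\<Sum>j<n. cmod (y j t))" using j
        by (intro member_le_sum[of j "{..<n}" "\<lambda>j. cmod (y j t)"]) auto
      also have "\<dots> \<le> Y" using Y t ab by auto
      finally show "cmod (Q k j t * y j t) \<le> cmod (Q k j t) * Y"
        by (auto simp: norm_mult intro: mult_left_mono)
    qed
    also have "\<dots> = qrow k t * Y" by (simp add: qrow_def sum_distrib_right)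
    finally have "kern (Im lam) k x t * cmod (f t) \<le> kern (Im lam) k x t * (cmod (h k t) + qrow k t * Y)"
      by (intro mult_left_mono) (auto simp: kern_def)
    then show "kern (Im lam) k x t * cmod (f t) \<le> ?g t" by (simp add: algebra_simps)
  qed (use ab in \<open>intro int kern_absint k fn g; simp\<close>)+
  also have "\<dots> \<le> integral {0..l} ?g" using ab g0 by (intro integral_Icc_mono[OF g]) auto
  also have "\<dots> = integral {0..l} (\<lambda>t. kern (Im lam) k x t * qrow k t * Y)
      + integral {0..l} (\<lambda>t. kern (Im lam) k x t * cmod (h k t))"
    by (intro Henstock_Kurzweil_Integration.integral_add int g1 g2) auto
  also have "integral {0..l} (\<lambda>t. kern (Im lam) k x t * qrow k t * Y)
      = integral {0..l} (\<lambda>t. kern (Im lam) k x t * qrow k t) * Y"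
    by simp
  also have "\<dots> \<le> e * Y" using e Y0 by (intro mult_right_mono)
  finally show ?thesis using G by simp
qed

text \<open>At a maximum point of the sum of moduli the coupling contributes at most half of the
  maximum and is absorbed. The right end \<open>x0\<close> is variable because
  \<open>boundary_det_lower\<close> needs the estimate on every initial subinterval.\<close>

lemma half_estimate:
  assumes y: "lin_sys l n (A lam) h y" and h: "\<And>k. k < n \<Longrightarrow> h k absolutely_integrable_on {0..l}"
    and lam: "Im lam \<ge> 0" and x0: "0 \<le> x0" "x0 \<le> l"
    and e: "\<And>k x. k < n \<Longrightarrow> 0 \<le> x \<Longrightarrow> x \<le> l \<Longrightarrow> integral {0..l} (\<lambda>t. kern (Im lam) k x t * qrow k t) \<le> e"
    and ne: "real n * e \<le> 1/2"
    and G: "\<And>k x. k < n \<Longrightarrow> 0 \<le> x \<Longrightarrow> x \<le> l \<Longrightarrow> integral {0..l} (\<lambda>t. kern (Im lam) k x t * cmod (h k t)) \<le> G"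
    and x: "0 \<le> x" "x \<le> x0"
  shows "(\<Sum>k<n. cmod (y k x)) \<le> 2 * (bdata x0 y + real n * G)"
proof -
  have "continuous_on {0..x0} (\<lambda>x. \<Sum>k<n. cmod (y k x))"
    using x0 by (intro continuous_intros continuous_on_subset[OF ac_continuous[OF lin_sysD[OF y]]]) auto
  from continuous_attains_sup[OF _ _ this] x0 obtain z where z: "z \<in> {0..x0}"
    "\<And>t. t \<in> {0..x0} \<Longrightarrow> (\<Sum>k<n. cmod (y k t)) \<le> (\<Sum>k<n. cmod (y k z))" by auto
  define Y where "Y = (\<Sum>k<n. cmod (y k z))"
  have Y0: "Y \<ge> 0" unfolding Y_def by (intro sum_nonneg) auto
  have "Y \<le> (\<Sum>k<n. cmod (y k (src_end x0 k)) + (e * Y + G))"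
    unfolding Y_def
  proof (rule sum_mono, fold Y_def)
    fix k assume "k \<in> {..<n}"
    then have k: "k < n" by simp
    have "cmod (y k z) \<le> kern (Im lam) k z (src_end x0 k) * cmod (y k (src_end x0 k)) + e * Y + G"
      by (rule component_estimate[OF y h k]) (use z x0 k e G in \<open>auto simp: Y_def\<close>)
    also have "kern (Im lam) k z (src_end x0 k) * cmod (y k (src_end x0 k)) \<le> 1
        * cmod (y k (src_end x0 k))"
      using lam by (intro mult_right_mono) (auto simp: kern_def)
    finally show "cmod (y k z) \<le> cmod (y k (src_end x0 k)) + (e * Y + G)" by simp
  qed
  also have "\<dots> = bdata x0 y + (real n * e) * Y + real n * G"
    by (simp add: sum.distrib bdata_def algebra_simps)
  also have "(real n * e) * Y \<le> 1/2 * Y" using ne Y0 by (rule mult_right_mono)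
  finally have "Y \<le> 2 * (bdata x0 y + real n * G)" by simp
  moreover have "(\<Sum>k<n. cmod (y k x)) \<le> Y" unfolding Y_def using z(2) x by auto
  ultimately show ?thesis by linarith
qed

section \<open>Regularity and the a priori estimate\<close>

definition Smat :: "complex mat" where
  "Smat = Matrix.mat n n (\<lambda>(i, j). if pos j then C $$ (i, j) else D $$ (i, j))"

text \<open>\<open>src_end l j\<close> is 0 or \<open>l\<close>, so \<open>l - src_end l j\<close>
  is the opposite endpoint.\<close>

lemma U_split:
  "U i y = (\<Sum>j<n. (if pos j then C $$ (i, j) else D $$ (i, j)) * y j (src_end l j)) +
           (\<Sum>j<n. (if pos j then D $$ (i, j) else C $$ (i, j)) * y j (l - src_end l j))"
  unfolding U_def sum.distrib[symmetric] by (intro sum.cong) (auto simp: src_end_def)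

definition Qsmall :: "real \<Rightarrow> real \<Rightarrow> bool" where
  "Qsmall e \<kappa> \<longleftrightarrow> (\<forall>k<n. \<forall>x\<in>{0..l}. integral {0..l} (\<lambda>t. kern \<kappa> k x t * qrow k t) \<le> e)"

lemma kern_int_small:
  assumes "\<And>k. k < n \<Longrightarrow> f k absolutely_integrable_on {0..l}" "e > 0"
    "\<And>k t. k < n \<Longrightarrow> 0 \<le> t \<Longrightarrow> t \<le> l \<Longrightarrow> f k t \<ge> 0"
  shows "\<forall>\<^sub>F \<kappa> in at_top. \<forall>k<n. \<forall>x\<in>{0..l}. integral {0..l} (\<lambda>t. kern \<kappa> k x t * f k t) \<le> e"
proof -
  have "\<forall>\<^sub>F \<kappa> in at_top. \<forall>k\<in>{..<n}. \<forall>x\<in>{0..l}. integral {0..l} (\<lambda>t. kern \<kappa> k x t * f k t) \<le> e"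
    unfolding kern_def using assms
    by (intro eventually_ball_finite ballI exp_kernel_small rho_inj ac_continuous[OF rho_ac]) auto
  then show ?thesis by (rule eventually_mono) auto
qed

lemma Qsmall_eventually: "e > 0 \<Longrightarrow> \<forall>\<^sub>F \<kappa> in at_top. Qsmall e \<kappa>"
  unfolding Qsmall_def by (intro kern_int_small qrow_absint) (auto simp: qrow_def intro!: sum_nonneg)

lemma end_small: "e > 0 \<Longrightarrow> \<forall>\<^sub>F \<kappa> in at_top. \<forall>k<n. kern \<kappa> k l 0 \<le> e"
proof -
  assume e: "e > 0"
  have "\<forall>\<^sub>F \<kappa> in at_top. kern \<kappa> k l 0 \<le> e" if k: "k < n" for k
  proof -
    have "((\<lambda>\<kappa>. exp (- \<kappa> * \<bar>rho k l\<bar>)) \<longlongrightarrow> 0) at_top"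
      using rho_l_neq_0[OF k] by (intro exp_neg_mult_tendsto_0) simp
    then have "\<forall>\<^sub>F \<kappa> in at_top. exp (- \<kappa> * \<bar>rho k l\<bar>) < e" using e by (rule order_tendstoD(2))
    then show ?thesis by eventually_elim (simp add: kern_def)
  qed
  then have "\<forall>\<^sub>F \<kappa> in at_top. \<forall>k\<in>{..<n}. kern \<kappa> k l 0 \<le> e" by (intro eventually_ball_finite) auto
  then show ?thesis by (rule eventually_mono) auto
qed

definition Gbound :: "real \<Rightarrow> (nat \<Rightarrow> real \<Rightarrow> complex) \<Rightarrow> real \<Rightarrow> bool" where
  "Gbound \<kappa> h G \<longleftrightarrow> G \<ge> 0 \<and> (\<forall>k<n. \<forall>x\<in>{0..l}. integral {0..l} (\<lambda>t. kern \<kappa> k x t * cmod (h k t)) \<le> G)"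

text \<open>All \<open>lam\<close> on the line \<open>Im lam = \<kappa>\<close> share the constant
  \<open>K\<close>; the treatment of the strip relies on this uniformity in the real part.\<close>

definition apriori :: "real \<Rightarrow> real \<Rightarrow> bool" where
  "apriori K \<kappa> \<longleftrightarrow> (\<forall>lam h y G. Im lam = \<kappa> \<longrightarrow> lin_sys l n (A lam) h y \<longrightarrow>
     (\<forall>k<n. h k absolutely_integrable_on {0..l}) \<longrightarrow> Gbound \<kappa> h G \<longrightarrow>
     bdata l y \<le> K * ((\<Sum>i<n. cmod (U i y)) + G) \<and>
     (\<forall>x\<in>{0..l}. (\<Sum>k<n. cmod (y k x)) \<le> K * ((\<Sum>i<n. cmod (U i y)) + G)))"

text \<open>\<open>Smat\<close> acts on the endpoint values from which the components decay, so
  \<open>reg\<close> lets these values be solved for. The opposite endpoint values consist of a part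
  damped by an exponential that has decayed over the whole interval, a part due to the small
  coupling, and the forcing; the first two are absorbed for large \<kappa>.\<close>

lemma main_estimate:
  assumes reg: "Determinant.det Smat \<noteq> 0"
  shows "\<exists>K\<ge>0. \<forall>\<^sub>F \<kappa> in at_top. apriori K \<kappa>"
proof -
  obtain K0 where K0: "K0 \<ge> 0" "\<And>v. (\<Sum>k<n. cmod (v k)) \<le> K0 * (\<Sum>i<n. cmod (\<Sum>j<n. Smat $$ (i, j) * v j))"
    using inverse_matrix_bound[of Smat n, OF _ reg] by (auto simp: Smat_def)
  define s' where "s' i j = (if pos j then D $$ (i, j) else C $$ (i, j))" for i j
  define K1 where "K1 = (\<Sum>i<n. \<Sum>j<n. cmod (s' i j))"
  have K1: "K1 \<ge> 0" unfolding K1_def by (intro sum_nonneg) auto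
  \<comment> \<open>\<tau> is chosen so that \<open>K0 * K1 * \<tau> \<le> 1/4\<close>, and
    \<open>e\<close> so that \<open>2 * real n * e \<le> \<tau>\<close>; then \<open>b\<close>
    reappears on the right with a factor at most 1/2.\<close>
  define \<tau> where "\<tau> = 1 / (4 * (K0 * K1 + 1))"
  define e where "e = \<tau> / (2 * (real n + 1))"
  \<comment> \<open>The four entries are the coefficients of \<open>W\<close> and \<open>G\<close>
    in the bounds for \<open>b\<close> and for \<open>Y = 2 * (b + real n * G)\<close>.\<close>
  define K where "K = max (2 * K0) (max (4 * K0 * K1 * real n)
      (max (4 * K0) (8 * K0 * K1 * real n + 2 * real n)))"
  have KK: "K0 * K1 \<ge> 0" using K0 K1 by simp
  have \<tau>0: "\<tau> > 0" "\<tau> \<le> 1/4" "K0 * K1 * \<tau> \<le> 1/4"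
    using KK by (auto simp: \<tau>_def field_simps)
  have e0: "e > 0" "2 * real n * e \<le> \<tau>" using \<tau>0 by (auto simp: e_def field_simps)
  have Kge: "K \<ge> 0" "2 * K0 \<le> K" "4 * K0 * K1 * real n \<le> K" "4 * K0 \<le> K" "8 * K0 * K1 * real n + 2
      * real n \<le> K"
    using K0 by (auto simp: K_def)
  have "\<forall>\<^sub>F \<kappa> in at_top. apriori K \<kappa>"
    using Qsmall_eventually[OF e0(1)] end_small[OF \<tau>0(1)] eventually_ge_at_top[of 0]
  proof eventually_elim
    case (elim \<kappa>)
    show ?case
      unfolding apriori_def
    proof (intro allI impI)
      fix lam h y G
      assume lam: "Im lam = \<kappa>" and y: "lin_sys l n (A lam) h y"
        and h: "\<forall>k<n. h k absolutely_integrable_on {0..l}"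
        and G: "Gbound \<kappa> h G"
      define W where "W = (\<Sum>i<n. cmod (U i y))"
      define b where "b = bdata l y"
      define Y where "Y = 2 * (b + real n * G)"
      have G0: "G \<ge> 0" using G by (simp add: Gbound_def)
      have b0: "b \<ge> 0" unfolding b_def bdata_def by (intro sum_nonneg) auto
      have ne: "real n * e \<le> 1/2" using e0 \<tau>0 by simp
      have Y: "(\<Sum>k<n. cmod (y k x)) \<le> Y" if "0 \<le> x" "x \<le> l" for x
        unfolding Y_def b_def
        by (rule half_estimate[OF y _ _ _ _ _ ne])
            (use h lam elim G l_pos that in \<open>auto simp: Qsmall_def Gbound_def\<close>)
      have other: "cmod (y k (l - src_end l k)) \<le> \<tau> * cmod (y k (src_end l k)) + (e * Y + G)"
        if k: "k < n" for k
      proof -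
        let ?x = "l - src_end l k"
        have x: "0 \<le> ?x" "?x \<le> l" using l_pos by (auto simp: src_end_def)
        have "cmod (y k ?x) \<le> kern (Im lam) k ?x (src_end l k) * cmod (y k (src_end l k)) + e * Y + G"
          by (rule component_estimate[OF y _ k]) (use h Y x k elim G lam in \<open>auto simp: Qsmall_def
              Gbound_def\<close>)
        also have "kern (Im lam) k ?x (src_end l k) = kern \<kappa> k l 0"
          by (simp add: lam kern_def src_end_def abs_minus_commute)
        also have "kern \<kappa> k l 0 * cmod (y k (src_end l k)) \<le> \<tau> * cmod (y k (src_end l k))"
          using elim k by (intro mult_right_mono) auto
        finally show ?thesis by simp
      qed
      have oth: "cmod (\<Sum>j<n. s' i j * y j (l - src_end l j)) \<le> (\<Sum>j<n. cmod (s' i j))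
          * (\<tau> * b + (e * real n * Y + real n * G))" for i
      proof -
        have "cmod (\<Sum>j<n. s' i j * y j (l - src_end l j))
            \<le> (\<Sum>j<n. cmod (s' i j) * cmod (y j (l - src_end l j)))"
          by (rule order_trans[OF norm_sum]) (simp add: norm_mult)
        also have "\<dots> \<le> (\<Sum>j<n. cmod (s' i j) * (\<Sum>j<n. cmod (y j (l - src_end l j))))"
          by (intro sum_mono mult_left_mono member_le_sum) auto
        also have "\<dots> = (\<Sum>j<n. cmod (s' i j)) * (\<Sum>j<n. cmod (y j (l - src_end l j)))"
          by (simp add: sum_distrib_right)
        also have "\<dots> \<le> (\<Sum>j<n. cmod (s' i j)) * (\<Sum>j<n. \<tau> * cmod (y j (src_end l j)) + (e * Y + G))"
          by (intro mult_left_mono sum_mono other sum_nonneg) auto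
        also have "(\<Sum>j<n. \<tau> * cmod (y j (src_end l j)) + (e * Y + G)) = \<tau> * b
            + (e * real n * Y + real n * G)"
          by (simp add: sum.distrib b_def bdata_def sum_distrib_left algebra_simps)
        finally show ?thesis .
      qed
      define V where "V = \<tau> * b + (e * real n * Y + real n * G)"
      have "b \<le> K0 * (\<Sum>i<n. cmod (\<Sum>j<n. Smat $$ (i, j) * y j (src_end l j)))"
        unfolding b_def bdata_def by (rule K0(2))
      also have "(\<Sum>i<n. cmod (\<Sum>j<n. Smat $$ (i, j) * y j (src_end l j)))
          \<le> (\<Sum>i<n. cmod (U i y) + (\<Sum>j<n. cmod (s' i j)) * V)"
      proof (rule sum_mono)
        fix i assume i: "i \<in> {..<n}"
        have "(\<Sum>j<n. Smat $$ (i, j) * y j (src_end l j)) = U i y - (\<Sum>j<n. s' i j * y j (l - src_end l j))"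
          unfolding U_split s'_def using i by (simp add: Smat_def)
        then show "cmod (\<Sum>j<n. Smat $$ (i, j) * y j (src_end l j)) \<le> cmod (U i y)
            + (\<Sum>j<n. cmod (s' i j)) * V"
          using oth[of i] norm_triangle_ineq4[of "U i y" "\<Sum>j<n. s' i j * y j (l - src_end l j)"]
            by (simp add: V_def)
      qed
      also have "\<dots> = W + K1 * V" by (simp add: sum.distrib W_def K1_def sum_distrib_right)
      finally have b1: "b \<le> K0 * W + K0 * K1 * V" using K0(1)
        by (simp add: distrib_left mult_left_mono mult.assoc)
      have V: "V = (\<tau> + 2 * real n * e) * b + (2 * real n * e + 1) * (real n * G)"
        by (simp add: V_def Y_def algebra_simps)
      have "V \<le> (2 * \<tau>) * b + 2 * (real n * G)"
        unfolding V using e0 \<tau>0 b0 G0 by (intro add_mono mult_right_mono) auto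
      then have "K0 * K1 * V \<le> K0 * K1 * ((2 * \<tau>) * b + 2 * (real n * G))" using KK
        by (rule mult_left_mono)
      also have "\<dots> = 2 * (K0 * K1 * \<tau>) * b + 2 * (K0 * K1 * real n * G)" by (simp add: algebra_simps)
      also have "2 * (K0 * K1 * \<tau>) * b \<le> 2 * (1/4) * b" using \<tau>0 b0
        by (intro mult_right_mono mult_left_mono) auto
      finally have b2: "b \<le> 2 * K0 * W + 4 * K0 * K1 * real n * G" using b1 by (simp add: algebra_simps)
      have W0: "W \<ge> 0" unfolding W_def by (intro sum_nonneg) auto
      have "b \<le> K * (W + G)"
      proof -
        have "2 * K0 * W \<le> K * W" "4 * K0 * K1 * real n * G \<le> K * G"
          using Kge W0 G0 by (auto intro: mult_right_mono)
        with b2 show ?thesis by (simp add: algebra_simps)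
      qed
      moreover have "Y \<le> K * (W + G)"
      proof -
        have "4 * K0 * W \<le> K * W" "(8 * K0 * K1 * real n + 2 * real n) * G \<le> K * G"
          using Kge W0 G0 by (auto intro: mult_right_mono)
        with b2 show ?thesis by (simp add: Y_def algebra_simps)
      qed
      ultimately show "bdata l y \<le> K * ((\<Sum>i<n. cmod (U i y)) + G) \<and>
          (\<forall>x\<in>{0..l}. (\<Sum>k<n. cmod (y k x)) \<le> K * ((\<Sum>i<n. cmod (U i y)) + G))"
        unfolding W_def b_def by (auto intro: order_trans[OF Y])
    qed
  qed
  with Kge(1) show ?thesis by blast
qed

end

section \<open>Lower bound for the characteristic determinant\<close>

text \<open>The product rule differentiates one factor of each Leibniz term; collecting terms by the
  row of that factor gives determinants with one row differentiated.\<close>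

lemma ac_det:
  assumes "\<And>i j. i < n \<Longrightarrow> j < n \<Longrightarrow> ac l (\<lambda>x. f x (i, j) :: complex) (\<lambda>x. f' x (i, j))"
  shows "ac l (\<lambda>x. Determinant.det (Matrix.mat n n (f x)))
    (\<lambda>x. \<Sum>k<n. Determinant.det (Matrix.mat n n (\<lambda>(i, j). if i = k then f' x (i, j) else f x (i, j))))"
proof -
  have pl: "p i < n" if "p permutes {0..<n}" "i < n" for p i
    using permutes_in_image[OF that(1), of i] that(2) by auto
  have "ac l (\<lambda>x. \<Sum>p | p permutes {0..<n}. signof p * (\<Prod>i=0..<n. f x (i, p i)))
     (\<lambda>x. \<Sum>p | p permutes {0..<n}. signof p * (\<Sum>k=0..<n. f' x (k, p k) * (\<Prod>i\<in>{0..<n}-{k}. f x (i, p i))))"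
  proof (rule ac_sum, rule ac_cmult, rule ac_prod)
    fix p i assume "p \<in> {p. p permutes {0..<n}}" "i \<in> {0..<n}"
    then show "ac l (\<lambda>x. f x (i, p i)) (\<lambda>x. f' x (i, p i))" by (intro assms pl[of p i]) simp_all
  qed simp
  moreover have "(\<Sum>p | p permutes {0..<n}. signof p * (\<Sum>k=0..<n. f' x (k, p k)
      * (\<Prod>i\<in>{0..<n}-{k}. f x (i, p i))))
    = (\<Sum>k<n. Determinant.det (Matrix.mat n n (\<lambda>(i, j). if i = k then f' x (i, j) else f x (i, j))))" for x
  proof -
    have "(\<Prod>i=0..<n. if i = k then f' x (i, p i) else f x (i, p i)) = f' x (k, p k)
        * (\<Prod>i\<in>{0..<n}-{k}. f x (i, p i))"
      if "k < n" for k p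
      using that by (subst prod.remove[of _ k]) (auto intro!: prod.cong)
    then have "(\<Sum>p | p permutes {0..<n}. signof p * (\<Sum>k=0..<n. f' x (k, p k)
        * (\<Prod>i\<in>{0..<n}-{k}. f x (i, p i))))
      = (\<Sum>p | p permutes {0..<n}. \<Sum>k=0..<n. signof p * (\<Prod>i=0..<n.
        if i = k then f' x (i, p i) else f x (i, p i)))"
      by (intro sum.cong refl) (simp add: sum_distrib_left)
    also have "\<dots> = (\<Sum>k=0..<n. \<Sum>p | p permutes {0..<n}. signof p
        * (\<Prod>i=0..<n. if i = k then f' x (i, p i) else f x (i, p i)))"
      by (rule sum.swap)
    finally show ?thesis unfolding det_mat_Leibniz by (simp add: lessThan_atLeast0)
  qed
  ultimately show ?thesis unfolding det_mat_Leibniz by simp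
qed

lemma det_replace_row:
  fixes f :: "nat \<times> nat \<Rightarrow> complex"
  assumes k: "k < n"
  shows "Determinant.det (Matrix.mat n n (\<lambda>(i, j). if i = k then w j else f (i, j)))
     = (\<Sum>j<n. w j * cofactor (Matrix.mat n n f) k j)"
proof -
  let ?R = "Matrix.mat n n (\<lambda>(i, j). if i = k then w j else f (i, j))"
  have "mat_delete ?R k j = mat_delete (Matrix.mat n n f) k j" if "j < n" for j
    unfolding mat_delete_def using k that by (intro eq_matI) auto
  then have "cofactor ?R k j = cofactor (Matrix.mat n n f) k j" if "j < n" for j
    using that by (simp add: cofactor_def)
  moreover have "Determinant.det ?R = (\<Sum>j<n. ?R $$ (k, j) * cofactor ?R k j)"
    by (rule laplace_expansion_row[OF _ k]) simp
  ultimately show ?thesis using k by simp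
qed

text \<open>For \<open>i \<noteq> k\<close> this is expansion along a foreign row. Row
  \<open>k\<close> of cofactors is therefore a vector on which every row but the k-th vanishes, and
  \<open>boundary_det_lower\<close> takes it as initial data.\<close>

lemma sum_row_cofactor:
  fixes f :: "nat \<times> nat \<Rightarrow> complex"
  assumes "i < n" "k < n"
  shows "(\<Sum>j<n. f (i, j) * cofactor (Matrix.mat n n f) k j)
      = (if i = k then Determinant.det (Matrix.mat n n f) else 0)"
proof -
  let ?A = "Matrix.mat n n f"
  have A: "?A \<in> carrier_mat n n" by simp
  have "(?A * adj_mat ?A) $$ (i, k) = (\<Sum>j<n. f (i, j) * cofactor ?A k j)"
    using assms by (simp add: adj_mat_def scalar_prod_def lessThan_atLeast0)
  moreover have "(?A * adj_mat ?A) $$ (i, k) = (if i = k then Determinant.det ?A else 0)"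
    using assms by (simp add: adj_mat(2)[OF A])
  ultimately show ?thesis by simp
qed

lemma norm_det_le:
  fixes f :: "nat \<times> nat \<Rightarrow> complex"
  assumes "\<And>i j. i < n \<Longrightarrow> j < n \<Longrightarrow> cmod (f (i, j)) \<le> B"
  shows "cmod (Determinant.det (Matrix.mat n n f)) \<le> fact n * B ^ n"
proof -
  have "cmod (Determinant.det (Matrix.mat n n f)) \<le> (\<Sum>p | p permutes {0..<n}. B ^ n)"
    unfolding det_mat_Leibniz
  proof (rule sum_norm_le)
    fix p assume p: "p \<in> {p. p permutes {0..<n}}"
    have "cmod (\<Prod>i=0..<n. f (i, p i)) \<le> (\<Prod>i=0..<n. B)"
      unfolding prod_norm[symmetric]
      using assms p permutes_in_image[of p "{0..<n}"] by (intro prod_mono) auto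
    moreover have "cmod (signof p) = 1" by (simp add: sign_def)
    ultimately show "cmod (signof p * (\<Prod>i=0..<n. f (i, p i))) \<le> B ^ n" by (simp add: norm_mult)
  qed
  also have "\<dots> = fact n * B ^ n" by (simp add: card_permutations[OF refl])
  finally show ?thesis .
qed

section \<open>The determinant of the data map\<close>

context signed_problem
begin

text \<open>The matrix of the map from the initial values of a solution to the data measured by \<open>bdata x\<close>.\<close>

definition boundary_mat :: "complex \<Rightarrow> real \<Rightarrow> nat \<times> nat \<Rightarrow> complex" where
  "boundary_mat lam x = (\<lambda>(i, j). if pos i then (if i = j then 1 else 0) else E j lam i x)"

definition boundary_det :: "complex \<Rightarrow> real \<Rightarrow> complex" where
  "boundary_det lam x = Determinant.det (Matrix.mat n n (boundary_mat lam x))"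

definition Ecomb :: "complex \<Rightarrow> (nat \<Rightarrow> complex) \<Rightarrow> nat \<Rightarrow> real \<Rightarrow> complex" where
  "Ecomb lam v = (\<lambda>k x. \<Sum>j<n. v j * E j lam k x)"

lemma Ecomb_lin_sys: "lin_sys l n (A lam) (\<lambda>_ _. 0) (Ecomb lam v)"
proof -
  have "lin_sys l n (A lam) (\<lambda>k t. \<Sum>j<n. v j * 0) (Ecomb lam v)"
    unfolding Ecomb_def by (intro lin_sys_sum_scaled E_lin_sys)
  then show ?thesis by simp
qed

lemma Ecomb_0: "k < n \<Longrightarrow> Ecomb lam v k 0 = v k"
  by (simp add: Ecomb_def E_0 if_distrib[of "\<lambda>x. _ * x"] sum.delta cong: if_cong)

lemma bdata_Ecomb: "bdata x (Ecomb lam v) = (\<Sum>i<n. cmod (\<Sum>j<n. boundary_mat lam x (i, j) * v j))"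
  unfolding bdata_def
proof (rule sum.cong[OF refl])
  fix i assume "i \<in> {..<n}"
  then have i: "i < n" by simp
  show "cmod (Ecomb lam v i (src_end x i)) = cmod (\<Sum>j<n. boundary_mat lam x (i, j) * v j)"
  proof (cases "pos i")
    case True
    then show ?thesis using i
      by (simp add: src_end_def Ecomb_0 boundary_mat_def if_distrib[of "\<lambda>x. x * _"] sum.delta cong:
          if_cong)
  next
    case False
    then show ?thesis by (simp add: src_end_def boundary_mat_def Ecomb_def mult.commute)
  qed
qed

lemma U_Ecomb: "i < n \<Longrightarrow> U i (Ecomb lam v) = (\<Sum>j<n. bc_mat lam $$ (i, j) * v j)"
  unfolding Ecomb_def by (subst sup_functional_sum_scaled[OF sup_functional_U E_cont_comps])
      (simp add: bc_mat_def mult.commute)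

text \<open>Write \<open>d\<close> for \<open>boundary_det lam\<close>. Differentiation by rows
  gives \<open>d' = \<i> * lam * Rb * d + q\<close>, where \<open>q\<close> combines minors that are
  not obviously controlled by \<open>d\<close>. The remedy: row \<open>k\<close> of cofactors, taken
  as initial values, defines a solution whose data \<open>bdata x\<close> equal
  \<open>cmod (d x)\<close>, and \<open>half_estimate\<close> on \<open>{0..x}\<close> bounds that
  solution by twice these data. So \<open>q\<close> is at most an integrable multiple of
  \<open>d\<close>, and apart from its exponential factor \<open>d\<close> cannot become small
  starting from \<open>d 0 = 1\<close>.\<close>

lemma boundary_det_lower:
  assumes lam: "Im lam \<ge> 0" and e: "Qsmall e (Im lam)" and ne: "real n * e \<le> 1/2"
  shows "cmod (boundary_det lam l) \<ge> exp (- Im lam * (\<Sum>k | k < n \<and> \<not> pos k. rho k l))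
      * exp (- (2 * (\<Sum>k<n. integral {0..l} (qrow k))))"
proof -
  let ?Ng = "{k. k < n \<and> \<not> pos k}"
  let ?cof = "\<lambda>x k j. cofactor (Matrix.mat n n (boundary_mat lam x)) k j"
  define boundary_mat' where "boundary_mat' x = (\<lambda>(i, j). if pos i then 0 else (\<Sum>m<n. A lam i m x
      * E j lam m x))" for x
  define R where "R x = (\<Sum>k\<in>?Ng. rho k x)" for x
  define Rb where "Rb x = (\<Sum>k\<in>?Ng. beta k x)" for x
  define q where "q x = - (\<Sum>k\<in>?Ng. \<Sum>m<n. Q k m x * (\<Sum>j<n. E j lam m x * ?cof x k j))" for x
  have fin: "finite ?Ng" by simp
  have boundary_mat_ac: "ac l (\<lambda>x. boundary_mat lam x (i, j)) (\<lambda>x. boundary_mat' x (i, j))"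
    if "i < n" "j < n" for i j
    using lin_sysD[OF E_lin_sys[of lam j] that(1)]
      by (cases "pos i") (auto simp: boundary_mat_def boundary_mat'_def)
  have d_ac: "ac l (boundary_det lam) (\<lambda>x. \<i> * lam * of_real (Rb x) * boundary_det lam x + q x)"
    unfolding boundary_det_def[abs_def]
  proof (rule ac_deriv_cong[OF ac_det[where f = "boundary_mat lam" and f' = boundary_mat' and n = n
    and l = l, OF boundary_mat_ac]])
    fix x assume x: "0 \<le> x" "x \<le> l"
    have row: "Determinant.det (Matrix.mat n n (\<lambda>(i, j). if i
        = k then boundary_mat' x (i, j) else boundary_mat lam x (i, j)))
        = (if pos k then 0 else \<i> * lam * of_real (beta k x) * boundary_det lam x
            - (\<Sum>m<n. Q k m x * (\<Sum>j<n. E j lam m x * ?cof x k j)))"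
      if k: "k < n" for k
    proof -
      have eq: "Matrix.mat n n (\<lambda>(i, j). if i = k then boundary_mat' x (i, j) else boundary_mat lam x
          (i, j)) =
         Matrix.mat n n (\<lambda>(i, j). if i = k then boundary_mat' x (k, j) else boundary_mat lam x (i, j))"
             by (rule eq_matI) auto
      have "Determinant.det (Matrix.mat n n (\<lambda>(i, j). if i
          = k then boundary_mat' x (i, j) else boundary_mat lam x (i, j)))
        = (\<Sum>j<n. boundary_mat' x (k, j) * ?cof x k j)" unfolding eq by
            (rule det_replace_row[OF k, where w = "\<lambda>j. boundary_mat' x (k, j)"
          and f = "boundary_mat lam x"])
      also have "\<dots> = (if pos k then 0 else \<i> * lam * of_real (beta k x) * boundary_det lam x
          - (\<Sum>m<n. Q k m x * (\<Sum>j<n. E j lam m x * ?cof x k j)))"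
      proof (cases "pos k")
        case False
        have "(\<Sum>j<n. boundary_mat' x (k, j) * ?cof x k j)
            = (\<Sum>j<n. \<i> * lam * of_real (beta k x) * (boundary_mat lam x (k, j) * ?cof x k j)
            - (\<Sum>m<n. Q k m x * (E j lam m x * ?cof x k j)))"
          using False by (intro sum.cong refl) (simp add: boundary_mat'_def boundary_mat_def
              A_sum[OF k] left_diff_distrib sum_distrib_right mult.assoc)
        also have "\<dots> = \<i> * lam * of_real (beta k x) * (\<Sum>j<n. boundary_mat lam x (k, j) * ?cof x k j)
            - (\<Sum>j<n. \<Sum>m<n. Q k m x * (E j lam m x * ?cof x k j))"
          by (simp add: sum_subtractf sum_distrib_left)
        also have "(\<Sum>j<n. boundary_mat lam x (k, j) * ?cof x k j) = boundary_det lam x"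
          using sum_row_cofactor[OF k k, of "boundary_mat lam x"] by (simp add: boundary_det_def)
        also have "(\<Sum>j<n. \<Sum>m<n. Q k m x * (E j lam m x * ?cof x k j))
            = (\<Sum>m<n. Q k m x * (\<Sum>j<n. E j lam m x * ?cof x k j))"
          by (subst sum.swap) (simp add: sum_distrib_left)
        finally show ?thesis using False by simp
      qed (simp add: boundary_mat'_def)
      finally show ?thesis .
    qed
    have "(\<Sum>k<n. Determinant.det (Matrix.mat n n (\<lambda>(i, j). if i
        = k then boundary_mat' x (i, j) else boundary_mat lam x (i, j))))
       = (\<Sum>k<n. if pos k then 0 else \<i> * lam * of_real (beta k x) * boundary_det lam x
           - (\<Sum>m<n. Q k m x * (\<Sum>j<n. E j lam m x * ?cof x k j)))"
      using row by (intro sum.cong) auto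
    also have "\<dots> = (\<Sum>k\<in>?Ng. \<i> * lam * of_real (beta k x) * boundary_det lam x
        - (\<Sum>m<n. Q k m x * (\<Sum>j<n. E j lam m x * ?cof x k j)))"
      by (rule sum.mono_neutral_cong_right) auto
    also have "\<dots> = \<i> * lam * of_real (Rb x) * boundary_det lam x + q x"
      by (simp add: sum_subtractf Rb_def q_def sum_distrib_left sum_distrib_right)
    finally show "(\<Sum>k<n. Determinant.det (Matrix.mat n n (\<lambda>(i, j). if i
        = k then boundary_mat' x (i, j) else boundary_mat lam x (i, j))))
       = \<i> * lam * of_real (Rb x) * Determinant.det (Matrix.mat n n (boundary_mat lam x))
           + q x" by (simp add: boundary_det_def)
  qed
  have R_ac: "ac l R Rb" unfolding R_def[abs_def] Rb_def[abs_def] by (intro ac_sum rho_ac) auto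
  \<comment> \<open>\<open>v\<close> is the determinant with its main exponential growth removed;
    what drives it is the potential alone.\<close>
  define p where "p x = exp (- (\<i> * lam * of_real (R x)))" for x
  define v where "v x = p x * boundary_det lam x" for x
  have p_ac: "ac l p (\<lambda>t. p t * - (\<i> * lam * of_real (Rb t)))"
    unfolding p_def by (rule ac_exp[OF ac_minus[OF
        ac_cmult[OF ac_linear[OF R_ac bounded_linear_of_real]]]])
  have v_ac: "ac l v (\<lambda>t. p t * q t)"
    unfolding v_def by (rule ac_deriv_cong[OF ac_mult[OF p_ac d_ac]]) (simp add: algebra_simps)
  \<comment> \<open>The factor 2 is the constant of \<open>half_estimate\<close> in the absence of
    forcing.\<close>
  define a where "a t = 2 * (\<Sum>k<n. qrow k t)" for t
  have q0: "qrow k t \<ge> 0" for k t unfolding qrow_def by (intro sum_nonneg) auto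
  have "(\<lambda>t. \<Sum>k<n. qrow k t) absolutely_integrable_on {0..l}"
    by (rule absolutely_integrable_sum) (simp_all add: qrow_absint)
  then have a_absint: "a absolutely_integrable_on {0..l}"
    unfolding a_def[abs_def] by (rule absint_cmult)
  have q_le: "cmod (q x) \<le> a x * cmod (boundary_det lam x)" if x: "0 \<le> x" "x \<le> l" for x
  proof -
    have Dle: "(\<Sum>m<n. cmod (\<Sum>j<n. E j lam m x * ?cof x k j)) \<le> 2 * cmod (boundary_det lam x)"
      if k: "k < n" for k
    proof -
      \<comment> \<open>With \<open>?cof x k\<close> as initial values only datum number
        \<open>k\<close> survives, and it is the determinant itself.\<close>
      have "(\<Sum>m<n. cmod (Ecomb lam (?cof x k) m x)) \<le> 2 * (bdata x (Ecomb lam (?cof x k)) + real n * 0)"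
        by (rule half_estimate[OF Ecomb_lin_sys _ lam _ _ _ ne]) (use x e in \<open>auto simp: Qsmall_def\<close>)
      also have "bdata x (Ecomb lam (?cof x k)) = (\<Sum>i<n. cmod (if i = k then boundary_det lam x else 0))"
        unfolding bdata_Ecomb by (intro sum.cong refl) (simp add: sum_row_cofactor k boundary_det_def)
      also have "\<dots> = cmod (boundary_det lam x)" using k
        by (simp add: if_distrib[of cmod] sum.delta cong: if_cong)
      finally show ?thesis by (simp add: Ecomb_def mult.commute)
    qed
    have "cmod (q x) \<le> (\<Sum>k\<in>?Ng. \<Sum>m<n. cmod (Q k m x) * cmod (\<Sum>j<n. E j lam m x * ?cof x k j))"
      unfolding q_def norm_minus_cancel norm_mult[symmetric]
      by (rule order_trans[OF norm_sum sum_mono]) (rule norm_sum)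
    also have "\<dots> \<le> (\<Sum>k\<in>?Ng. qrow k x * (2 * cmod (boundary_det lam x)))"
    proof (rule sum_mono)
      fix k assume "k \<in> ?Ng"
      then have k: "k < n" by simp
      have "(\<Sum>m<n. cmod (Q k m x) * cmod (\<Sum>j<n. E j lam m x * ?cof x k j))
          \<le> (\<Sum>m<n. qrow k x * cmod (\<Sum>j<n. E j lam m x * ?cof x k j))"
        unfolding qrow_def
        by (intro sum_mono mult_right_mono member_le_sum[of _ "{..<n}" "\<lambda>m. cmod (Q k m x)"]) auto
      also have "\<dots> = qrow k x * (\<Sum>m<n. cmod (\<Sum>j<n. E j lam m x * ?cof x k j))"
        by (simp add: sum_distrib_left)
      also have "\<dots> \<le> qrow k x * (2 * cmod (boundary_det lam x))" by (intro mult_left_mono Dle k q0)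
      finally show "(\<Sum>m<n. cmod (Q k m x) * cmod (\<Sum>j<n. E j lam m x * ?cof x k j)) \<le> qrow k x
          * (2 * cmod (boundary_det lam x))" .
    qed
    also have "\<dots> \<le> (\<Sum>k<n. qrow k x * (2 * cmod (boundary_det lam x)))" using q0 by (intro sum_mono2) auto
    also have "\<dots> = a x * cmod (boundary_det lam x)"
      by (simp add: a_def sum_distrib_left sum_distrib_right algebra_simps)
    finally show ?thesis .
  qed
  have vc: "continuous_on {0..l} (\<lambda>x. cmod (v x))" by (intro continuous_intros ac_continuous[OF v_ac])
  have avai: "(\<lambda>t. a t * cmod (v t)) absolutely_integrable_on {0..l}"
    by (rule absint_mult_cont2[OF vc a_absint])
  have "cmod (v 0) \<le> cmod (v l) * exp (integral {0..l} a)"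
  proof (rule gronwall_backward[OF _ vc a_absint])
    fix x assume x: "0 \<le> x" "x \<le> l"
    show "0 \<le> a x" unfolding a_def using q0 by (simp add: sum_nonneg)
    have "cmod (v l - v x) \<le> integral {x..l} (\<lambda>t. a t * cmod (v t))"
    proof (rule ac_norm_diff_le[OF v_ac avai _ x order_refl])
      fix t assume t: "0 \<le> t" "t \<le> l"
      have "cmod (p t) * cmod (q t) \<le> cmod (p t) * (a t * cmod (boundary_det lam t))"
        by (intro mult_left_mono q_le t) auto
      then show "cmod (p t * q t) \<le> a t * cmod (v t)" by (simp add: norm_mult v_def algebra_simps)
    qed
    moreover have "cmod (v x) \<le> cmod (v l) + cmod (v l - v x)" using norm_triangle_sub[of "v x" "v l"]
      by (simp add: norm_minus_commute)
    ultimately show "cmod (v x) \<le> cmod (v l) + integral {x..l} (\<lambda>t. a t * cmod (v t))" by simp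
  qed (use l_pos in auto)
  moreover have "v 0 = 1"
  proof -
    have "Matrix.mat n n (boundary_mat lam 0) = 1\<^sub>m n" by (rule eq_matI) (auto simp: boundary_mat_def E_0)
    then show ?thesis by (simp add: v_def p_def R_def boundary_det_def)
  qed
  moreover have "integral {0..l} a = 2 * (\<Sum>k<n. integral {0..l} (qrow k))"
  proof -
    have "integral {0..l} (\<lambda>t. \<Sum>k<n. qrow k t) = (\<Sum>k<n. integral {0..l} (qrow k))"
      by (rule Henstock_Kurzweil_Integration.integral_sum)
        (simp_all add: absint_integrable[OF qrow_absint])
    then show ?thesis by (simp add: a_def[abs_def])
  qed
  moreover have "cmod (v l) = exp (Im lam * R l) * cmod (boundary_det lam l)"
    by (simp add: v_def p_def norm_mult)
  ultimately have one: "1 \<le> exp (Im lam * R l) * cmod (boundary_det lam l)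
      * exp (2 * (\<Sum>k<n. integral {0..l} (qrow k)))" by simp
  let ?I = "2 * (\<Sum>k<n. integral {0..l} (qrow k))"
  have "exp (- Im lam * R l) * exp (- ?I) * 1 \<le> exp (- Im lam * R l) * exp (- ?I)
      * (exp (Im lam * R l) * cmod (boundary_det lam l) * exp ?I)"
    using one by (intro mult_left_mono) auto
  also have "\<dots> = cmod (boundary_det lam l)" by (simp add: exp_minus field_simps)
  finally show ?thesis by (simp add: R_def)
qed

text \<open>The a priori estimate bounds the data of a solution by its boundary forms, hence the
  entries of \<open>boundary_mat\<close> times the adjugate of \<open>bc_mat\<close> by
  \<open>K * cmod (char_det lam)\<close>. After taking determinants all powers of
  \<open>char_det lam\<close> but the first cancel.\<close>

lemma char_det_lower:
  assumes reg: "Determinant.det Smat \<noteq> 0"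
  shows "\<exists>c>0. \<forall>\<^sub>F \<kappa> in at_top. \<forall>lam. Im lam = \<kappa> \<longrightarrow>
     cmod (char_det lam) \<ge> c * exp (- \<kappa> * (\<Sum>k | k < n \<and> \<not> pos k. rho k l))"
proof -
  obtain K where K: "K \<ge> 0" and est: "\<forall>\<^sub>F \<kappa> in at_top. apriori K \<kappa>"
    using main_estimate[OF reg] by blast
  define e where "e = 1 / (2 * (real n + 1))"
  have e: "e > 0" "real n * e \<le> 1/2" by (auto simp: e_def field_simps)
  define I where "I = 2 * (\<Sum>k<n. integral {0..l} (qrow k))"
  \<comment> \<open>The summand 1 keeps \<open>L\<close> positive even if \<open>K\<close> is
    0.\<close>
  define L where "L = fact n * K ^ n + 1"
  have L: "L > 0" "fact n * K ^ n \<le> L" using K by (auto simp: L_def add_nonneg_pos)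
  have "\<forall>\<^sub>F \<kappa> in at_top. \<forall>lam. Im lam = \<kappa> \<longrightarrow>
     cmod (char_det lam) \<ge> exp (- I) / L * exp (- \<kappa> * (\<Sum>k | k < n \<and> \<not> pos k. rho k l))"
    using est Qsmall_eventually[OF e(1)] eventually_ge_at_top[of 0]
  proof eventually_elim
    case (elim \<kappa>)
    show ?case
    proof (intro allI impI)
      fix lam assume lam: "Im lam = \<kappa>"
      have G: "Gbound \<kappa> (\<lambda>_ _. 0) 0" by (simp add: Gbound_def)
      have est: "bdata l (Ecomb lam v) \<le> K * (\<Sum>i<n. cmod (\<Sum>j<n. bc_mat lam $$ (i, j) * v j))"
        "\<And>x. 0 \<le> x \<Longrightarrow> x \<le> l \<Longrightarrow> (\<Sum>k<n. cmod (Ecomb lam v k x)) \<le> K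
            * (\<Sum>i<n. cmod (\<Sum>j<n. bc_mat lam $$ (i, j) * v j))" for v
        using elim(1)[unfolded apriori_def, rule_format, OF lam Ecomb_lin_sys _ G] by (auto simp: U_Ecomb)
      \<comment> \<open>A kernel vector would be the initial value of a nonzero solution with
        vanishing boundary forms, which the estimate at \<open>x = 0\<close> excludes.\<close>
      have Dl0: "char_det lam \<noteq> 0"
      proof
        assume "char_det lam = 0"
        then obtain v where v: "v \<in> carrier_vec n" "v \<noteq> 0\<^sub>v n" "bc_mat lam *\<^sub>v v = 0\<^sub>v n"
          unfolding char_det_def det_0_iff_vec_prod_zero_field[OF bc_mat_car] by blast
        have "(\<Sum>j<n. bc_mat lam $$ (i, j) * vec_index v j) = 0" if i: "i < n" for i
        proof -
          have "vec_index (bc_mat lam *\<^sub>v v) i = 0" using v(3) i by simp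
          then show ?thesis using i v(1) by (simp add: scalar_prod_def lessThan_atLeast0 bc_mat_def)
        qed
        then have "(\<Sum>k<n. cmod (Ecomb lam (vec_index v) k 0)) \<le> 0"
          using est(2)[of 0 "vec_index v"] l_pos by simp
        then have "(\<Sum>k<n. cmod (vec_index v k)) = 0"
          by (intro antisym sum_nonneg) (auto simp: Ecomb_0)
        then have "\<forall>k<n. vec_index v k = 0" by (subst (asm) sum_nonneg_eq_0_iff) auto
        then have "v = 0\<^sub>v n" using v(1) by (intro eq_vecI) auto
        with v(2) show False by simp
      qed
      let ?ad = "adj_mat (bc_mat lam)" and ?H = "Matrix.mat n n (boundary_mat lam l)"
      have adc: "?ad \<in> carrier_mat n n" by (rule adj_mat(1)) simp
      have entry: "cmod (\<Sum>s<n. boundary_mat lam l (i, s) * ?ad $$ (s, j)) \<le> K * cmod (char_det lam)"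
        if i: "i < n" and j: "j < n" for i j
      proof -
        have "(\<Sum>s<n. bc_mat lam $$ (i, s) * ?ad $$ (s, j)) = (if i = j then char_det lam else 0)"
          if "i < n" for i
          using sum_row_cofactor[OF that j, of "\<lambda>(i, j). U i (E j lam)"] that j
          by (simp add: adj_mat_def char_det_def bc_mat_def)
        then have "(\<Sum>i<n. cmod (\<Sum>s<n. bc_mat lam $$ (i, s) * ?ad $$ (s, j)))
            = (\<Sum>i<n. cmod (if i = j then char_det lam else 0))"
          by (intro sum.cong) auto
        also have "\<dots> = cmod (char_det lam)" using j
          by (simp add: if_distrib[of cmod] sum.delta cong: if_cong)
        finally have "bdata l (Ecomb lam (\<lambda>s. ?ad $$ (s, j))) \<le> K * cmod (char_det lam)"
          using est(1)[of "\<lambda>s. ?ad $$ (s, j)"] by simp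
        moreover have "cmod (\<Sum>s<n. boundary_mat lam l (i, s) * ?ad $$ (s, j))
            \<le> bdata l (Ecomb lam (\<lambda>s. ?ad $$ (s, j)))"
          unfolding bdata_Ecomb using i
          by (intro member_le_sum[of i "{..<n}" "\<lambda>i. cmod (\<Sum>s<n. boundary_mat lam l (i, s)
              * ?ad $$ (s, j))"]) auto
        ultimately show ?thesis by linarith
      qed
      have HA: "?H * ?ad = Matrix.mat n n (\<lambda>(i, j). \<Sum>s<n. boundary_mat lam l (i, s) * ?ad $$ (s, j))"
        using adc by (intro eq_matI) (auto simp: scalar_prod_def lessThan_atLeast0)
      have "cmod (Determinant.det (?H * ?ad)) \<le> fact n * (K * cmod (char_det lam)) ^ n"
        unfolding HA by (rule norm_det_le) (use entry in auto)
      then have "cmod (boundary_det lam l) * cmod (Determinant.det ?ad) \<le> fact n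
          * (K * cmod (char_det lam)) ^ n"
        by (subst (asm) det_mult[OF _ adc]) (auto simp: boundary_det_def norm_mult)
      then have "cmod (boundary_det lam l) * cmod (Determinant.det ?ad) * cmod (char_det lam) \<le> fact n
          * (K * cmod (char_det lam)) ^ n * cmod (char_det lam)"
        by (rule mult_right_mono) auto
      \<comment> \<open>Multiplying by \<open>char_det lam\<close> avoids the exponent
        \<open>n - 1\<close> for the determinant of the adjugate, which would be truncated at
        \<open>n = 0\<close>.\<close>
      moreover have "cmod (Determinant.det ?ad) * cmod (char_det lam) = cmod (char_det lam) ^ n"
      proof -
        have "Determinant.det (bc_mat lam * ?ad) = char_det lam ^ n"
          by (simp add: adj_mat(2)[OF bc_mat_car] char_det_def det_smult)
        then have "char_det lam * Determinant.det ?ad = char_det lam ^ n"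
          by (subst (asm) det_mult[OF bc_mat_car adc]) (simp add: char_det_def)
        then show ?thesis by (metis mult.commute norm_mult norm_power)
      qed
      ultimately have "cmod (boundary_det lam l) * cmod (char_det lam) ^ n
          \<le> (fact n * K ^ n * cmod (char_det lam)) * cmod (char_det lam) ^ n"
        by (simp add: power_mult_distrib mult.assoc mult.left_commute mult.commute)
      then have "cmod (boundary_det lam l) \<le> fact n * K ^ n * cmod (char_det lam)" using Dl0 by simp
      also have "\<dots> \<le> L * cmod (char_det lam)" using L by (intro mult_right_mono) auto
      finally have "exp (- \<kappa> * (\<Sum>k | k < n \<and> \<not> pos k. rho k l)) * exp (- I) \<le> L * cmod (char_det lam)"
        using boundary_det_lower[of lam e] lam elim e by (simp add: I_def)
      then show "cmod (char_det lam) \<ge> exp (- I) / L * exp (- \<kappa> * (\<Sum>k | k < n \<and> \<not> pos k. rho k l))"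
        using L by (simp add: field_simps)
    qed
  qed
  moreover have "exp (- I) / L > 0" using L by simp
  ultimately show ?thesis by blast
qed

end

section \<open>Quotients of entire functions\<close>

text \<open>The growth condition makes the quotient bounded near each zero of \<open>Df\<close>, so
  Riemann's theorem extends it; \<open>z1\<close> ensures that the zeros are isolated.\<close>

lemma entire_quotient:
  fixes G Df :: "complex \<Rightarrow> complex"
  assumes G: "G holomorphic_on UNIV" and D: "Df holomorphic_on UNIV" and nz: "Df z1 \<noteq> 0"
    and bd: "\<And>z0. Df z0 = 0 \<Longrightarrow> \<exists>K r. r > 0 \<and> (\<forall>z. cmod (z - z0) < r \<longrightarrow> cmod (G z) \<le> K * cmod (Df z))"
  shows "\<exists>F. F holomorphic_on UNIV \<and> (\<forall>z. G z = F z * Df z)"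
proof -
  \<comment> \<open>At a zero the value is a limit, later identified with the value of the local
    holomorphic extension.\<close>
  define F where "F z = (if Df z \<noteq> 0 then G z / Df z else Lim (at z) (\<lambda>w. G w / Df w))" for z
  have "F field_differentiable at z0" for z0
  proof (cases "Df z0 = 0")
    case False
    have op: "open {z. Df z \<noteq> 0}"
      using open_Collect_neq[of Df "\<lambda>_. 0"] holomorphic_on_imp_continuous_on[OF D] by auto
    have "(\<lambda>z. G z / Df z) holomorphic_on {z. Df z \<noteq> 0}"
      by (intro holomorphic_intros holomorphic_on_subset[OF G] holomorphic_on_subset[OF D]) auto
    then have "F holomorphic_on {z. Df z \<noteq> 0}" by (rule holomorphic_transform) (simp add: F_def)
    then show ?thesis using op False by (intro holomorphic_on_imp_differentiable_at[OF _ op]) auto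
  next
    case True
    obtain r1 where r1: "r1 > 0" "\<And>z. z \<in> ball z0 r1 - {z0} \<Longrightarrow> Df z \<noteq> 0"
      using isolated_zeros[OF D open_UNIV connected_UNIV UNIV_I True UNIV_I nz] by metis
    obtain K r2 where r2: "r2 > 0" "\<And>z. cmod (z - z0) < r2 \<Longrightarrow> cmod (G z) \<le> K * cmod (Df z)"
      using bd[OF True] by blast
    define r where "r = min r1 r2"
    have r: "r > 0" "r \<le> r1" "r \<le> r2" using r1 r2 by (auto simp: r_def)
    define q where "q z = G z / Df z" for z
    have q: "q holomorphic_on ball z0 r - {z0}" unfolding q_def
      using r1 r by (intro holomorphic_intros holomorphic_on_subset[OF G] holomorphic_on_subset[OF D])
          auto
    have "\<forall>\<^sub>F z in at z0. norm (q z) \<le> K"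
      unfolding eventually_at
    proof (intro exI[of _ r] conjI ballI impI)
      fix z assume z: "z \<noteq> z0 \<and> dist z z0 < r"
      then have "Df z \<noteq> 0" using r1(2)[of z] r by (auto simp: dist_commute)
      moreover have "cmod (G z) \<le> K * cmod (Df z)" using r2(2)[of z] z r by (auto simp: dist_norm)
      ultimately show "norm (q z) \<le> K" by (simp add: q_def norm_divide divide_le_eq)
    qed (rule r(1))
    moreover have "z0 \<in> interior (ball z0 r)" using r by simp
    ultimately obtain g where g: "g holomorphic_on ball z0 r" "\<forall>z\<in>ball z0 r - {z0}. g z = q z"
      using holomorphic_on_extend_bounded[OF q] by blast
    have "g field_differentiable at z0" using holomorphic_on_imp_differentiable_at[OF g(1)] r by simp
    then have "(g \<longlongrightarrow> g z0) (at z0)"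
      using field_differentiable_imp_continuous_at continuous_at by blast
    then have "(q \<longlongrightarrow> g z0) (at z0)"
      by (rule Lim_transform_within_open[of _ _ _ _ "ball z0 r"]) (use g(2) r in auto)
    then have "Lim (at z0) q = g z0" by (intro tendsto_Lim) auto
    then have "F z = g z" if "z \<in> ball z0 r" for z
      using that g(2) r1(2)[of z] r True by (cases "z = z0") (auto simp: F_def q_def[abs_def])
    then have "F holomorphic_on ball z0 r" by (intro holomorphic_transform[OF g(1)]) auto
    then show ?thesis using holomorphic_on_imp_differentiable_at r by simp
  qed
  then have "F holomorphic_on UNIV"
    by (auto simp: holomorphic_on_def intro: field_differentiable_at_within)
  moreover have "G z = F z * Df z" for z
  proof (cases "Df z = 0")
    case True
    obtain K r where "r > 0" "\<And>w. cmod (w - z) < r \<Longrightarrow> cmod (G w) \<le> K * cmod (Df w)" using bd[OF True]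
      by blast
    from this(2)[of z] this(1) True show ?thesis by simp
  qed (simp add: F_def)
  ultimately show ?thesis by blast
qed

text \<open>No growth estimate on \<open>F\<close> inside the strip is needed: horizontal translates of \<open>Df\<close> form a normal
  family whose limits do not vanish identically, so around every point of the strip there is a
  circle on which the translates are bounded away from zero.\<close>

lemma strip_quotient_bounded:
  fixes F G Df :: "complex \<Rightarrow> complex"
  assumes F: "F holomorphic_on UNIV" and G: "strip_entire G" and D: "strip_entire Df"
    and GF: "\<And>z. G z = F z * Df z"
    and out: "\<And>z. \<bar>Im z\<bar> \<ge> M \<Longrightarrow> cmod (F z) \<le> K0"
    and low: "c > 0" "\<And>z. Im z = M \<Longrightarrow> cmod (Df z) \<ge> c"
  shows "bounded (range F)"
proof (rule ccontr)
  assume "\<not> bounded (range F)"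
  then have "\<forall>m::nat. \<exists>z. cmod (F z) > real m + \<bar>K0\<bar>"
    unfolding bounded_iff by (metis not_le rangeE rangeI)
  \<comment> \<open>These points witness that \<open>F\<close> is unbounded; adding
    \<open>\<bar>K0\<bar>\<close> forces all of them into the strip.\<close>
  then obtain z where z: "\<And>m::nat. cmod (F (z m)) > real m + \<bar>K0\<bar>" by metis
  have Imz: "\<bar>Im (z m)\<bar> \<le> \<bar>M\<bar>" for m
  proof (rule ccontr)
    assume "\<not> ?thesis"
    then have "cmod (F (z m)) \<le> K0" by (intro out) simp
    with z[of m] show False by simp
  qed
  \<comment> \<open>All real translates of \<open>Df\<close>; boundedness on strips makes them
    uniformly bounded on compact sets.\<close>
  define H where "H = {h. \<exists>x. h = (\<lambda>w. Df (complex_of_real x + w))}"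
  define FF where "FF m w = Df (complex_of_real (Re (z m)) + w)" for m w
  have shift: "(\<lambda>w. f (x + w)) holomorphic_on X" if "f holomorphic_on UNIV"
    for f :: "complex \<Rightarrow> complex" and x X
  proof -
    have "(\<lambda>w. x + w) holomorphic_on X" by (intro holomorphic_intros)
    from holomorphic_on_compose_gen[OF this that] show ?thesis by (simp add: o_def)
  qed
  have Hh: "h holomorphic_on UNIV" if "h \<in> H" for h
    using that shift[OF strip_entire_holomorphic[OF D]] unfolding H_def by auto
  obtain g r where g: "g holomorphic_on UNIV" and r: "strict_mono (r :: nat \<Rightarrow> nat)"
    and lim: "\<And>x. (\<lambda>n. FF (r n) x) \<longlonglongrightarrow> g x"
    and ulim: "\<And>K. compact K \<Longrightarrow> uniform_limit K (FF \<circ> r) g sequentially"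
  proof (rule Montel[of UNIV H FF])
    show "range FF \<subseteq> H" by (auto simp: H_def FF_def[abs_def])
    show "\<exists>B. \<forall>h\<in>H. \<forall>w\<in>K. cmod (h w) \<le> B" if K: "compact K" for K
    proof -
      obtain S where S: "\<forall>w\<in>K. cmod w \<le> S" using compact_imp_bounded[OF K] bounded_iff by blast
      obtain B where B: "\<forall>z. \<bar>Im z\<bar> \<le> S \<longrightarrow> cmod (Df z) \<le> B" using strip_entire_strip[OF D] by blast
      have "\<bar>Im (complex_of_real x + w)\<bar> \<le> S" if "w \<in> K" for x w
        using S that abs_Im_le_cmod[of w] by force
      then show ?thesis using B by (intro exI[of _ B]) (auto simp: H_def)
    qed
  qed (use Hh in auto)
  \<comment> \<open>The lower bound on the line \<open>Im z = M\<close> is invariant under real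
    translation, so it survives in the limit, and \<open>g\<close> is not identically zero.\<close>
  have "cmod (g (\<i> * of_real M)) \<ge> c"
  proof (rule Lim_norm_lbound[OF _ lim])
    show "\<forall>\<^sub>F n in sequentially. c \<le> cmod (FF (r n) (\<i> * of_real M))"
      by (auto simp: FF_def intro!: low(2) always_eventually)
  qed simp
  then have gnz: "g (\<i> * of_real M) \<noteq> 0" using low(1) by auto
  have "Im (z (r m)) \<in> {-\<bar>M\<bar>..\<bar>M\<bar>}" for m using Imz[of "r m"] by auto
  then obtain t s where s: "strict_mono (s :: nat \<Rightarrow> nat)" and t: "(\<lambda>m. Im (z (r (s m)))) \<longlonglongrightarrow> t"
  proof -
    have "seq_compact {-\<bar>M\<bar>..\<bar>M\<bar>}" by (rule compact_imp_seq_compact) simp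
    from seq_compactE[OF this, of "\<lambda>m. Im (z (r m))"] \<open>\<And>m. Im (z (r m)) \<in> _\<close>
    obtain t s where "strict_mono (s :: nat \<Rightarrow> nat)" "((\<lambda>m. Im (z (r m))) \<circ> s) \<longlonglongrightarrow> t" by blast
    then show ?thesis using that[of s t] by (simp add: o_def)
  qed
  \<comment> \<open>Along a subsequence the imaginary parts converge to \<open>t\<close>; translated
    to the imaginary axis, the points \<open>z\<close> tend to \<open>w0\<close>.\<close>
  define w0 where "w0 = \<i> * complex_of_real t"
  obtain \<rho> where \<rho>: "\<rho> > 0" "\<And>w. w \<in> ball w0 \<rho> - {w0} \<Longrightarrow> g w \<noteq> 0"
  proof (cases "g w0 = 0")
    case True
    show ?thesis using isolated_zeros[OF g open_UNIV connected_UNIV UNIV_I True UNIV_I gnz] that by metis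
  next
    case False
    have "open {w. g w \<noteq> 0}" using open_Collect_neq[of g "\<lambda>_. 0"]
        holomorphic_on_imp_continuous_on[OF g] by auto
    then obtain e where "e > 0" "ball w0 e \<subseteq> {w. g w \<noteq> 0}" using False open_contains_ball by blast
    then show ?thesis using that[of e] by blast
  qed
  define S where "S = sphere w0 (\<rho>/2)"
  have S: "compact S" "S \<noteq> {}" using \<rho>(1) by (auto simp: S_def)
  obtain w1 where w1: "w1 \<in> S" "\<And>w. w \<in> S \<Longrightarrow> cmod (g w1) \<le> cmod (g w)"
    using continuous_attains_inf[OF S, of "\<lambda>w. cmod (g w)"]
        holomorphic_on_imp_continuous_on[OF holomorphic_on_subset[OF g]]
    by (metis continuous_on_norm subset_UNIV)
  \<comment> \<open>Half of the minimum of \<open>g\<close> on the circle: translates closer than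
    \<delta> to \<open>g\<close> then have modulus at least \<delta> there.\<close>
  define \<delta> where "\<delta> = cmod (g w1) / 2"
  have \<delta>: "\<delta> > 0" unfolding \<delta>_def using \<rho>(1) \<rho>(2)[of w1] w1(1) by (auto simp: S_def)
  obtain B where B: "B \<ge> 0" "\<And>z. \<bar>Im z\<bar> \<le> \<bar>t\<bar> + \<rho> \<Longrightarrow> cmod (G z) \<le> B" using strip_entire_strip[OF G]
    by blast
  have "\<forall>\<^sub>F m in sequentially. \<forall>w\<in>S. dist ((FF \<circ> r) m w) (g w) < \<delta>"
    using ulim[OF S(1)] \<delta> by (rule uniform_limitD)
  then have ev1: "\<forall>\<^sub>F m in sequentially. \<forall>w\<in>S. dist ((FF \<circ> r) (s m) w) (g w) < \<delta>"
    by (rule eventually_subseq[OF s])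
  have ev2: "\<forall>\<^sub>F m in sequentially. \<bar>Im (z (r (s m))) - t\<bar> < \<rho>/2"
    using tendstoD[OF t, of "\<rho>/2"] \<rho>(1) by (simp add: dist_real_def)
  have ev3: "\<forall>\<^sub>F m in sequentially. B / \<delta> < real m"
    using filterlim_real_sequentially by (simp add: filterlim_at_top_dense)
  from eventually_conj[OF ev1 eventually_conj[OF ev2 ev3]] obtain m where
    m: "\<And>w. w \<in> S \<Longrightarrow> dist (FF (r (s m)) w) (g w) < \<delta>" "\<bar>Im (z (r (s m))) - t\<bar> < \<rho>/2" "B / \<delta> < real m"
    by (auto simp: eventually_sequentially)
  define x where "x = complex_of_real (Re (z (r (s m))))"
  \<comment> \<open>On the circle \<open>G\<close> is bounded by \<open>B\<close> and
    \<open>Df\<close> is at least \<delta>; the maximum principle carries the bound of the quotient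
    into the disc, which contains the translated point.\<close>
  have "cmod (F (z (r (s m)))) \<le> B / \<delta>"
  proof -
    have "cmod ((\<lambda>w. F (x + w)) (\<i> * of_real (Im (z (r (s m)))))) \<le> B / \<delta>"
    proof (rule maximum_modulus_frontier[of "\<lambda>w. F (x + w)" "cball w0 (\<rho>/2)"])
      have h: "(\<lambda>w. F (x + w)) holomorphic_on X" for X
        by (rule shift[OF F])
      show "(\<lambda>w. F (x + w)) holomorphic_on interior (cball w0 (\<rho> / 2))" by (rule h)
      show "continuous_on (closure (cball w0 (\<rho> / 2))) (\<lambda>w. F (x + w))"
        by (rule holomorphic_on_imp_continuous_on[OF h])
      show "\<i> * of_real (Im (z (r (s m)))) \<in> cball w0 (\<rho>/2)"
      proof -
        have "dist w0 (\<i> * of_real (Im (z (r (s m))))) = \<bar>Im (z (r (s m))) - t\<bar>"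
          by (simp add: w0_def dist_norm norm_mult flip: right_diff_distrib of_real_diff)
        then show ?thesis using m(2) by simp
      qed
      fix w assume "w \<in> frontier (cball w0 (\<rho>/2))"
      then have w: "w \<in> S" using \<rho>(1) by (simp add: S_def frontier_cball)
      have "cmod (g w) \<ge> 2 * \<delta>" using w1(2)[OF w] by (simp add: \<delta>_def)
      moreover have "cmod (FF (r (s m)) w - g w) < \<delta>" using m(1)[OF w] by (simp add: dist_norm)
      ultimately have Dw: "cmod (Df (x + w)) \<ge> \<delta>"
        using norm_triangle_ineq3[of "g w" "FF (r (s m)) w"]
          by (simp add: FF_def x_def norm_minus_commute)
      have "\<bar>Im w - t\<bar> \<le> cmod (w - w0)" using abs_Im_le_cmod[of "w - w0"] by (simp add: w0_def)
      also have "\<dots> = \<rho>/2" using w by (simp add: S_def dist_norm norm_minus_commute)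
      finally have "\<bar>Im w\<bar> \<le> \<bar>t\<bar> + \<rho>" using \<rho>(1) by linarith
      then have "\<bar>Im (x + w)\<bar> \<le> \<bar>t\<bar> + \<rho>" by (simp add: x_def)
      then have "cmod (F (x + w)) * cmod (Df (x + w)) \<le> B" using B(2)[of "x + w"]
        by (simp add: GF norm_mult)
      moreover have "cmod (F (x + w)) * \<delta> \<le> cmod (F (x + w)) * cmod (Df (x + w))" using Dw
        by (intro mult_left_mono) auto
      ultimately show "cmod (F (x + w)) \<le> B / \<delta>" using \<delta> by (simp add: field_simps)
    qed simp
    moreover have "x + \<i> * of_real (Im (z (r (s m)))) = z (r (s m))" unfolding x_def
      by (rule complex_eq[symmetric])
    ultimately show ?thesis by simp
  qed
  moreover have "m \<le> r (s m)" using seq_suble[OF r, of "s m"] seq_suble[OF s, of m] by simp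
  ultimately show False using m(3) z[of "r (s m)"] by simp
qed

section \<open>Separation and density in weighted spaces\<close>

text \<open>The structure consists of a set of functions and the single operation
  \<open>asc c u v\<close>, read as \<open>u + c * v\<close>. No quotient is formed, so
  \<open>nrm\<close> may vanish on nonzero elements.\<close>

locale semi_ip =
  fixes H :: "'v set" and asc :: "complex \<Rightarrow> 'v \<Rightarrow> 'v \<Rightarrow> 'v" and ip :: "'v \<Rightarrow> 'v \<Rightarrow> complex"
    and nrm :: "'v \<Rightarrow> real"
  assumes asc_closed: "u \<in> H \<Longrightarrow> v \<in> H \<Longrightarrow> asc c u v \<in> H"
    and ip_asc: "u \<in> H \<Longrightarrow> v \<in> H \<Longrightarrow> w \<in> H \<Longrightarrow> ip (asc c u v) w = ip u w + c * ip v w"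
    and ip_cnj: "u \<in> H \<Longrightarrow> v \<in> H \<Longrightarrow> ip v u = cnj (ip u v)"
    and ip_self: "u \<in> H \<Longrightarrow> ip u u = of_real ((nrm u)\<^sup>2)"
    and nrm_nonneg: "nrm u \<ge> 0"
begin

lemma ip_asc_right:
  assumes "u \<in> H" "v \<in> H" "w \<in> H" shows "ip w (asc c u v) = ip w u + cnj c * ip w v"
proof -
  have "ip w (asc c u v) = cnj (ip (asc c u v) w)" by (rule ip_cnj[OF asc_closed[OF assms(1,2)] assms(3)])
  also have "\<dots> = cnj (ip u w) + cnj c * cnj (ip v w)" unfolding ip_asc[OF assms] by simp
  finally show ?thesis unfolding ip_cnj[OF assms(1,3)] ip_cnj[OF assms(2,3)] .
qed

lemma nrm_asc_sq:
  assumes "u \<in> H" "v \<in> H"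
  shows "(nrm (asc c u v))\<^sup>2 = (nrm u)\<^sup>2 + 2 * Re (c * ip v u) + (cmod c)\<^sup>2 * (nrm v)\<^sup>2"
proof -
  have "of_real ((nrm (asc c u v))\<^sup>2) = ip (asc c u v) (asc c u v)"
    using ip_self[OF asc_closed[OF assms]] by simp
  also have "\<dots> = ip u u + cnj c * ip u v + c * (ip v u + cnj c * ip v v)"
    by (simp add: ip_asc ip_asc_right assms asc_closed algebra_simps)
  also have "\<dots> = of_real ((nrm u)\<^sup>2) + (cnj (c * ip v u) + c * ip v u) + (c * cnj c)
      * of_real ((nrm v)\<^sup>2)"
    using assms by (simp add: ip_self ip_cnj[of v u] algebra_simps)
  also have "cnj (c * ip v u) + c * ip v u = of_real (2 * Re (c * ip v u))"
    using complex_add_cnj[of "c * ip v u"] by (simp only: add.commute)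
  also have "c * cnj c = of_real ((cmod c)\<^sup>2)" by (simp only: complex_norm_square)
  finally show ?thesis unfolding of_real_mult[symmetric] of_real_add[symmetric]
    by (simp only: of_real_eq_iff)
qed

text \<open>Minimizing the quadratic polynomial \<open>(nrm (asc c r s))\<^sup>2\<close> in
  \<open>c\<close> shows that \<open>r\<close> is nearly orthogonal to \<open>s\<close> when its
  norm is close to the minimal one. With \<open>D = 0\<close> it becomes the Cauchy-Schwarz
  inequality.\<close>

lemma ip_bound_if_far:
  assumes "s \<in> H" "r \<in> H" "D \<ge> 0" and far: "\<And>c. (nrm (asc c r s))\<^sup>2 \<ge> D"
  shows "cmod (ip s r) \<le> nrm s * sqrt ((nrm r)\<^sup>2 - D)"
proof -
  define p where "p = ip s r"
  have q: "(nrm r)\<^sup>2 + 2 * Re (c * p) + (cmod c)\<^sup>2 * (nrm s)\<^sup>2 \<ge> D" for c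
    using far[of c] nrm_asc_sq[OF assms(2,1), of c] by (simp add: p_def)
  have q': "(nrm r)\<^sup>2 - D - 2 * t * (cmod p)\<^sup>2 + t\<^sup>2 * (cmod p)\<^sup>2 * (nrm s)\<^sup>2 \<ge> 0" for t :: real
  proof -
    have "Re (- of_real t * cnj p * p) = - t * (cmod p)\<^sup>2"
      by (simp add: mult.assoc complex_mult_cnj cmod_def mult.commute[of "cnj p"])
    then show ?thesis using q[of "- of_real t * cnj p"] by (simp add: norm_mult power_mult_distrib)
  qed
  have sq: "(cmod p)\<^sup>2 \<le> (nrm s)\<^sup>2 * ((nrm r)\<^sup>2 - D)"
  proof (cases "nrm s = 0")
    case True
    have "cmod p = 0"
    proof (rule ccontr)
      assume "cmod p \<noteq> 0"
      then have p: "(cmod p)\<^sup>2 > 0" by simp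
      \<comment> \<open>If \<open>nrm s = 0\<close>, the polynomial is linear in \<open>t\<close>,
        and this \<open>t\<close> gives it the value -1.\<close>
      define t where "t = ((nrm r)\<^sup>2 - D + 1) / (2 * (cmod p)\<^sup>2)"
      have "2 * t * (cmod p)\<^sup>2 = (nrm r)\<^sup>2 - D + 1" using p by (simp add: t_def)
      then show False using q'[of t] True by simp
    qed
    then show ?thesis using True by simp
  next
    case False
    then have s: "(nrm s)\<^sup>2 > 0" by simp
    define t where "t = 1 / (nrm s)\<^sup>2"
    have "t\<^sup>2 * (cmod p)\<^sup>2 * (nrm s)\<^sup>2 = t * (cmod p)\<^sup>2" using s by (simp add: t_def power2_eq_square)
    then have "t * (cmod p)\<^sup>2 \<le> (nrm r)\<^sup>2 - D" using q'[of t] by linarith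
    then show ?thesis using s by (simp add: t_def field_simps)
  qed
  have "cmod p = sqrt ((cmod p)\<^sup>2)" by simp
  also have "\<dots> \<le> sqrt ((nrm s)\<^sup>2 * ((nrm r)\<^sup>2 - D))" using sq by (rule real_sqrt_le_mono)
  finally show ?thesis using nrm_nonneg[of s] by (simp add: p_def real_sqrt_mult)
qed

lemma Cauchy_Schwarz: "u \<in> H \<Longrightarrow> v \<in> H \<Longrightarrow> cmod (ip u v) \<le> nrm u * nrm v"
  using ip_bound_if_far[of u v 0] nrm_nonneg[of v] by simp

text \<open>The limit of the functionals \<open>\<lambda>h. ip h (f0 - s)\<close> along a minimizing sequence \<open>s\<close> exists even
  if the space is not complete.\<close>

lemma separating_functional:
  assumes f0: "f0 \<in> H" and S: "S \<subseteq> H" "S \<noteq> {}" "\<And>c u v. u \<in> S \<Longrightarrow> v \<in> S \<Longrightarrow> asc c u v \<in> S"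
    and d: "d > 0" "\<And>s. s \<in> S \<Longrightarrow> nrm (asc (-1) f0 s) \<ge> d"
    and asc_assoc: "\<And>c u v. u \<in> H \<Longrightarrow> v \<in> H \<Longrightarrow> asc c (asc (-1) f0 u) v = asc (-1) f0 (asc (-c) u v)"
    and asc_diff: "\<And>u v w. u \<in> H \<Longrightarrow> v \<in> H \<Longrightarrow> w \<in> H \<Longrightarrow> ip w (asc (-1) f0 u) - ip w (asc (-1) f0 v)
        = ip w (asc (-1) v u)"
  shows "\<exists>\<phi>. (\<forall>u\<in>H. \<forall>v\<in>H. \<forall>c. \<phi> (asc c u v) = \<phi> u + c * \<phi> v) \<and> (\<exists>K\<ge>0. \<forall>u\<in>H. cmod (\<phi> u) \<le> K * nrm u)
    \<and> (\<forall>s\<in>S. \<phi> s = 0) \<and> \<phi> f0 \<noteq> (0::complex)"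
proof -
  define N where "N = (\<lambda>s. (nrm (asc (-1) f0 s))\<^sup>2) ` S"
  define D where "D = Inf N"
  have bdd: "bdd_below N" unfolding N_def by (rule bdd_belowI[of _ 0]) auto
  have Ne: "N \<noteq> {}" using S(2) by (simp add: N_def)
  have Dle: "D \<le> (nrm (asc (-1) f0 s))\<^sup>2" if "s \<in> S" for s
    unfolding D_def using bdd that by (intro cInf_lower) (auto simp: N_def)
  have D0: "D > 0"
  proof -
    have "d\<^sup>2 \<le> D" unfolding D_def using Ne d
      by (intro cInf_greatest) (auto simp: N_def intro!: power_mono)
    then show ?thesis using d(1) by (meson less_le_trans zero_less_power)
  qed
  have "\<exists>s\<in>S. (nrm (asc (-1) f0 s))\<^sup>2 < D + 1 / real (Suc m)" for m
  proof -
    have "Inf N < D + 1 / real (Suc m)" by (simp add: D_def)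
    then obtain x where "x \<in> N" "x < D + 1 / real (Suc m)" using cInf_lessD[OF Ne] by blast
    then show ?thesis by (auto simp: N_def)
  qed
  then obtain s where s: "\<And>m. s m \<in> S" "\<And>m. (nrm (asc (-1) f0 (s m)))\<^sup>2 < D + 1 / real (Suc m)" by metis
  have sH: "s m \<in> H" for m using s S by auto
  define r where "r m = asc (-1) f0 (s m)" for m
  have rH: "r m \<in> H" for m unfolding r_def by (intro asc_closed f0 sH)
  \<comment> \<open>The excess of \<open>(nrm (r m))\<^sup>2\<close> over \<open>D\<close> is below
    \<open>1 / real (Suc m)\<close>, and its root measures how far \<open>r m\<close> is from being
    orthogonal to \<open>S\<close>.\<close>
  define \<epsilon> where "\<epsilon> m = sqrt (1 / real (Suc m))" for m
  have \<epsilon>0: "\<epsilon> \<longlonglongrightarrow> 0"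
  proof -
    have "(\<lambda>m. sqrt (1 / real (Suc m))) \<longlonglongrightarrow> sqrt 0" by (intro tendsto_real_sqrt LIMSEQ_Suc[OF lim_1_over_n])
    then show ?thesis by (simp add: \<epsilon>_def[abs_def])
  qed
  have orth: "cmod (ip u (r m)) \<le> nrm u * \<epsilon> m" if u: "u \<in> S" for u m
  proof -
    have uH: "u \<in> H" using u S by auto
    have "cmod (ip u (r m)) \<le> nrm u * sqrt ((nrm (r m))\<^sup>2 - D)"
    proof (rule ip_bound_if_far[OF uH rH])
      show "D \<le> (nrm (asc c (r m) u))\<^sup>2" for c
        unfolding r_def asc_assoc[OF sH uH] by (intro Dle S(3) s u)
    qed (use D0 in simp)
    also have "\<dots> \<le> nrm u * \<epsilon> m"
      unfolding \<epsilon>_def using s(2)[of m]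
        by (intro mult_left_mono nrm_nonneg real_sqrt_le_mono) (simp add: r_def)
    finally show ?thesis .
  qed
  have dist: "cmod (ip h (r p) - ip h (r m)) \<le> nrm h * (\<epsilon> m + \<epsilon> p)" if h: "h \<in> H" for h p m
  proof -
    define u where "u = asc (-1) (s m) (s p)"
    have uS: "u \<in> S" unfolding u_def by (intro S(3) s)
    then have uH: "u \<in> H" using S by auto
    have e: "ip w (r p) - ip w (r m) = ip w u" if "w \<in> H" for w
      unfolding r_def u_def by (rule asc_diff[OF sH sH that])
    \<comment> \<open>\<open>u\<close> lies in \<open>S\<close> and acts in products like the
      difference of two residuals, so near-orthogonality bounds its squared norm by
      \<open>nrm u * (\<epsilon> m + \<epsilon> p)\<close>.\<close>
    have "of_real ((nrm u)\<^sup>2) = ip u (r p) - ip u (r m)" using e[OF uH] ip_self[OF uH] by simp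
    then have "cmod (of_real ((nrm u)\<^sup>2)) \<le> nrm u * \<epsilon> p + nrm u * \<epsilon> m"
      using orth[OF uS, of p] orth[OF uS, of m] norm_triangle_ineq4[of "ip u (r p)" "ip u (r m)"] by simp
    moreover have "cmod (of_real ((nrm u)\<^sup>2)) = (nrm u)\<^sup>2" by (simp only: norm_of_real abs_power2)
    ultimately have "(nrm u)\<^sup>2 \<le> nrm u * (\<epsilon> m + \<epsilon> p)" by (simp only: distrib_left add.commute)
    moreover have "\<epsilon> m + \<epsilon> p \<ge> 0" by (simp add: \<epsilon>_def)
    ultimately have "nrm u \<le> \<epsilon> m + \<epsilon> p"
      using nrm_nonneg[of u] by (cases "nrm u = 0") (auto simp: power2_eq_square)
    then have "nrm h * nrm u \<le> nrm h * (\<epsilon> m + \<epsilon> p)" by (intro mult_left_mono nrm_nonneg)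
    then show ?thesis using Cauchy_Schwarz[OF h uH] e[OF h] by simp
  qed
  have conv: "convergent (\<lambda>m. ip h (r m))" if h: "h \<in> H" for h
  proof -
    have "Cauchy (\<lambda>m. ip h (r m))"
    proof (rule metric_CauchyI)
      fix e :: real assume e: "e > 0"
      have "(\<lambda>m. nrm h * \<epsilon> m) \<longlonglongrightarrow> nrm h * 0" by (intro tendsto_intros \<epsilon>0)
      then have "\<forall>\<^sub>F m in sequentially. nrm h * \<epsilon> m < e/2" using e by (intro order_tendstoD(2)) auto
      then obtain M where M: "\<And>m. m \<ge> M \<Longrightarrow> nrm h * \<epsilon> m < e/2" by (auto simp: eventually_sequentially)
      show "\<exists>M. \<forall>m\<ge>M. \<forall>p\<ge>M. dist (ip h (r m)) (ip h (r p)) < e"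
      proof (intro exI[of _ M] allI impI)
        fix m p assume "m \<ge> M" "p \<ge> M"
        then have "nrm h * \<epsilon> m < e/2" "nrm h * \<epsilon> p < e/2" using M by auto
        moreover have "dist (ip h (r m)) (ip h (r p)) \<le> nrm h * \<epsilon> p + nrm h * \<epsilon> m"
          using dist[OF h, of m p] by (simp add: dist_norm distrib_left)
        ultimately show "dist (ip h (r m)) (ip h (r p)) < e" by linarith
      qed
    qed
    then show ?thesis by (rule Cauchy_convergent)
  qed
  define \<phi> where "\<phi> h = lim (\<lambda>m. ip h (r m))" for h
  have lim: "(\<lambda>m. ip h (r m)) \<longlonglongrightarrow> \<phi> h" if "h \<in> H" for h
    unfolding \<phi>_def using conv[OF that] by (simp add: convergent_LIMSEQ_iff)
  have rb: "nrm (r m) \<le> sqrt (D + 1)" for m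
  proof -
    have "1 / real (Suc m) \<le> 1" by simp
    then have "(nrm (r m))\<^sup>2 \<le> D + 1" using s(2)[of m] unfolding r_def by linarith
    then show ?thesis by (rule real_le_rsqrt)
  qed
  show ?thesis
  proof (intro exI[of _ \<phi>] conjI ballI allI)
    fix u v c assume uv: "u \<in> H" "v \<in> H"
    have "(\<lambda>m. ip (asc c u v) (r m)) \<longlonglongrightarrow> \<phi> u + c * \<phi> v"
      unfolding ip_asc[OF uv rH] by (intro tendsto_intros lim uv)
    then show "\<phi> (asc c u v) = \<phi> u + c * \<phi> v" using lim[OF asc_closed[OF uv]] LIMSEQ_unique by blast
  next
    have "cmod (\<phi> u) \<le> sqrt (D + 1) * nrm u" if u: "u \<in> H" for u
    proof (rule Lim_norm_ubound[OF _ lim[OF u]])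
      have "cmod (ip u (r m)) \<le> sqrt (D + 1) * nrm u" for m
        using Cauchy_Schwarz[OF u rH, of m] mult_left_mono[OF rb[of m] nrm_nonneg[of u]]
          by (simp add: mult.commute)
      then show "\<forall>\<^sub>F m in sequentially. cmod (ip u (r m)) \<le> sqrt (D + 1) * nrm u" by simp
    qed simp
    then show "\<exists>K\<ge>0. \<forall>u\<in>H. cmod (\<phi> u) \<le> K * nrm u" using D0 by (intro exI[of _ "sqrt (D + 1)"]) auto
  next
    fix u assume u: "u \<in> S"
    have "(\<lambda>m. nrm u * \<epsilon> m) \<longlonglongrightarrow> nrm u * 0" by (intro tendsto_intros \<epsilon>0)
    then have "(\<lambda>m. ip u (r m)) \<longlonglongrightarrow> 0"
      by (intro Lim_null_comparison[where f = "\<lambda>m. ip u (r m)"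
        and g = "\<lambda>m. nrm u * \<epsilon> m"]) (auto intro: always_eventually orth[OF u])
    then show "\<phi> u = 0" using lim[of u] u S(1) LIMSEQ_unique by blast
  next
    \<comment> \<open>\<open>ip f0 (r m)\<close> is the squared norm of \<open>r m\<close>, at least
      \<open>D\<close>, plus a product with \<open>s m\<close> that tends to 0; so the limit has
      real part at least \<open>D\<close>.\<close>
    have "(\<lambda>m. Re (ip f0 (r m))) \<longlonglongrightarrow> Re (\<phi> f0)" by (intro tendsto_intros lim f0)
    moreover have "(\<lambda>m. D - (nrm f0 + sqrt (D + 1)) * \<epsilon> m) \<longlonglongrightarrow> D - (nrm f0 + sqrt (D + 1)) * 0"
      by (intro tendsto_intros \<epsilon>0)
    moreover have "D - (nrm f0 + sqrt (D + 1)) * \<epsilon> m \<le> Re (ip f0 (r m))" for m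
    proof -
      have "ip (r m) (r m) = ip f0 (r m) - ip (s m) (r m)"
        using ip_asc[OF f0 sH rH, of "-1" m m] by (simp add: r_def)
      then have e: "ip f0 (r m) = of_real ((nrm (r m))\<^sup>2) + ip (s m) (r m)" using ip_self[OF rH, of m]
        by simp
      have "nrm (s m) \<le> nrm f0 + sqrt (D + 1)"
      proof -
        have "(nrm (r m))\<^sup>2 = (nrm f0)\<^sup>2 - 2 * Re (ip (s m) f0) + (nrm (s m))\<^sup>2"
          using nrm_asc_sq[OF f0 sH, of "-1" m] by (simp add: r_def)
        moreover have "\<bar>Re (ip (s m) f0)\<bar> \<le> nrm (s m) * nrm f0"
          using Cauchy_Schwarz[OF sH f0, of m] abs_Re_le_cmod order_trans by blast
        ultimately have "(nrm (s m) - nrm f0)\<^sup>2 \<le> (nrm (r m))\<^sup>2"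
          by (simp add: power2_diff abs_le_iff)
        then have "nrm (s m) - nrm f0 \<le> nrm (r m)" using nrm_nonneg[of "r m"] by (rule power2_le_imp_le)
        then show ?thesis using rb[of m] by simp
      qed
      then have "nrm (s m) * \<epsilon> m \<le> (nrm f0 + sqrt (D + 1)) * \<epsilon> m"
        by (intro mult_right_mono) (auto simp: \<epsilon>_def)
      moreover have "Re (ip (s m) (r m)) \<ge> - (nrm (s m) * \<epsilon> m)"
        using orth[OF s(1), of m m] abs_Re_le_cmod[of "ip (s m) (r m)"] by linarith
      moreover have "D \<le> (nrm (r m))\<^sup>2" unfolding r_def by (rule Dle[OF s(1)])
      ultimately show ?thesis by (simp add: e)
    qed
    ultimately have "D - (nrm f0 + sqrt (D + 1)) * 0 \<le> Re (\<phi> f0)" by (intro LIMSEQ_le) auto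
    then show "\<phi> f0 \<noteq> 0" using D0 by auto
  qed
qed

end

section \<open>Approximation in weighted L2 spaces\<close>

lemma cmod_diff_sq_le: "(cmod (u - w))\<^sup>2 \<le> 2 * (cmod (u - v))\<^sup>2 + 2 * (cmod (v - w))\<^sup>2"
proof -
  have "(cmod (u - w))\<^sup>2 \<le> (cmod (u - v) + cmod (v - w))\<^sup>2"
    using norm_triangle_ineq[of "u - v" "v - w"] by (intro power_mono) auto
  also have "\<dots> \<le> 2 * (cmod (u - v))\<^sup>2 + 2 * (cmod (v - w))\<^sup>2"
    using sum_squares_bound[of "cmod (u - v)" "cmod (v - w)"] by (simp add: power2_sum)
  finally show ?thesis .
qed

lemma weighted_sq_integrable:
  assumes [measurable]: "f \<in> borel_measurable M" and b: "integrable M b" "\<And>x. b x \<ge> 0"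
    and B: "\<And>x. x \<in> space M \<Longrightarrow> cmod (f x) \<le> B"
  shows "integrable M (\<lambda>x. b x * (cmod (f x))\<^sup>2)"
proof (rule Bochner_Integration.integrable_bound)
  note [measurable] = borel_measurable_integrable[OF b(1)]
  show "integrable M (\<lambda>x. b x * B\<^sup>2)" using b(1) by simp
  show "AE x in M. norm (b x * (cmod (f x))\<^sup>2) \<le> norm (b x * B\<^sup>2)"
    using b(2) B by (intro AE_I2) (auto simp: abs_mult intro!: mult_left_mono power_mono)
  show "(\<lambda>x. b x * (cmod (f x))\<^sup>2) \<in> borel_measurable M" by measurable
qed

lemma weighted_sq_diff_integrable:
  assumes b: "\<And>x. b x \<ge> 0" and [measurable]: "b \<in> borel_measurable M" "f \<in> borel_measurable M" "g \<in>
      borel_measurable M"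
    and assms: "integrable M (\<lambda>x. b x * (cmod (f x))\<^sup>2)" "integrable M (\<lambda>x. b x * (cmod (g x))\<^sup>2)"
  shows "integrable M (\<lambda>x. b x * (cmod (f x - g x))\<^sup>2)"
proof (rule Bochner_Integration.integrable_bound)
  show "integrable M (\<lambda>x. 2 * (b x * (cmod (f x))\<^sup>2) + 2 * (b x * (cmod (g x))\<^sup>2))"
    using assms by simp
  have "b x * (cmod (f x - g x))\<^sup>2 \<le> b x * (2 * (cmod (f x))\<^sup>2 + 2 * (cmod (g x))\<^sup>2)" for x
    using cmod_diff_sq_le[of "f x" "g x" 0] b[of x] by (intro mult_left_mono) auto
  then show "AE x in M. norm (b x * (cmod (f x - g x))\<^sup>2)
      \<le> norm (2 * (b x * (cmod (f x))\<^sup>2) + 2 * (b x * (cmod (g x))\<^sup>2))"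
    using b by (intro AE_I2) (simp add: algebra_simps)
qed measurable

lemma weighted_sq_triangle:
  assumes b: "\<And>x. b x \<ge> 0" and assms: "integrable M (\<lambda>x. b x * (cmod (f x - g x))\<^sup>2)" "integrable M
      (\<lambda>x. b x * (cmod (g x - h x))\<^sup>2)"
  shows "integral\<^sup>L M (\<lambda>x. b x * (cmod (f x - h x))\<^sup>2) \<le>
    2 * integral\<^sup>L M (\<lambda>x. b x * (cmod (f x - g x))\<^sup>2) + 2 * integral\<^sup>L M (\<lambda>x. b x * (cmod (g x - h x))\<^sup>2)"
proof -
  have "b x * (cmod (f x - h x))\<^sup>2 \<le> b x * (2 * (cmod (f x - g x))\<^sup>2 + 2 * (cmod (g x - h x))\<^sup>2)" for x
    using cmod_diff_sq_le[of "f x" "h x" "g x"] b[of x] by (rule mult_left_mono)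
  then have "b x * (cmod (f x - h x))\<^sup>2 \<le> 2 * (b x * (cmod (f x - g x))\<^sup>2) + 2
      * (b x * (cmod (g x - h x))\<^sup>2)" for x
    by (simp add: distrib_left mult.left_commute)
  then have "integral\<^sup>L M (\<lambda>x. b x * (cmod (f x - h x))\<^sup>2) \<le>
    integral\<^sup>L M (\<lambda>x. 2 * (b x * (cmod (f x - g x))\<^sup>2) + 2 * (b x * (cmod (g x - h x))\<^sup>2))"
    using assms b by (intro integral_mono_AE' AE_I2) auto
  then show ?thesis using assms by simp
qed

text \<open>Truncation of \<open>f\<close> at modulus \<open>m\<close>; the integrand of
  \<open>f\<close> itself dominates the error.\<close>

lemma weighted_L2_bounded_approx:
  fixes b :: "real \<Rightarrow> real" and f :: "real \<Rightarrow> complex"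
  assumes b: "integrable (lebesgue_on {0..l}) b" "\<And>x. b x \<ge> 0"
    and f: "f \<in> borel_measurable (lebesgue_on {0..l})" "integrable (lebesgue_on {0..l}) (\<lambda>x. b x
        * (cmod (f x))\<^sup>2)"
    and e: "e > 0"
  shows "\<exists>g (m::nat). g \<in> borel_measurable (lebesgue_on {0..l}) \<and> (\<forall>x. cmod (g x) \<le> real m) \<and>
     integral\<^sup>L (lebesgue_on {0..l}) (\<lambda>x. b x * (cmod (f x - g x))\<^sup>2) < e"
proof -
  let ?M = "lebesgue_on {0..l}"
  note [measurable] = f(1) borel_measurable_integrable[OF b(1)]
  define g where "g m x = (if cmod (f x) \<le> real m then f x else 0)" for m x
  have gm[measurable]: "g m \<in> borel_measurable ?M" for m unfolding g_def by measurable
  have "(\<lambda>m. integral\<^sup>L ?M (\<lambda>x. b x * (cmod (f x - g m x))\<^sup>2)) \<longlonglongrightarrow> integral\<^sup>L ?M (\<lambda>x. 0)"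
  proof (rule integral_dominated_convergence[OF _ _ f(2)])
    show "AE x in ?M. (\<lambda>m. b x * (cmod (f x - g m x))\<^sup>2) \<longlonglongrightarrow> 0"
    proof (rule AE_I2)
      fix x
      have "\<forall>\<^sub>F m in sequentially. g m x = f x"
        using eventually_ge_at_top[of "nat \<lceil>cmod (f x)\<rceil>"]
          by eventually_elim (simp add: g_def nat_ceiling_le_eq)
      then have "\<forall>\<^sub>F m in sequentially. b x * (cmod (f x - g m x))\<^sup>2 = 0" by eventually_elim simp
      then show "(\<lambda>m. b x * (cmod (f x - g m x))\<^sup>2) \<longlonglongrightarrow> 0" by (rule tendsto_eventually)
    qed
    show "AE x in ?M. norm (b x * (cmod (f x - g m x))\<^sup>2) \<le> b x * (cmod (f x))\<^sup>2" for m
      using b(2) by (intro AE_I2) (auto simp: g_def)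
  qed measurable
  then have "\<forall>\<^sub>F m in sequentially. integral\<^sup>L ?M (\<lambda>x. b x * (cmod (f x - g m x))\<^sup>2) < e"
    using e by (intro order_tendstoD(2)) auto
  then obtain m where "integral\<^sup>L ?M (\<lambda>x. b x * (cmod (f x - g m x))\<^sup>2) < e"
    by (auto simp: eventually_sequentially)
  then show ?thesis by (intro exI[of _ "g m"] exI[of _ m]) (auto simp: g_def gm[unfolded g_def])
qed

lemma ac_poly:
  fixes p :: "real \<Rightarrow> complex"
  assumes "polynomial_function p" "0 \<le> l"
  shows "\<exists>p'. ac l p p'"
proof -
  obtain p' where p': "polynomial_function p'" "\<And>x. (p has_vector_derivative p' x) (at x)"
    using has_vector_derivative_polynomial_function[OF assms(1)] by blast
  have "ac l p p'"
  proof (rule acI[of _ _ _ "p 0"])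
    show "p' absolutely_integrable_on {0..l}"
      using continuous_on_polymonial_function[OF p'(1)] by (rule absolutely_integrable_continuous_real)
    fix x assume x: "0 \<le> x" "x \<le> l"
    have "(p' has_integral p x - p 0) {0..x}"
      using x p'(2) by (intro fundamental_theorem_of_calculus)
          (auto intro: has_vector_derivative_at_within)
    then show "p x = p 0 + integral {0..x} p'" by (simp add: integral_unique)
  qed
  then show ?thesis by blast
qed

text \<open>The approximants vanish at both endpoints because of the polynomial cutoffs
  \<open>1 - (1 - x (l - x) / l\<^sup>2) ^ i\<close>, which increase to 1 on the open interval.\<close>

lemma weighted_L2_smooth_approx:
  fixes b :: "real \<Rightarrow> real" and g :: "real \<Rightarrow> complex"
  assumes l: "l > 0" and b: "integrable (lebesgue_on {0..l}) b" "\<And>x. b x \<ge> 0"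
    and g: "g \<in> borel_measurable (lebesgue_on {0..l})" "\<And>x. cmod (g x) \<le> real m"
    and e: "e > 0"
  shows "\<exists>p p'. ac l p p' \<and> p 0 = 0 \<and> p l = 0 \<and>
     integral\<^sup>L (lebesgue_on {0..l}) (\<lambda>x. b x * (cmod (g x - p x))\<^sup>2) < e"
proof -
  let ?M = "lebesgue_on {0..l}"
  note [measurable] = g(1) borel_measurable_integrable[OF b(1)]
  have "g measurable_on {0..l}" using g(1) by (subst measurable_on_iff_borel_measurable) auto
  then obtain Z h where Z: "negligible Z" and h: "\<And>i. continuous_on UNIV (h i)"
    and lim: "\<And>x. x \<notin> Z \<Longrightarrow> (\<lambda>i. h i x) \<longlonglongrightarrow> (if x \<in> {0..l} then g x else 0)"
    unfolding measurable_on_def by blast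
  define m1 where "m1 = real m + 1"
  have m1: "m1 > 0" "\<And>x. cmod (g x) \<le> m1" using g(2) by (auto simp: m1_def intro: add_increasing2)
  \<comment> \<open>The radial retraction onto the disc of radius \<open>m1\<close>: it keeps the
    continuous approximants bounded and does not move the values of \<open>g\<close>.\<close>
  define clamp where "clamp z = (m1 / max m1 (cmod z)) *\<^sub>R z" for z
  have clamp_le: "cmod (clamp z) \<le> m1" for z
    using m1(1) by (auto simp: clamp_def max_def field_simps)
  have clamp_id: "clamp z = z" if "cmod z \<le> m1" for z using that m1(1) by (simp add: clamp_def max_def)
  have clamp_c: "continuous_on UNIV clamp"
    unfolding clamp_def using m1(1) by (intro continuous_intros) (auto simp: max_def)
  define \<zeta> where "\<zeta> i x = 1 - (1 - x * (l - x) / l\<^sup>2) ^ i" for i x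
  have xl: "0 \<le> x * (l - x) / l\<^sup>2" "x * (l - x) / l\<^sup>2 \<le> 1" if "x \<in> {0..l}" for x
  proof -
    have "x * (l - x) \<le> l * l" using that by (intro mult_mono) auto
    then show "0 \<le> x * (l - x) / l\<^sup>2" "x * (l - x) / l\<^sup>2 \<le> 1" using that l
      by (auto simp: power2_eq_square)
  qed
  have \<zeta>01: "0 \<le> \<zeta> i x" "\<zeta> i x \<le> 1" if "x \<in> {0..l}" for i x
    using xl[OF that] by (auto simp: \<zeta>_def power_le_one)
  have \<zeta>lim: "(\<lambda>i. \<zeta> i x) \<longlonglongrightarrow> 1" if "0 < x" "x < l" for x
  proof -
    have "0 < x * (l - x) / l\<^sup>2" using that l by simp
    then have "(\<lambda>i. 1 - (1 - x * (l - x) / l\<^sup>2) ^ i) \<longlonglongrightarrow> 1 - 0"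
      using xl[of x] that by (intro tendsto_intros LIMSEQ_power_zero) auto
    then show ?thesis by (simp add: \<zeta>_def)
  qed
  define q where "q i x = of_real (\<zeta> i x) * clamp (h i x)" for i x
  have hc: "continuous_on {0..l} (\<lambda>x. clamp (h i x))" for i
    using continuous_on_compose2[OF clamp_c h] by (auto intro: continuous_on_subset)
  have qc: "continuous_on {0..l} (q i)" for i
    unfolding q_def \<zeta>_def using l by (intro continuous_intros hc) auto
  have [measurable]: "q i \<in> borel_measurable ?M" for i
    using qc by (intro continuous_imp_measurable_on_sets_lebesgue) auto
  have qle: "cmod (q i x) \<le> m1" if "x \<in> {0..l}" for i x
    using mult_mono[OF \<zeta>01(2)[OF that, of i] clamp_le[of "h i x"]] \<zeta>01[OF that, of i]
      by (simp add: q_def norm_mult)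
  have Z0: "Z \<union> {0, l} \<in> null_sets lebesgue"
    using Z by (simp add: negligible_iff_null_sets[symmetric] negligible_insert)
  have "(\<lambda>i. integral\<^sup>L ?M (\<lambda>x. b x * (cmod (g x - q i x))\<^sup>2)) \<longlonglongrightarrow> integral\<^sup>L ?M (\<lambda>x. 0)"
  proof (rule integral_dominated_convergence[where w = "\<lambda>x. (2 * m1)\<^sup>2 * b x"])
    have "AE x in lebesgue. x \<notin> Z \<union> {0, l}" using Z0 by (rule AE_not_in)
    then have "AE x in lebesgue. x \<in> {0..l} \<longrightarrow> (\<lambda>i. b x * (cmod (g x - q i x))\<^sup>2) \<longlonglongrightarrow> 0"
    proof eventually_elim
      case (elim x)
      show ?case
      proof
        assume x: "x \<in> {0..l}"
        have "isCont clamp (g x)" using clamp_c by (simp add: continuous_on_eq_continuous_at)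
        then have "(\<lambda>i. clamp (h i x)) \<longlonglongrightarrow> clamp (g x)"
          using lim[of x] elim x by (intro isCont_tendsto_compose[of _ clamp]) auto
        then have "(\<lambda>i. q i x) \<longlonglongrightarrow> of_real 1 * g x"
          unfolding q_def clamp_id[OF m1(2)] using elim x by (intro tendsto_intros \<zeta>lim) auto
        then have "(\<lambda>i. b x * (cmod (g x - q i x))\<^sup>2) \<longlonglongrightarrow> b x * (cmod (g x - of_real 1 * g x))\<^sup>2"
          by (intro tendsto_intros)
        then show "(\<lambda>i. b x * (cmod (g x - q i x))\<^sup>2) \<longlonglongrightarrow> 0" by simp
      qed
    qed
    then show "AE x in ?M. (\<lambda>i. b x * (cmod (g x - q i x))\<^sup>2) \<longlonglongrightarrow> 0" by (subst AE_restrict_space_iff) auto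
    show "integrable ?M (\<lambda>x. (2 * m1)\<^sup>2 * b x)" using b(1) by simp
    fix i
    show "AE x in ?M. norm (b x * (cmod (g x - q i x))\<^sup>2) \<le> (2 * m1)\<^sup>2 * b x"
    proof (rule AE_I2)
      fix x assume "x \<in> space ?M"
      then have "cmod (g x - q i x) \<le> m1 + m1"
        using m1(2)[of x] qle[of x i] by (intro norm_triangle_le_diff add_mono) auto
      then have "(cmod (g x - q i x))\<^sup>2 \<le> (2 * m1)\<^sup>2" by (intro power_mono) auto
      then show "norm (b x * (cmod (g x - q i x))\<^sup>2) \<le> (2 * m1)\<^sup>2 * b x"
        using b(2)[of x] by (simp add: mult.commute mult_left_mono)
    qed
  qed measurable
  then have "\<forall>\<^sub>F i in sequentially. integral\<^sup>L ?M (\<lambda>x. b x * (cmod (g x - q i x))\<^sup>2) < e/4"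
    using e by (intro order_tendstoD(2)) auto
  then obtain i where i: "integral\<^sup>L ?M (\<lambda>x. b x * (cmod (g x - q i x))\<^sup>2) < e/4"
    by (auto simp: eventually_sequentially)
  define I where "I = integral\<^sup>L ?M b"
  have I0: "I \<ge> 0" unfolding I_def using b(2) by simp
  \<comment> \<open>A uniform error \<delta> costs at most
    \<open>\<delta>\<^sup>2 * I \<le> e / 4\<close> in the weighted integral;
    \<open>weighted_sq_triangle\<close> doubles this and the quarter from \<open>q i\<close>, which
    together stay below \<open>e\<close>.\<close>
  define \<delta> where "\<delta> = sqrt (e / (4 * (I + 1)))"
  have \<delta>: "\<delta> > 0" "\<delta>\<^sup>2 * I \<le> e/4"
  proof -
    show "\<delta> > 0" using e I0 by (simp add: \<delta>_def)
    have "\<delta>\<^sup>2 = e / (4 * (I + 1))" using e I0 by (simp add: \<delta>_def)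
    then have "\<delta>\<^sup>2 * (I + 1) = e/4" using I0 by (simp add: divide_simps) (simp add: algebra_simps)
    moreover have "\<delta>\<^sup>2 * I \<le> \<delta>\<^sup>2 * (I + 1)" by (intro mult_left_mono) auto
    ultimately show "\<delta>\<^sup>2 * I \<le> e/4" by simp
  qed
  \<comment> \<open>The approximants \<open>h i\<close> are only continuous; a polynomial takes
    their place because absolute continuity is required.\<close>
  obtain P where P: "polynomial_function P" "\<And>x. x \<in> {0..l} \<Longrightarrow> cmod (clamp (h i x) - P x) < \<delta>"
    using Stone_Weierstrass_polynomial_function[OF _ hc \<delta>(1), of i] by auto
  define p where "p x = of_real (\<zeta> i x) * P x" for x
  obtain P' where P': "ac l P P'" using ac_poly[OF P(1)] l by force
  have "\<exists>c. ac l (\<lambda>x. complex_of_real (\<zeta> i x)) c"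
  proof -
    have mult: "polynomial_function (\<lambda>x. f x * g x)"
      if "polynomial_function f" "polynomial_function g" for f g :: "real \<Rightarrow> real"
      using polynomial_function_mult[OF that] by simp
    have "polynomial_function (\<lambda>x. (1 - x * (l - x) / l\<^sup>2) ^ i)"
    proof (induction i)
      case (Suc i)
      have "polynomial_function (\<lambda>x. 1 - x * (l - x) * inverse (l\<^sup>2))"
        by (intro polynomial_function_diff mult polynomial_function_const polynomial_function_id)
      from mult[OF this Suc] show ?case by (simp add: divide_inverse)
    qed simp
    then have "polynomial_function (\<lambda>x. \<zeta> i x)"
      unfolding \<zeta>_def by (intro polynomial_function_diff polynomial_function_const)
    then have "polynomial_function (\<lambda>x. complex_of_real (\<zeta> i x))"
      using polynomial_function_compose[OF _ polynomial_function_bounded_linear[OF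
          bounded_linear_of_real]] by (simp add: o_def)
    then show ?thesis using ac_poly l by force
  qed
  then obtain c where c: "ac l (\<lambda>x. complex_of_real (\<zeta> i x)) c" by blast
  have pac: "ac l p (\<lambda>x. c x * P x + of_real (\<zeta> i x) * P' x)" unfolding p_def by (rule ac_mult[OF c P'])
  have [measurable]: "p \<in> borel_measurable ?M"
    using ac_continuous[OF pac] by (intro continuous_imp_measurable_on_sets_lebesgue) auto
  have qp: "cmod (q i x - p x) \<le> \<delta>" if "x \<in> {0..l}" for x
  proof -
    have "cmod (q i x - p x) = \<zeta> i x * cmod (clamp (h i x) - P x)"
      using \<zeta>01[OF that, of i] by (simp add: q_def p_def norm_mult flip: right_diff_distrib)
    also have "\<dots> \<le> 1 * \<delta>" using \<zeta>01[OF that, of i] P(2)[OF that] by (intro mult_mono) auto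
    finally show ?thesis by simp
  qed
  have i1: "integrable ?M (\<lambda>x. b x * (cmod (g x - q i x))\<^sup>2)"
  proof (rule weighted_sq_integrable[OF _ b, where B = "m1 + m1"])
    show "cmod (g x - q i x) \<le> m1 + m1" if "x \<in> space ?M" for x
      using m1(2)[of x] qle[of x i] that by (intro norm_triangle_le_diff add_mono) auto
  qed measurable
  have i2: "integrable ?M (\<lambda>x. b x * (cmod (q i x - p x))\<^sup>2)"
    by (rule weighted_sq_integrable[OF _ b, where B = \<delta>]) (use qp in auto)
  have "integral\<^sup>L ?M (\<lambda>x. b x * (cmod (q i x - p x))\<^sup>2) \<le> integral\<^sup>L ?M (\<lambda>x. b x * \<delta>\<^sup>2)"
    using b qp by (intro integral_mono_AE' AE_I2 mult_left_mono power_mono) auto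
  then have "integral\<^sup>L ?M (\<lambda>x. b x * (cmod (q i x - p x))\<^sup>2) \<le> \<delta>\<^sup>2 * I" by (simp add: I_def mult.commute)
  moreover have "integral\<^sup>L ?M (\<lambda>x. b x * (cmod (g x - p x))\<^sup>2) \<le>
    2 * integral\<^sup>L ?M (\<lambda>x. b x * (cmod (g x - q i x))\<^sup>2) + 2 * integral\<^sup>L ?M (\<lambda>x. b x
        * (cmod (q i x - p x))\<^sup>2)"
    by (rule weighted_sq_triangle[OF b(2) i1 i2])
  ultimately have "integral\<^sup>L ?M (\<lambda>x. b x * (cmod (g x - p x))\<^sup>2) < e" using i \<delta>(2) by linarith
  then show ?thesis using pac by (intro exI[of _ p] exI[of _ "\<lambda>x. c x * P x + of_real (\<zeta> i x) * P' x"])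
      (auto simp: p_def \<zeta>_def)
qed

section \<open>Completeness of the root vectors\<close>

definition Hip :: "nat \<Rightarrow> real \<Rightarrow> (nat \<Rightarrow> real \<Rightarrow> real) \<Rightarrow> (nat \<Rightarrow> real \<Rightarrow> complex) \<Rightarrow> (nat \<Rightarrow> real \<Rightarrow> complex) \<Rightarrow>
    complex" where
  "Hip n l beta u v = (\<Sum>k<n. integral\<^sup>L (lebesgue_on {0..l}) (\<lambda>x. of_real \<bar>beta k x\<bar>
      * (u k x * cnj (v k x))))"

definition addsc :: "complex \<Rightarrow> (nat \<Rightarrow> real \<Rightarrow> complex) \<Rightarrow> (nat \<Rightarrow> real \<Rightarrow> complex) \<Rightarrow> nat \<Rightarrow> real \<Rightarrow> complex"
    where
  "addsc c u v = (\<lambda>k x. u k x + c * v k x)"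

lemma hnorm_sq: "(hnorm n l beta u)\<^sup>2 = (\<Sum>k<n. integral\<^sup>L (lebesgue_on {0..l}) (\<lambda>x. \<bar>beta k x\<bar>
    * (cmod (u k x))\<^sup>2))"
  unfolding hnorm_def by (intro real_sqrt_pow2 sum_nonneg) simp

context first_order_system
begin

lemma beta_integrable: "k < n \<Longrightarrow> integrable (lebesgue_on {0..l}) (beta k)"
  using beta_absint by (simp add: lebesgue_on_absint_iff)

lemma HspD:
  assumes "u \<in> Hsp n l beta" "k < n"
  shows "u k \<in> borel_measurable (lebesgue_on {0..l})" "integrable (lebesgue_on {0..l}) (\<lambda>x. \<bar>beta k x\<bar>
      * (cmod (u k x))\<^sup>2)"
  using assms by (auto simp: Hsp_def)

lemma Hip_integrable:
  assumes "u \<in> Hsp n l beta" "v \<in> Hsp n l beta" "k < n"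
  shows "integrable (lebesgue_on {0..l}) (\<lambda>x. of_real \<bar>beta k x\<bar> * (u k x * cnj (v k x)))"
proof (rule Bochner_Integration.integrable_bound)
  note [measurable] = HspD(1)[OF assms(1,3)] HspD(1)[OF assms(2,3)]
      borel_measurable_integrable[OF beta_integrable[OF assms(3)]]
  show "integrable (lebesgue_on {0..l}) (\<lambda>x. \<bar>beta k x\<bar> * (cmod (u k x))\<^sup>2 + \<bar>beta k x\<bar>
      * (cmod (v k x))\<^sup>2)"
    by (intro Bochner_Integration.integrable_add HspD(2) assms)
  have [measurable]: "(\<lambda>x. cnj (v k x)) \<in> borel_measurable (lebesgue_on {0..l})"
    by (rule borel_measurable_continuous_on[where f = cnj]) (auto intro: continuous_intros)
  show "(\<lambda>x. of_real \<bar>beta k x\<bar> * (u k x * cnj (v k x))) \<in> borel_measurable (lebesgue_on {0..l})"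
    by measurable
  show "AE x in lebesgue_on {0..l}. norm (of_real \<bar>beta k x\<bar> * (u k x * cnj (v k x)))
      \<le> norm (\<bar>beta k x\<bar> * (cmod (u k x))\<^sup>2 + \<bar>beta k x\<bar> * (cmod (v k x))\<^sup>2)"
  proof (rule AE_I2)
    fix x
    have "cmod (u k x) * cmod (v k x) \<le> (cmod (u k x))\<^sup>2 + (cmod (v k x))\<^sup>2"
      using sum_squares_bound[of "cmod (u k x)" "cmod (v k x)"]
        mult_nonneg_nonneg[OF norm_ge_zero[of "u k x"] norm_ge_zero[of "v k x"]] by linarith
    then have "\<bar>beta k x\<bar> * (cmod (u k x) * cmod (v k x)) \<le> \<bar>beta k x\<bar>
        * ((cmod (u k x))\<^sup>2 + (cmod (v k x))\<^sup>2)"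
      by (intro mult_left_mono) auto
    then show "norm (of_real \<bar>beta k x\<bar> * (u k x * cnj (v k x)))
        \<le> norm (\<bar>beta k x\<bar> * (cmod (u k x))\<^sup>2 + \<bar>beta k x\<bar> * (cmod (v k x))\<^sup>2)"
      by (simp add: norm_mult distrib_left)
  qed
qed

lemma Hsp_addsc:
  assumes "u \<in> Hsp n l beta" "v \<in> Hsp n l beta" shows "addsc c u v \<in> Hsp n l beta"
  unfolding Hsp_def mem_Collect_eq
proof (intro allI impI conjI)
  fix k assume k: "k < n"
  note [measurable] = HspD(1)[OF assms(1) k] HspD(1)[OF assms(2) k]
      borel_measurable_integrable[OF beta_integrable[OF k]]
  show m[measurable]: "addsc c u v k \<in> borel_measurable (lebesgue_on {0..l})" unfolding addsc_def
    by measurable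
  show "integrable (lebesgue_on {0..l}) (\<lambda>x. \<bar>beta k x\<bar> * (cmod (addsc c u v k x))\<^sup>2)"
  proof -
    have "integrable (lebesgue_on {0..l}) (\<lambda>x. \<bar>beta k x\<bar> * (cmod (- c * v k x))\<^sup>2)"
      using integrable_mult_right[OF HspD(2)[OF assms(2) k], of "(cmod c)\<^sup>2"]
      by (simp add: norm_mult power_mult_distrib mult.left_commute)
    from weighted_sq_diff_integrable[OF _ _ _ _ HspD(2)[OF assms(1) k] this] show ?thesis
      by (simp add: addsc_def)
  qed
qed

sublocale Hil: semi_ip "Hsp n l beta" addsc "Hip n l beta" "hnorm n l beta"
proof
  fix u v w c assume u: "u \<in> Hsp n l beta" and v: "v \<in> Hsp n l beta"
  show "addsc c u v \<in> Hsp n l beta" by (rule Hsp_addsc[OF u v])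
  show "Hip n l beta v u = cnj (Hip n l beta u v)"
    unfolding Hip_def cnj_sum
  proof (rule sum.cong[OF refl])
    fix k
    have "(\<lambda>x. of_real \<bar>beta k x\<bar> * (v k x * cnj (u k x)))
        = (\<lambda>x. cnj (of_real \<bar>beta k x\<bar> * (u k x * cnj (v k x))))"
      by (simp add: mult.commute)
    then show "integral\<^sup>L (lebesgue_on {0..l}) (\<lambda>x. of_real \<bar>beta k x\<bar> * (v k x * cnj (u k x))) =
       cnj (integral\<^sup>L (lebesgue_on {0..l}) (\<lambda>x. of_real \<bar>beta k x\<bar> * (u k x * cnj (v k x))))"
      by (simp only: Bochner_Integration.integral_cnj)
  qed
  assume w: "w \<in> Hsp n l beta"
  have "integral\<^sup>L (lebesgue_on {0..l}) (\<lambda>x. of_real \<bar>beta k x\<bar> * (addsc c u v k x * cnj (w k x)))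
    = integral\<^sup>L (lebesgue_on {0..l}) (\<lambda>x. of_real \<bar>beta k x\<bar> * (u k x * cnj (w k x)))
      + c * integral\<^sup>L (lebesgue_on {0..l}) (\<lambda>x. of_real \<bar>beta k x\<bar> * (v k x * cnj (w k x)))" if k: "k
          < n" for k
  proof -
    have "integral\<^sup>L (lebesgue_on {0..l}) (\<lambda>x. of_real \<bar>beta k x\<bar> * (addsc c u v k x * cnj (w k x)))
      = integral\<^sup>L (lebesgue_on {0..l}) (\<lambda>x. of_real \<bar>beta k x\<bar> * (u k x * cnj (w k x)) + c
          * (of_real \<bar>beta k x\<bar> * (v k x * cnj (w k x))))"
      by (rule Bochner_Integration.integral_cong) (auto simp: addsc_def algebra_simps)
    also have "\<dots> = integral\<^sup>L (lebesgue_on {0..l}) (\<lambda>x. of_real \<bar>beta k x\<bar> * (u k x * cnj (w k x)))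
       + integral\<^sup>L (lebesgue_on {0..l}) (\<lambda>x. c * (of_real \<bar>beta k x\<bar> * (v k x * cnj (w k x))))"
      by (intro Bochner_Integration.integral_add integrable_mult_right Hip_integrable u v w k)
    finally show ?thesis by (simp only: integral_mult_right_zero)
  qed
  then show "Hip n l beta (addsc c u v) w = Hip n l beta u w + c * Hip n l beta v w"
    unfolding Hip_def by (simp add: sum.distrib sum_distrib_left)
next
  fix u
  have "integral\<^sup>L (lebesgue_on {0..l}) (\<lambda>x. of_real \<bar>beta k x\<bar> * (u k x * cnj (u k x)))
     = complex_of_real (integral\<^sup>L (lebesgue_on {0..l}) (\<lambda>x. \<bar>beta k x\<bar> * (cmod (u k x))\<^sup>2))" for k
    unfolding integral_complex_of_real[symmetric]
    by (rule Bochner_Integration.integral_cong) (simp_all flip: complex_norm_square)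
  then show "Hip n l beta u u = complex_of_real ((hnorm n l beta u)\<^sup>2)"
    unfolding Hip_def hnorm_sq by simp
  show "0 \<le> hnorm n l beta u" unfolding hnorm_def by (intro real_sqrt_ge_zero sum_nonneg) simp
qed

lemma cont_comps_hnorm_le:
  assumes u: "cont_comps l n u" and B: "B \<ge> 0" "\<And>k x. k < n \<Longrightarrow> 0 \<le> x \<Longrightarrow> x \<le> l \<Longrightarrow> cmod (u k x) \<le> B"
  shows "hnorm n l beta u \<le> sqrt (\<Sum>k<n. integral\<^sup>L (lebesgue_on {0..l}) (\<lambda>x. \<bar>beta k x\<bar>)) * B"
proof -
  have "(\<Sum>k<n. integral\<^sup>L (lebesgue_on {0..l}) (\<lambda>x. \<bar>beta k x\<bar> * (cmod (u k x))\<^sup>2))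
      \<le> (\<Sum>k<n. integral\<^sup>L (lebesgue_on {0..l}) (\<lambda>x. \<bar>beta k x\<bar> * B\<^sup>2))"
  proof (intro sum_mono integral_mono_AE' AE_I2)
    fix k x assume "k \<in> {..<n}" "x \<in> space (lebesgue_on {0..l})"
    then show "\<bar>beta k x\<bar> * (cmod (u k x))\<^sup>2 \<le> \<bar>beta k x\<bar> * B\<^sup>2"
      using B by (intro mult_left_mono power_mono) auto
  qed (use beta_integrable in auto)
  also have "\<dots> = (\<Sum>k<n. integral\<^sup>L (lebesgue_on {0..l}) (\<lambda>x. \<bar>beta k x\<bar>)) * B\<^sup>2"
    by (simp add: sum_distrib_right)
  finally have "hnorm n l beta u \<le> sqrt ((\<Sum>k<n. integral\<^sup>L (lebesgue_on {0..l}) (\<lambda>x. \<bar>beta k x\<bar>)) * B\<^sup>2)"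
    unfolding hnorm_def by (rule real_sqrt_le_mono)
  then show ?thesis using B(1) by (simp add: real_sqrt_mult)
qed

text \<open>Vanishing at both ends annihilates every boundary form, whatever \<open>C\<close> and
  \<open>D\<close> are. Membership in the domain of the operator is not demanded:
  \<open>f' + Q f\<close> is merely integrable, which suffices for a forcing term in the a priori
  estimate.\<close>

definition testfun :: "(nat \<Rightarrow> real \<Rightarrow> complex) \<Rightarrow> bool" where
  "testfun f \<longleftrightarrow> (\<forall>k<n. f k 0 = 0 \<and> f k l = 0 \<and> (\<exists>f'. ac l (f k) f'))"

lemma testfun_cont_comps: "testfun f \<Longrightarrow> cont_comps l n f"
  unfolding testfun_def cont_comps_def using ac_continuous by blast

lemma testfun_dense:
  assumes f: "f \<in> Hsp n l beta" and e: "e > 0"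
  shows "\<exists>p. testfun p \<and> hnorm n l beta (addsc (-1) f p) < e"
proof -
  let ?M = "lebesgue_on {0..l}"
  \<comment> \<open>Each component contributes at most \<open>4 * \<eta>\<close>, and
    \<open>n\<close> such contributions stay below \<open>e\<^sup>2\<close>.\<close>
  define \<eta> where "\<eta> = e\<^sup>2 / (8 * (real n + 1))"
  have \<eta>: "\<eta> > 0" using e by (simp add: \<eta>_def)
  have "\<exists>p. (\<exists>p'. ac l p p') \<and> p 0 = 0 \<and> p l = 0 \<and> integral\<^sup>L ?M (\<lambda>x. \<bar>beta k x\<bar>
      * (cmod (f k x - p x))\<^sup>2) \<le> 4 * \<eta>" if k: "k < n" for k
  proof -
    note fk = HspD[OF f k]
    have b: "integrable ?M (\<lambda>x. \<bar>beta k x\<bar>)" using beta_integrable[OF k] by simp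
    obtain g m where g: "g \<in> borel_measurable ?M" "\<And>x. cmod (g x) \<le> real m"
      and fg: "integral\<^sup>L ?M (\<lambda>x. \<bar>beta k x\<bar> * (cmod (f k x - g x))\<^sup>2) < \<eta>"
      using weighted_L2_bounded_approx[OF b _ fk \<eta>] by auto
    obtain p p' where p: "ac l p p'" "p 0 = 0" "p l = 0"
      and gp: "integral\<^sup>L ?M (\<lambda>x. \<bar>beta k x\<bar> * (cmod (g x - p x))\<^sup>2) < \<eta>"
      using weighted_L2_smooth_approx[OF l_pos b _ g \<eta>] by auto
    note [measurable] = fk(1) g(1) borel_measurable_integrable[OF beta_integrable[OF k]]
    have pm[measurable]: "p \<in> borel_measurable ?M"
      using ac_continuous[OF p(1)] by (intro continuous_imp_measurable_on_sets_lebesgue) auto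
    obtain B where "\<forall>y\<in>p ` {0..l}. cmod y \<le> B"
      using compact_imp_bounded[OF compact_continuous_image[OF ac_continuous[OF p(1)] compact_Icc]]
      unfolding bounded_iff by blast
    then have B: "\<And>x. x \<in> {0..l} \<Longrightarrow> cmod (p x) \<le> B" by blast
    have "integrable ?M (\<lambda>x. \<bar>beta k x\<bar> * (cmod (g x))\<^sup>2)"
      by (rule weighted_sq_integrable[OF g(1) b _ g(2)]) simp
    then have fg_int: "integrable ?M (\<lambda>x. \<bar>beta k x\<bar> * (cmod (f k x - g x))\<^sup>2)"
      by (intro weighted_sq_diff_integrable fk(2)) simp_all
    have "cmod (g x - p x) \<le> real m + B" if "x \<in> space ?M" for x
      using g(2)[of x] B[of x] that by (intro norm_triangle_le_diff add_mono) auto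
    then have gp_int: "integrable ?M (\<lambda>x. \<bar>beta k x\<bar> * (cmod (g x - p x))\<^sup>2)"
      by (intro weighted_sq_integrable[OF _ b]) simp_all
    have "integral\<^sup>L ?M (\<lambda>x. \<bar>beta k x\<bar> * (cmod (f k x - p x))\<^sup>2) \<le>
       2 * integral\<^sup>L ?M (\<lambda>x. \<bar>beta k x\<bar> * (cmod (f k x - g x))\<^sup>2) + 2
           * integral\<^sup>L ?M (\<lambda>x. \<bar>beta k x\<bar> * (cmod (g x - p x))\<^sup>2)"
      by (rule weighted_sq_triangle[OF _ fg_int gp_int]) simp
    also have "\<dots> \<le> 4 * \<eta>" using fg gp by linarith
    finally show ?thesis using p by blast
  qed
  then have "\<forall>k\<in>{..<n}. \<exists>p. (\<exists>p'. ac l p p') \<and> p 0 = 0 \<and> p l = 0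
      \<and> integral\<^sup>L ?M (\<lambda>x. \<bar>beta k x\<bar> * (cmod (f k x - p x))\<^sup>2) \<le> 4 * \<eta>"
    by blast
  then obtain p where p: "\<forall>k\<in>{..<n}. (\<exists>p'. ac l (p k) p') \<and> p k 0 = 0 \<and> p k l = 0
      \<and> integral\<^sup>L ?M (\<lambda>x. \<bar>beta k x\<bar> * (cmod (f k x - p k x))\<^sup>2) \<le> 4 * \<eta>"
    unfolding bchoice_iff by blast
  have "testfun p" unfolding testfun_def using p by simp
  moreover have "hnorm n l beta (addsc (-1) f p) < e"
  proof -
    have "(hnorm n l beta (addsc (-1) f p))\<^sup>2 \<le> (\<Sum>k<n. 4 * \<eta>)"
      unfolding hnorm_sq addsc_def using p by (intro sum_mono) simp
    also have "\<dots> = e\<^sup>2 * (real n / (2 * (real n + 1)))" by (simp add: \<eta>_def field_simps)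
    also have "\<dots> < e\<^sup>2 * 1" using e by (intro mult_strict_left_mono) (auto simp: field_simps)
    finally show ?thesis using e by (intro power2_less_imp_less[of _ e]) auto
  qed
  ultimately show ?thesis by blast
qed

end

section \<open>Bounds for the resolvent\<close>

context boundary_problem
begin

text \<open>The summand 0 gives the expression the shape to which \<open>lin_sys_add_scaled\<close>
  and \<open>sup_functional_add_scaled\<close> apply.\<close>

definition resolvent :: "(nat \<Rightarrow> real \<Rightarrow> complex) \<Rightarrow> complex \<Rightarrow> nat \<Rightarrow> real \<Rightarrow> complex" where
  "resolvent g lam = (\<lambda>k x. 0 + inverse (char_det lam) * N g lam k x)"

lemma resolvent_lin_sys: assumes "cont_comps l n g" "char_det lam \<noteq> 0"
  shows "lin_sys l n (A lam) (src g) (resolvent g lam)"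
proof -
  have "lin_sys l n (A lam) (\<lambda>k t. 0 + inverse (char_det lam) * (char_det lam * src g k t))
      (resolvent g lam)"
    unfolding resolvent_def by (intro lin_sys_add_scaled lin_sys_zero N_lin_sys assms)
  then show ?thesis using assms(2) by (simp flip: mult.assoc)
qed

lemma sup_functional_resolvent: assumes "sup_functional l n \<phi>" "cont_comps l n g"
  shows "\<phi> (resolvent g lam) = inverse (char_det lam) * \<phi> (N g lam)"
  unfolding resolvent_def using sup_functional_add_scaled[OF assms(1) cont_comps_zero
      N_cont_comps[OF assms(2)]] sup_functional_zero[OF assms(1)] by simp

lemma U_resolvent: "cont_comps l n g \<Longrightarrow> i < n \<Longrightarrow> U i (resolvent g lam) = 0"
  by (simp add: sup_functional_resolvent[OF sup_functional_U] U_N)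

end

context signed_problem
begin

lemma char_det_nonzero:
  assumes reg: "Determinant.det Smat \<noteq> 0"
  shows "\<forall>\<^sub>F \<kappa> in at_top. \<forall>lam. Im lam = \<kappa> \<longrightarrow> char_det lam \<noteq> 0"
proof -
  obtain c where c: "c > 0" and ev: "\<forall>\<^sub>F \<kappa> in at_top. \<forall>lam. Im lam = \<kappa> \<longrightarrow>
     cmod (char_det lam) \<ge> c * exp (- \<kappa> * (\<Sum>k | k < n \<and> \<not> pos k. rho k l))" using
         char_det_lower[OF reg] by blast
  from ev show ?thesis
  proof eventually_elim
    case (elim \<kappa>)
    have "c * exp (- \<kappa> * (\<Sum>k | k < n \<and> \<not> pos k. rho k l)) > 0" using c by simp
    then show ?case using elim by fastforce
  qed
qed

text \<open>The resolvent has zero boundary forms, and the L1 norm of its forcing bounds all kernel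
  integrals, so the a priori estimate bounds it uniformly in the half plane. Boundedness without
  decay is all that Liouville's theorem asks for.\<close>

lemma quotient_bound_upper:
  assumes reg: "Determinant.det Smat \<noteq> 0" and \<phi>: "sup_functional l n \<phi>" and g: "cont_comps l n g"
  shows "\<exists>K. \<forall>\<^sub>F \<kappa> in at_top. \<forall>lam. Im lam = \<kappa> \<longrightarrow> char_det lam \<noteq> 0 \<and> cmod (\<phi> (N g lam)) \<le> K
      * cmod (char_det lam)"
proof -
  obtain K where K: "K \<ge> 0" and est: "\<forall>\<^sub>F \<kappa> in at_top. apriori K \<kappa>"
    using main_estimate[OF reg] by blast
  obtain K' where K': "K' \<ge> 0" "\<And>u B. cont_comps l n u \<Longrightarrow> B \<ge> 0
      \<Longrightarrow> (\<And>k x. k < n \<Longrightarrow> 0 \<le> x \<Longrightarrow> x \<le> l \<Longrightarrow> cmod (u k x) \<le> B) \<Longrightarrow> cmod (\<phi> u) \<le> K' * B"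
    using sup_functional_bound[OF \<phi>] by blast
  define G where "G = (\<Sum>k<n. integral {0..l} (\<lambda>t. cmod (src g k t)))"
  have sn: "(\<lambda>t. cmod (src g k t)) absolutely_integrable_on {0..l}" if "k < n" for k
    using absint_norm[OF src_absint[OF g that]] by simp
  have in0: "0 \<le> integral {0..l} (\<lambda>t. cmod (src g k t))" if "k < n" for k
    by (rule Henstock_Kurzweil_Integration.integral_nonneg[OF absint_integrable[OF sn[OF that]]]) simp
  have G0: "G \<ge> 0" unfolding G_def using in0 by (intro sum_nonneg) auto
  have GB: "Gbound \<kappa> (src g) G" if "\<kappa> \<ge> 0" for \<kappa>
    unfolding Gbound_def
  proof (intro conjI allI impI ballI G0)
    fix k x assume k: "k < n" and x: "x \<in> {0..l}"
    have "integral {0..l} (\<lambda>t. kern \<kappa> k x t * cmod (src g k t)) \<le> integral {0..l} (\<lambda>t. cmod (src g k t))"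
    proof (rule integral_le)
      show "kern \<kappa> k x t * cmod (src g k t) \<le> cmod (src g k t)" for t
        using that by (intro mult_left_le_one_le) (auto simp: kern_def)
    qed (use absint_integrable[OF sn[OF k]] absint_integrable[OF kern_absint[OF k sn[OF k]]] in auto)
    also have "\<dots> \<le> G" unfolding G_def using k in0
      by (intro member_le_sum[of k "{..<n}" "\<lambda>k. integral {0..l} (\<lambda>t. cmod (src g k t))"]) auto
    finally show "integral {0..l} (\<lambda>t. kern \<kappa> k x t * cmod (src g k t)) \<le> G" .
  qed
  have "\<forall>\<^sub>F \<kappa> in at_top. \<forall>lam. Im lam = \<kappa> \<longrightarrow> char_det lam \<noteq> 0 \<and> cmod (\<phi> (N g lam)) \<le> K' * (K * G)
      * cmod (char_det lam)"
    using est char_det_nonzero[OF reg] eventually_ge_at_top[of 0]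
  proof eventually_elim
    case (elim \<kappa>)
    show ?case
    proof (intro allI impI conjI)
      fix lam assume lam: "Im lam = \<kappa>"
      show nz: "char_det lam \<noteq> 0" using elim lam by blast
      have R: "lin_sys l n (A lam) (src g) (resolvent g lam)" by (rule resolvent_lin_sys[OF g nz])
      have "\<forall>x\<in>{0..l}. (\<Sum>k<n. cmod (resolvent g lam k x)) \<le> K
          * ((\<Sum>i<n. cmod (U i (resolvent g lam))) + G)"
        using elim(1)[unfolded apriori_def, rule_format, OF lam R _ GB[OF elim(3)]] src_absint[OF g]
          by blast
      then have s: "(\<Sum>k<n. cmod (resolvent g lam k x)) \<le> K * G" if "0 \<le> x" "x \<le> l" for x
        using that U_resolvent[OF g] by simp
      have "cmod (resolvent g lam k x) \<le> K * G" if "k < n" "0 \<le> x" "x \<le> l" for k x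
        using member_le_sum[of k "{..<n}" "\<lambda>k. cmod (resolvent g lam k x)"] s[OF that(2,3)] that(1)
          by auto
      then have "cmod (\<phi> (resolvent g lam)) \<le> K' * (K * G)"
        using K G0 by (intro K'(2) lin_sys_cont_comps[OF R]) auto
      then have "cmod (\<phi> (resolvent g lam)) * cmod (char_det lam) \<le> K' * (K * G) * cmod (char_det lam)"
        by (rule mult_right_mono) simp
      then show "cmod (\<phi> (N g lam)) \<le> K' * (K * G) * cmod (char_det lam)"
      proof -
        have "\<phi> (resolvent g lam) * char_det lam = \<phi> (N g lam)" using nz
          by (simp add: sup_functional_resolvent[OF \<phi> g])
        then have "cmod (\<phi> (N g lam)) = cmod (\<phi> (resolvent g lam)) * cmod (char_det lam)"
          by (metis norm_mult)
        then show ?thesis using \<open>_ \<le> K' * (K * G) * cmod (char_det lam)\<close> by simp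
      qed
    qed
  qed
  then show ?thesis by blast
qed

section \<open>Reflection to the lower half plane\<close>

lemma signed_problem_neg: "signed_problem n l (\<lambda>k x. - beta k x) Q C D"
proof
  fix k assume k: "k < n"
  show "(\<lambda>x. - beta k x) absolutely_integrable_on {0..l}" by (rule absint_minus[OF beta_absint[OF k]])
  show "(AE x in lebesgue_on {0..l}. - beta k x > 0) \<or> (AE x in lebesgue_on {0..l}. - beta k x < 0)"
    using beta_sign[OF k] by auto
qed (use l_pos Q_absint C_car D_car in auto)

text \<open>Reflection \<open>lam \<mapsto> - lam\<close>, \<open>beta \<mapsto> - beta\<close> exchanges the two half planes.\<close>

interpretation neg: signed_problem n l "\<lambda>k x. - beta k x" Q C D by (rule signed_problem_neg)

lemma neg_A: "neg.A (- lam) = A lam" by (intro ext) (simp add: neg.A_def A_def)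

lemma neg_src: "neg.src (\<lambda>k x. - g k x) = src g" by (intro ext) (simp add: neg.src_def src_def)

lemma neg_E: "neg.E j (- lam) = E j lam" by (simp add: neg.E_def E_def neg.ivp_def ivp_def neg_A)

lemma neg_T: "neg.T (- lam) (\<lambda>k x. - g k x) = T lam g"
  by (simp add: neg.T_def T_def neg.ivp_def ivp_def neg_A neg_src)

lemma neg_bc_mat: "neg.bc_mat (- lam) = bc_mat lam" by (simp add: neg.bc_mat_def bc_mat_def neg_E)

lemma neg_char_det: "neg.char_det (- lam) = char_det lam"
  by (simp add: neg.char_det_def char_det_def neg_bc_mat)

lemma neg_N: "neg.N (\<lambda>k x. - g k x) (- lam) = N g lam"
  by (simp add: neg.N_def N_def neg.cramer_coef_def cramer_coef_def neg_bc_mat neg_T neg_E neg_char_det)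

lemma neg_rho: "neg.rho k x = - rho k x" by (simp add: neg.rho_def rho_def)

text \<open>After reflection every component decays from the opposite endpoint, which exchanges the
  roles of \<open>C\<close> and \<open>D\<close> in \<open>Smat\<close>.\<close>

lemma neg_pos: "k < n \<Longrightarrow> neg.pos k \<longleftrightarrow> \<not> pos k"
  using rho_l_neq_0[of k] by (auto simp: neg.pos_def pos_def neg_rho)

lemma quotient_bound_lower:
  assumes reg: "Determinant.det neg.Smat \<noteq> 0" and \<phi>: "sup_functional l n \<phi>" and g: "cont_comps l n g"
  shows "\<exists>K. \<forall>\<^sub>F \<kappa> in at_top. \<forall>lam. Im lam = - \<kappa> \<longrightarrow> char_det lam \<noteq> 0 \<and> cmod (\<phi> (N g lam)) \<le> K
      * cmod (char_det lam)"
proof -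
  have g': "cont_comps l n (\<lambda>k x. - g k x)" using g unfolding cont_comps_def
    by (auto intro: continuous_intros)
  obtain K where "\<forall>\<^sub>F \<kappa> in at_top. \<forall>lam. Im lam = \<kappa> \<longrightarrow> neg.char_det lam \<noteq> 0
      \<and> cmod (\<phi> (neg.N (\<lambda>k x. - g k x) lam)) \<le> K * cmod (neg.char_det lam)"
    using neg.quotient_bound_upper[OF reg \<phi> g'] by blast
  then have "\<forall>\<^sub>F \<kappa> in at_top. \<forall>lam. Im lam = - \<kappa> \<longrightarrow> char_det lam \<noteq> 0 \<and> cmod (\<phi> (N g lam)) \<le> K
      * cmod (char_det lam)"
  proof eventually_elim
    case (elim \<kappa>)
    show ?case
    proof (intro allI impI)
      fix lam assume "Im lam = - \<kappa>"
      then have "Im (- lam) = \<kappa>" by simp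
      from elim[rule_format, OF this] show "char_det lam \<noteq> 0 \<and> cmod (\<phi> (N g lam)) \<le> K
          * cmod (char_det lam)"
        unfolding neg_char_det neg_N .
    qed
  qed
  then show ?thesis by blast
qed

lemma resolvent_functional_const:
  assumes regs: "Determinant.det Smat \<noteq> 0" "Determinant.det neg.Smat \<noteq> 0" and \<phi>: "sup_functional l n \<phi>"
    and g: "cont_comps l n g"
    and roots: "\<And>u lam m. cont_comps l n u \<Longrightarrow> root_of n l beta Q C D lam m u \<Longrightarrow> \<phi> u = 0"
  shows "\<exists>a. \<forall>lam. \<phi> (N g lam) = a * char_det lam"
proof -
  obtain K1 K2 where ev: "\<forall>\<^sub>F \<kappa> in at_top. \<forall>lam. Im lam = \<kappa> \<longrightarrow> char_det lam \<noteq> 0 \<and> cmod (\<phi> (N g lam))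
      \<le> K1 * cmod (char_det lam)"
    "\<forall>\<^sub>F \<kappa> in at_top. \<forall>lam. Im lam = - \<kappa> \<longrightarrow> char_det lam \<noteq> 0 \<and> cmod (\<phi> (N g lam)) \<le> K2
        * cmod (char_det lam)"
    using quotient_bound_upper[OF regs(1) \<phi> g] quotient_bound_lower[OF regs(2) \<phi> g] by blast
  obtain c where c: "c > 0" "\<forall>\<^sub>F \<kappa> in at_top. \<forall>lam. Im lam = \<kappa> \<longrightarrow>
     cmod (char_det lam) \<ge> c * exp (- \<kappa> * (\<Sum>k | k < n \<and> \<not> pos k. rho k l))" using
         char_det_lower[OF regs(1)] by blast
  \<comment> \<open>One height \<open>\<kappa>0\<close> serves both half-plane bounds and the lower
    bound on the line \<open>Im z = \<kappa>0\<close>.\<close>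
  from eventually_conj[OF ev(1) eventually_conj[OF ev(2)
      eventually_conj[OF c(2) eventually_ge_at_top[of 0]]]]
  obtain \<kappa>0 where k0: "\<And>\<kappa>. \<kappa> \<ge> \<kappa>0 \<Longrightarrow> (\<forall>lam. Im lam = \<kappa> \<longrightarrow> char_det lam \<noteq> 0 \<and> cmod (\<phi> (N g lam)) \<le> K1
      * cmod (char_det lam)) \<and>
     (\<forall>lam. Im lam = - \<kappa> \<longrightarrow> char_det lam \<noteq> 0 \<and> cmod (\<phi> (N g lam)) \<le> K2 * cmod (char_det lam)) \<and>
     (\<forall>lam. Im lam = \<kappa> \<longrightarrow> cmod (char_det lam) \<ge> c * exp (- \<kappa> * (\<Sum>k | k < n \<and> \<not> pos k. rho k l))) \<and> 0 \<le> \<kappa>"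
    unfolding eventually_at_top_linorder by blast
  have nz: "char_det (\<i> * of_real \<kappa>0) \<noteq> 0" using k0[of \<kappa>0] by simp
  obtain F where F: "F holomorphic_on UNIV" "\<And>z. \<phi> (N g z) = F z * char_det z"
  proof -
    have "\<exists>K r. r > 0 \<and> (\<forall>z. cmod (z - z0) < r \<longrightarrow> cmod (\<phi> (N g z)) \<le> K * cmod (char_det z))"
      if "char_det z0 = 0" for z0
      using pole_removal[OF \<phi> g _ that nz] roots by blast
    from entire_quotient[OF strip_entire_holomorphic[OF sup_functional_N_strip_entire[OF \<phi> g]]
        strip_entire_holomorphic[OF char_det_strip_entire] nz this] that show ?thesis by blast
  qed
  have "bounded (range F)"
  proof (rule strip_quotient_bounded[OF F(1) sup_functional_N_strip_entire[OF \<phi> g]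
      char_det_strip_entire F(2)])
    show "c * exp (- \<kappa>0 * (\<Sum>k | k < n \<and> \<not> pos k. rho k l)) > 0" using c by simp
    show "c * exp (- \<kappa>0 * (\<Sum>k | k < n \<and> \<not> pos k. rho k l)) \<le> cmod (char_det z)" if "Im z = \<kappa>0" for z
      using k0[of \<kappa>0] that by blast
    show "cmod (F z) \<le> max K1 K2" if z: "\<kappa>0 \<le> \<bar>Im z\<bar>" for z
    proof -
      have "char_det z \<noteq> 0 \<and> (cmod (\<phi> (N g z)) \<le> K1 * cmod (char_det z) \<or> cmod (\<phi> (N g z)) \<le> K2
          * cmod (char_det z))"
      proof (cases "Im z \<ge> 0")
        case True
        then show ?thesis using k0[OF z] by auto
      next
        case False
        then have "Im z = - \<bar>Im z\<bar>" by simp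
        then show ?thesis using k0[OF z] by blast
      qed
      then show ?thesis unfolding F(2) norm_mult by auto
    qed
  qed
  then obtain a where "\<And>z. F z = a" using Liouville_theorem[OF F(1)] unfolding constant_on_def by blast
  then show ?thesis using F(2) by auto
qed

text \<open>A test function \<open>f\<close> satisfies every boundary condition, so \<open>w = - lam R(lam) f - f\<close> solves the
  boundary value problem with the source \<open>- f' - Q f\<close>, which does not depend on \<open>lam\<close>.\<close>

lemma testfun_annihilated:
  assumes regs: "Determinant.det Smat \<noteq> 0" "Determinant.det neg.Smat \<noteq> 0" and \<phi>: "sup_functional l n \<phi>"
    and f: "testfun f"
    and roots: "\<And>u lam m. cont_comps l n u \<Longrightarrow> root_of n l beta Q C D lam m u \<Longrightarrow> \<phi> u = 0"
  shows "\<phi> f = 0"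
proof -
  have fc: "cont_comps l n f" by (rule testfun_cont_comps[OF f])
  obtain a where a: "\<And>lam. \<phi> (N f lam) = a * char_det lam"
    using resolvent_functional_const[OF regs \<phi> fc] roots by blast
  have "\<forall>k\<in>{..<n}. \<exists>f'. ac l (f k) f'" using f by (simp add: testfun_def)
  then obtain f' where f': "\<And>k. k < n \<Longrightarrow> ac l (f k) (f' k)" unfolding bchoice_iff by auto
  obtain K where K: "K \<ge> 0" and est: "\<forall>\<^sub>F \<kappa> in at_top. apriori K \<kappa>"
    using main_estimate[OF regs(1)] by blast
  obtain K' where K': "K' \<ge> 0" "\<And>u B. cont_comps l n u \<Longrightarrow> B \<ge> 0
      \<Longrightarrow> (\<And>k x. k < n \<Longrightarrow> 0 \<le> x \<Longrightarrow> x \<le> l \<Longrightarrow> cmod (u k x) \<le> B) \<Longrightarrow> cmod (\<phi> u) \<le> K' * B"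
    using sup_functional_bound[OF \<phi>] by blast
  define hw where "hw k t = - f' k t - (\<Sum>j<n. Q k j t * f j t)" for k t
  have hw: "hw k absolutely_integrable_on {0..l}" if "k < n" for k
    unfolding hw_def[abs_def] using that fc
    by (intro set_integral_diff absint_minus ac_absint[OF f'] absolutely_integrable_sum
        absint_mult_cont2 Q_absint) (auto simp: cont_comps_def)
  \<comment> \<open>\<open>a\<close> is the constant value of
    \<open>\<phi> (resolvent f lam)\<close>, and \<open>w\<close> is paired with \<phi> at
    \<open>lam = \<i> * of_real \<kappa>\<close>. Since \<open>hw\<close> is integrable, its kernel
    integrals tend to 0 as \<kappa> grows.\<close>
  have key: "\<forall>\<^sub>F \<kappa> in at_top. cmod (\<phi> f + of_real \<kappa> * (\<i> * a)) \<le> K' * K * e" if e: "e > 0" for e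
  proof -
    have "\<forall>\<^sub>F \<kappa> in at_top. \<forall>k<n. \<forall>x\<in>{0..l}. integral {0..l} (\<lambda>t. kern \<kappa> k x t * cmod (hw k t)) \<le> e"
      using absolutely_integrable_norm[OF hw] e by (intro kern_int_small) (auto simp: o_def)
    with est char_det_nonzero[OF regs(1)] show ?thesis
    proof eventually_elim
      case (elim \<kappa>)
      define lam where "lam = \<i> * of_real \<kappa>"
      have lam: "Im lam = \<kappa>" by (simp add: lam_def)
      have nz: "char_det lam \<noteq> 0" using elim(2) lam by blast
      define w where "w = (\<lambda>k x. - f k x + (- lam) * resolvent f lam k x)"
      \<comment> \<open>\<open>- f\<close> counts as a solution of the system at \<open>lam\<close>,
        with the forcing that compensates for whatever the equation leaves over.\<close>
      have mf: "lin_sys l n (A lam) (\<lambda>k t. - f' k t + (\<Sum>j<n. A lam k j t * f j t)) (\<lambda>k t. - f k t)"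
        unfolding lin_sys_def
      proof (intro allI impI)
        fix k assume k: "k < n"
        show "ac l (\<lambda>t. - f k t) (\<lambda>t. (\<Sum>j<n. A lam k j t * - f j t)
            + (- f' k t + (\<Sum>j<n. A lam k j t * f j t)))"
          by (rule ac_deriv_cong[OF ac_minus[OF f'[OF k]]]) (simp add: sum_negf)
      qed
      have w: "lin_sys l n (A lam) hw w"
        unfolding w_def
        by (rule lin_sys_cong[OF lin_sys_add_scaled[OF mf resolvent_lin_sys[OF fc nz], of "- lam"]])
          (simp, simp only: A_sum, simp add: hw_def src_def algebra_simps)
      have mfc: "cont_comps l n (\<lambda>k t. - f k t)" by (rule lin_sys_cont_comps[OF mf])
      have Rc: "cont_comps l n (resolvent f lam)"
        by (rule lin_sys_cont_comps[OF resolvent_lin_sys[OF fc nz]])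
      have Uw: "U i w = 0" if "i < n" for i
      proof -
        have "U i w = U i (\<lambda>k t. - f k t) + (- lam) * U i (resolvent f lam)"
          unfolding w_def by (rule sup_functional_add_scaled[OF sup_functional_U mfc Rc])
        moreover have "U i (\<lambda>k t. - f k t) = 0" unfolding U_def using f by (simp add: testfun_def)
        ultimately show ?thesis using U_resolvent[OF fc that] by simp
      qed
      have "Gbound \<kappa> hw e" using elim(3) e by (simp add: Gbound_def)
      then have "\<forall>x\<in>{0..l}. (\<Sum>k<n. cmod (w k x)) \<le> K * ((\<Sum>i<n. cmod (U i w)) + e)"
        using elim(1)[unfolded apriori_def, rule_format, OF lam w] hw by blast
      then have s: "(\<Sum>k<n. cmod (w k x)) \<le> K * e" if "0 \<le> x" "x \<le> l" for x using that Uw by simp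
      have "cmod (w k x) \<le> K * e" if "k < n" "0 \<le> x" "x \<le> l" for k x
        using member_le_sum[of k "{..<n}" "\<lambda>k. cmod (w k x)"] s[OF that(2,3)] that(1) by auto
      then have "cmod (\<phi> w) \<le> K' * (K * e)"
        using K e by (intro K'(2) lin_sys_cont_comps[OF w]) auto
      moreover have "\<phi> w = - (\<phi> f + of_real \<kappa> * (\<i> * a))"
      proof -
        have "\<phi> w = \<phi> (\<lambda>k t. - f k t) + (- lam) * \<phi> (resolvent f lam)"
          unfolding w_def by (rule sup_functional_add_scaled[OF \<phi> mfc Rc])
        moreover have "\<phi> (\<lambda>k t. - f k t) = - \<phi> f"
          using sup_functional_add_scaled[OF \<phi> cont_comps_zero fc, of "-1"] sup_functional_zero[OF \<phi>]
            by simp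
        moreover have "\<phi> (resolvent f lam) = a" using nz
          by (simp add: sup_functional_resolvent[OF \<phi> fc] a)
        ultimately show ?thesis by (simp add: lam_def)
      qed
      ultimately show ?case by (simp only: norm_minus_cancel mult.assoc)
    qed
  qed
  \<comment> \<open>Otherwise \<open>\<kappa> * cmod a\<close> would grow linearly, while
    \<open>key\<close> keeps it bounded.\<close>
  have a0: "a = 0"
  proof (rule ccontr)
    assume "a \<noteq> 0"
    then have an: "cmod a > 0" by simp
    from eventually_conj[OF key[of 1] eventually_gt_at_top[of "max 0 ((cmod (\<phi> f) + K' * K) / cmod a)"]]
    obtain \<kappa> where k: "cmod (\<phi> f + of_real \<kappa> * (\<i> * a)) \<le> K' * K
        * 1" "\<kappa> > 0" "\<kappa> > (cmod (\<phi> f) + K' * K) / cmod a"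
      by (auto simp: eventually_at_top_linorder)
    have "cmod (of_real \<kappa> * (\<i> * a)) \<le> cmod (\<phi> f + of_real \<kappa> * (\<i> * a)) + cmod (\<phi> f)"
      using norm_triangle_ineq4[of "\<phi> f + of_real \<kappa> * (\<i> * a)" "\<phi> f"] by simp
    then have "\<kappa> * cmod a \<le> K' * K + cmod (\<phi> f)" using k by (simp add: norm_mult)
    then show False using k(3) an by (simp add: field_simps)
  qed
  have "cmod (\<phi> f) \<le> 0 + e" if e: "e > 0" for e
  proof -
    \<comment> \<open>The summand 1 covers the case \<open>K' * K = 0\<close>.\<close>
    have "e / (K' * K + 1) > 0" using e K K'(1) by (simp add: add_nonneg_pos)
    from eventually_happens'[OF _ key[OF this]] a0 have "cmod (\<phi> f) \<le> K' * K * (e / (K' * K + 1))" by auto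
    also have "\<dots> = (K' * K) / (K' * K + 1) * e" by simp
    also have "\<dots> \<le> 1 * e" using e K K'(1)
      by (intro mult_right_mono) (auto simp: divide_le_eq add_nonneg_pos)
    finally show ?thesis by simp
  qed
  then have "cmod (\<phi> f) \<le> 0" by (rule field_le_epsilon)
  then show ?thesis by simp
qed

theorem complete_if_regular:
  assumes regs: "Determinant.det Smat \<noteq> 0" "Determinant.det neg.Smat \<noteq> 0"
  shows "roots_complete n l beta Q C D"
  unfolding roots_complete_def
proof (intro ballI allI impI, rule ccontr)
  fix f0 and \<epsilon> :: real
  assume f0: "f0 \<in> Hsp n l beta" and e: "\<epsilon> > 0"
  let ?R = "root_vectors n l beta Q C D"
  assume far: "\<not> (\<exists>(N::nat) (c::nat \<Rightarrow> complex) v. (\<forall>j<N. v j \<in> ?R) \<and>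
      hnorm n l beta (\<lambda>k x. f0 k x - (\<Sum>j<N. c j * v j k x)) < \<epsilon>)"
  \<comment> \<open>The linear span of the root vectors; \<open>far\<close> says that it keeps the
    distance \<epsilon> from \<open>f0\<close>.\<close>
  define S where "S = {u. \<exists>(N::nat) (c::nat \<Rightarrow> complex) v. (\<forall>j<N. v j \<in> ?R) \<and> u
      = (\<lambda>k x. \<Sum>j<N. c j * v j k x)}"
  have S_iff: "s \<in> S \<longleftrightarrow> (\<exists>(N::nat) (c::nat \<Rightarrow> complex) v. (\<forall>j<N. v j \<in> ?R) \<and> s
      = (\<lambda>k x. \<Sum>j<N. c j * v j k x))" for s
    unfolding S_def by (rule mem_Collect_eq)
  have RH: "?R \<subseteq> Hsp n l beta" by (auto simp: root_vectors_def)
  have SH: "S \<subseteq> Hsp n l beta"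
  proof
    fix u assume "u \<in> S"
    then obtain N :: nat and c :: "nat \<Rightarrow> complex" and v
      where v: "\<forall>j<N. v j \<in> ?R" "u = (\<lambda>k x. \<Sum>j<N. c j * v j k x)"
      unfolding S_iff by (elim exE conjE)
    have "(\<lambda>k x. \<Sum>j<N. c j * v j k x) \<in> Hsp n l beta" using v(1)
    proof (induction N)
      case 0
      show ?case using cont_comps_Hsp[OF cont_comps_zero] by simp
    next
      case (Suc N)
      have "addsc (c N) (\<lambda>k x. \<Sum>j<N. c j * v j k x) (v N) \<in> Hsp n l beta"
        using Suc RH by (intro Hsp_addsc) auto
      then show ?case by (simp add: addsc_def)
    qed
    then show "u \<in> Hsp n l beta" using v(2) by simp
  qed
  have Sne: "S \<noteq> {}" unfolding S_def by (auto intro!: exI[of _ "0::nat"])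
  have Scl: "addsc a u w \<in> S" if "u \<in> S" "w \<in> S" for a u w
  proof -
    obtain N1 :: nat and c1 :: "nat \<Rightarrow> complex" and v1
      where 1: "\<forall>j<N1. v1 j \<in> ?R" "u = (\<lambda>k x. \<Sum>j<N1. c1 j * v1 j k x)"
      using \<open>u \<in> S\<close> unfolding S_iff by (elim exE conjE)
    obtain N2 :: nat and c2 :: "nat \<Rightarrow> complex" and v2
      where 2: "\<forall>j<N2. v2 j \<in> ?R" "w = (\<lambda>k x. \<Sum>j<N2. c2 j * v2 j k x)"
      using \<open>w \<in> S\<close> unfolding S_iff by (elim exE conjE)
    \<comment> \<open>Two linear combinations are concatenated, the second one shifted by
      \<open>N1\<close>.\<close>
    define c where "c j = (if j < N1 then c1 j else a * c2 (j - N1))" for j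
    define v where "v j = (if j < N1 then v1 j else v2 (j - N1))" for j
    have split: "(\<Sum>j<N1 + M. g j) = (\<Sum>j<N1. g j) + (\<Sum>j<M. g (N1 + j))" for M and g :: "nat \<Rightarrow> complex"
      by (induction M) auto
    have "addsc a u w = (\<lambda>k x. \<Sum>j<N1 + N2. c j * v j k x)"
      unfolding split addsc_def 1(2) 2(2)
        by (intro ext) (simp add: c_def v_def sum_distrib_left mult.assoc)
    moreover have "\<forall>j<N1 + N2. v j \<in> ?R" using 1(1) 2(1) by (auto simp: v_def)
    ultimately show ?thesis unfolding S_iff by (intro exI conjI)
  qed
  have Sfar: "hnorm n l beta (addsc (-1) f0 s) \<ge> \<epsilon>" if sS: "s \<in> S" for s
  proof -
    obtain N :: nat and c :: "nat \<Rightarrow> complex" and v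
      where v: "\<forall>j<N. v j \<in> ?R" "s = (\<lambda>k x. \<Sum>j<N. c j * v j k x)"
      using sS unfolding S_iff by (elim exE conjE)
    have "\<not> hnorm n l beta (\<lambda>k x. f0 k x - (\<Sum>j<N. c j * v j k x)) < \<epsilon>" using far v(1) by blast
    then show ?thesis by (simp add: addsc_def v(2))
  qed
  have "\<exists>\<phi>. (\<forall>u\<in>Hsp n l beta. \<forall>v\<in>Hsp n l beta. \<forall>c. \<phi> (addsc c u v) = \<phi> u + c * \<phi> v) \<and>
      (\<exists>K\<ge>0. \<forall>u\<in>Hsp n l beta. cmod (\<phi> u) \<le> K * hnorm n l beta u) \<and> (\<forall>s\<in>S. \<phi> s = 0) \<and> \<phi> f0 \<noteq> (0::complex)"
  proof (rule Hil.separating_functional[OF f0 SH Sne Scl e Sfar])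
    show "addsc c (addsc (-1) f0 u) v = addsc (-1) f0 (addsc (-c) u v)" for c u v
      by (auto simp: addsc_def fun_eq_iff algebra_simps)
    show "Hip n l beta w (addsc (-1) f0 u) - Hip n l beta w (addsc (-1) f0 v)
        = Hip n l beta w (addsc (-1) v u)"
      if "u \<in> Hsp n l beta" "v \<in> Hsp n l beta" "w \<in> Hsp n l beta" for u v w
      using that f0 by (simp add: Hil.ip_asc_right)
  qed
  then obtain \<phi> :: "(nat \<Rightarrow> real \<Rightarrow> complex) \<Rightarrow> complex" and K where
    lin: "\<And>u v c. u \<in> Hsp n l beta \<Longrightarrow> v \<in> Hsp n l beta \<Longrightarrow> \<phi> (addsc c u v) = \<phi> u + c * \<phi> v"
    and K: "K \<ge> 0" "\<And>u. u \<in> Hsp n l beta \<Longrightarrow> cmod (\<phi> u) \<le> K * hnorm n l beta u"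
    and \<phi>S: "\<And>s. s \<in> S \<Longrightarrow> \<phi> s = 0" and \<phi>f0: "\<phi> f0 \<noteq> 0" by blast
  \<comment> \<open>The functional is bounded in the norm of the space; on continuous functions the
    integrable weights turn this into a bound in the uniform norm.\<close>
  have sup_functional: "sup_functional l n \<phi>"
    unfolding sup_functional_def
  proof (intro conjI allI impI)
    fix u v c assume "cont_comps l n u" "cont_comps l n v"
    then show "\<phi> (\<lambda>k x. u k x + c * v k x) = \<phi> u + c * \<phi> v" using lin[OF cont_comps_Hsp cont_comps_Hsp]
      by (simp add: addsc_def)
  next
    define b where "b = sqrt (\<Sum>k<n. integral\<^sup>L (lebesgue_on {0..l}) (\<lambda>x. \<bar>beta k x\<bar>))"
    have b0: "b \<ge> 0" unfolding b_def by (intro real_sqrt_ge_zero sum_nonneg) simp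
    show "\<exists>K\<ge>0. \<forall>u B. cont_comps l n u \<longrightarrow> 0 \<le> B \<longrightarrow> (\<forall>k<n. \<forall>x\<in>{0..l}. cmod (u k x) \<le> B) \<longrightarrow> cmod (\<phi> u) \<le> K * B"
    proof (intro exI[of _ "K * b"] conjI allI impI)
      fix u B assume u: "cont_comps l n u" and B: "0 \<le> B" "\<forall>k<n. \<forall>x\<in>{0..l}. cmod (u k x) \<le> B"
      have "hnorm n l beta u \<le> b * B" unfolding b_def
        by (rule cont_comps_hnorm_le[OF u B(1)]) (use B(2) in auto)
      then have "K * hnorm n l beta u \<le> K * (b * B)" using K(1) by (rule mult_left_mono)
      then show "cmod (\<phi> u) \<le> K * b * B" using K(2)[OF cont_comps_Hsp[OF u]] by simp
    qed (use K(1) b0 in simp)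
  qed
  have roots: "\<phi> u = 0" if "cont_comps l n u" "root_of n l beta Q C D lam m u" for u lam m
  proof (rule \<phi>S)
    have "u \<in> ?R" using that cont_comps_Hsp unfolding root_vectors_def by blast
    then show "u \<in> S" unfolding S_def
      by (auto intro!: exI[of _ "1::nat"] exI[of _ "\<lambda>_. 1::complex"] exI[of _ "\<lambda>_. u"])
  qed
  have "cmod (\<phi> f0) \<le> 0 + d" if d: "d > 0" for d
  proof -
    have "d / (K + 1) > 0" using d K(1) by simp
    then obtain p where p: "testfun p" "hnorm n l beta (addsc (-1) f0 p) < d / (K + 1)"
      using testfun_dense[OF f0] by blast
    have pH: "p \<in> Hsp n l beta" by (rule cont_comps_Hsp[OF testfun_cont_comps[OF p(1)]])
    have "\<phi> p = 0" using testfun_annihilated[OF regs sup_functional p(1)] roots by blast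
    then have "\<phi> (addsc (-1) f0 p) = \<phi> f0" using lin[OF f0 pH, of "-1"] by simp
    then have "cmod (\<phi> f0) \<le> K * hnorm n l beta (addsc (-1) f0 p)" using K(2)[OF Hsp_addsc[OF f0 pH]]
      by metis
    also have "\<dots> \<le> K * (d / (K + 1))" using p(2) K(1) by (intro mult_left_mono) auto
    also have "\<dots> \<le> d" using d K(1) by (simp add: field_simps)
    finally show ?thesis by simp
  qed
  then have "cmod (\<phi> f0) \<le> 0" by (rule field_le_epsilon)
  with \<phi>f0 show False by simp
qed

end

section \<open>The characteristic determinant and regularity\<close>

context boundary_problem
begin

text \<open>The integral equations of the fundamental matrix decouple into columns, and each column
  solves the initial value problem of one \<open>E j\<close>.\<close>

lemma fund_solves_iff:
  "fund_solves n l beta Q lam Phi \<longleftrightarrow>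
     (\<forall>j<n. lin_sys l n (A lam) (\<lambda>_ _. 0) (\<lambda>k x. Phi x k j)
         \<and> (\<forall>k<n. Phi 0 k j = (if k = j then 1 else 0)))"
proof -
  let ?g = "\<lambda>k j t. \<i> * lam * of_real (beta k t) * Phi t k j - (\<Sum>m<n. Q k m t * Phi t m j)"
  have one: "(integrable (lebesgue_on {0..l}) (?g k j) \<and>
      (\<forall>x\<in>{0..l}. Phi x k j = (if k = j then 1 else 0) + integral\<^sup>L (lebesgue_on {0..x}) (?g k j)))
    \<longleftrightarrow> ac l (\<lambda>x. Phi x k j) (\<lambda>t. (\<Sum>m<n. A lam k m t * Phi t m j) + 0) \<and> Phi 0 k j
        = (if k = j then 1 else 0)"
    (is "?L \<longleftrightarrow> ?R") if k: "k < n" for k j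
  proof -
    have eq: "(\<lambda>t. (\<Sum>m<n. A lam k m t * Phi t m j) + 0) = ?g k j" by (simp add: A_sum[OF k])
    have int: "integral\<^sup>L (lebesgue_on {0..x}) (?g k j) = integral {0..x} (?g k j)"
      if "?g k j absolutely_integrable_on {0..l}" "0 \<le> x" "x \<le> l" for x
      using absint_subset[OF that(1), of 0 x] that by (intro absint_integral_eq) auto
    show ?thesis
    proof
      assume L: ?L
      then have absint: "?g k j absolutely_integrable_on {0..l}" by (simp add: lebesgue_on_absint_iff)
      have v: "Phi x k j = (if k = j then 1 else 0) + integral {0..x} (?g k j)" if "0 \<le> x" "x \<le> l" for x
        using L int[OF absint that] that by (simp only: atLeastAtMost_iff)
      have "ac l (\<lambda>x. Phi x k j) (?g k j)" by (rule acI[OF absint v])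
      moreover have "Phi 0 k j = (if k = j then 1 else 0)" using v[of 0] l_pos by simp
      ultimately show ?R unfolding eq by blast
    next
      assume ?R
      then have ac: "ac l (\<lambda>x. Phi x k j) (?g k j)" and i: "Phi 0 k j = (if k = j then 1 else 0)"
        unfolding eq by blast+
      show ?L
      proof (intro conjI ballI)
        show "integrable (lebesgue_on {0..l}) (?g k j)" using ac_absint[OF ac]
          by (simp only: lebesgue_on_absint_iff)
        fix x assume "x \<in> {0..l}"
        then show "Phi x k j = (if k = j then 1 else 0) + integral\<^sup>L (lebesgue_on {0..x}) (?g k j)"
          using int[OF ac_absint[OF ac], of x] ac_eq[OF ac, of x] i by (simp only: atLeastAtMost_iff)
      qed
    qed
  qed
  show ?thesis unfolding fund_solves_def lin_sys_def using one by blast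
qed

text \<open>A fundamental matrix is fixed only on the interval, but uniqueness for the initial value
  problem determines its value at \<open>l\<close>, so the definite description denotes.\<close>

lemma Phi_end_eq: "Phi_end n l beta Q lam = Matrix.mat n n (\<lambda>(k, j). E j lam k l)"
  unfolding Phi_end_def
proof (rule the_equality)
  have "fund_solves n l beta Q lam (\<lambda>x k j. E j lam k x)"
    unfolding fund_solves_iff by (auto simp: E_0 E_lin_sys)
  then show "Matrix.mat n n (\<lambda>(k, j). E j lam k l) \<in> carrier_mat n n \<and>
      (\<exists>Phi. fund_solves n l beta Q lam Phi \<and> (\<forall>i<n. \<forall>j<n. Matrix.mat n n (\<lambda>(k, j). E j lam k l) $$
          (i, j) = Phi l i j))"
    by (intro conjI exI[of _ "\<lambda>x k j. E j lam k x"]) auto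
next
  fix M assume M: "M \<in> carrier_mat n n \<and> (\<exists>Phi. fund_solves n l beta Q lam Phi
      \<and> (\<forall>i<n. \<forall>j<n. M $$ (i, j) = Phi l i j))"
  then obtain Phi where P: "fund_solves n l beta Q lam Phi" "\<And>i j. i < n \<Longrightarrow> j < n \<Longrightarrow> M $$ (i, j)
      = Phi l i j" by blast
  have "Phi l k j = E j lam k l" if "k < n" "j < n" for k j
  proof (rule ivp_unique[OF _ E_lin_sys])
    show "lin_sys l n (A lam) (\<lambda>_ _. 0) (\<lambda>k x. Phi x k j)" using P(1) that unfolding fund_solves_iff
      by blast
    show "Phi 0 k j = E j lam k 0" if "k < n" for k
      using P(1) \<open>j < n\<close> that E_0[OF that, of j lam] unfolding fund_solves_iff by metis
  qed (use that l_pos in auto)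
  then show "M = Matrix.mat n n (\<lambda>(k, j). E j lam k l)" using M P(2) by (intro eq_matI) auto
qed

lemma Delta_eq_char_det: "Delta n l beta Q C D lam = char_det lam"
proof -
  have "C + D * Phi_end n l beta Q lam = bc_mat lam"
  proof (rule eq_matI)
    fix i j assume "i < dim_row (bc_mat lam)" "j < dim_col (bc_mat lam)"
    then have ij: "i < n" "j < n" by (auto simp: bc_mat_def)
    have "(\<Sum>k<n. C $$ (i, k) * E j lam k 0) = C $$ (i, j)"
      using ij by (simp add: E_0 if_distrib[of "\<lambda>x. _ * x"] sum.delta cong: if_cong)
    then show "(C + D * Phi_end n l beta Q lam) $$ (i, j) = bc_mat lam $$ (i, j)"
      using ij C_car D_car
      by (simp add: Phi_end_eq bc_mat_def U_def sum.distrib scalar_prod_def lessThan_atLeast0)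
  qed (use C_car D_car in \<open>auto simp: bc_mat_def Phi_end_eq\<close>)
  then show ?thesis by (simp add: Delta_def char_det_def)
qed

end

context signed_problem
begin

interpretation neg: signed_problem n l "\<lambda>k x. - beta k x" Q C D by (rule signed_problem_neg)

lemma bk_eq: "k < n \<Longrightarrow> bk l beta k = rho k l"
  unfolding bk_def rho_def by (simp add: absint_integral_eq beta_absint)

lemma mult_Pplus: "C * Pplus n l beta = Matrix.mat n n (\<lambda>(i, j). if pos j then C $$ (i, j) else 0)"
  and mult_Pplus': "D * Pplus n l beta = Matrix.mat n n (\<lambda>(i, j). if pos j then D $$ (i, j) else 0)"
proof -
  have "X * Pplus n l beta = Matrix.mat n n (\<lambda>(i, j). if pos j then X $$ (i, j) else 0)"
    if "X \<in> carrier_mat n n" for X :: "complex mat"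
  proof (rule eq_matI)
    fix i j assume "i < dim_row (Matrix.mat n n (\<lambda>(i, j). if pos j then X $$ (i, j) else 0))"
      "j < dim_col (Matrix.mat n n (\<lambda>(i, j). if pos j then X $$ (i, j) else 0))"
    then have ij: "i < n" "j < n" by auto
    have "(X * Pplus n l beta) $$ (i, j) = (\<Sum>k<n. X $$ (i, k) * (if k = j \<and> pos k then 1 else 0))"
      using ij that by (simp add: Pplus_def scalar_prod_def lessThan_atLeast0 bk_eq pos_def)
    also have "\<dots> = (\<Sum>k<n. if k = j then (if pos j then X $$ (i, j) else 0) else 0)"
      by (intro sum.cong) auto
    also have "\<dots> = (if pos j then X $$ (i, j) else 0)" using ij by simp
    finally show "(X * Pplus n l beta) $$ (i, j) = Matrix.mat n n
        (\<lambda>(i, j). if pos j then X $$ (i, j) else 0) $$ (i, j)"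
      using ij by simp
  qed (use that in \<open>auto simp: Pplus_def\<close>)
  then show "C * Pplus n l beta = Matrix.mat n n (\<lambda>(i, j). if pos j then C $$ (i, j) else 0)"
    "D * Pplus n l beta = Matrix.mat n n (\<lambda>(i, j). if pos j then D $$ (i, j) else 0)"
    using C_car D_car by blast+
qed

lemma mult_Pminus: "C * Pminus n l beta = Matrix.mat n n (\<lambda>(i, j). if pos j then 0 else C $$ (i, j))"
  and mult_Pminus': "D * Pminus n l beta = Matrix.mat n n (\<lambda>(i, j). if pos j then 0 else D $$ (i, j))"
proof -
  have P: "Pplus n l beta \<in> carrier_mat n n" by (simp add: Pplus_def)
  have "X * Pminus n l beta = X - X * Pplus n l beta" if "X \<in> carrier_mat n n" for X :: "complex mat"
    unfolding Pminus_def using mult_minus_distrib_mat[OF that one_carrier_mat P] that by simp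
  note this[OF C_car] this[OF D_car]
  then show "C * Pminus n l beta = Matrix.mat n n (\<lambda>(i, j). if pos j then 0 else C $$ (i, j))"
    "D * Pminus n l beta = Matrix.mat n n (\<lambda>(i, j). if pos j then 0 else D $$ (i, j))"
    using C_car D_car by (auto simp: mult_Pplus mult_Pplus' intro!: eq_matI)
qed

lemma Smat_eq: "Smat = C * Pplus n l beta + D * Pminus n l beta"
  unfolding mult_Pplus mult_Pminus' Smat_def by (intro eq_matI) auto

lemma neg_Smat_eq: "neg.Smat = C * Pminus n l beta + D * Pplus n l beta"
  unfolding mult_Pplus' mult_Pminus neg.Smat_def by (intro eq_matI) (auto simp: neg_pos)

text \<open>The two determinants in the regularity condition belong to the problem and to its
  reflection, one for each half plane.\<close>

lemma regular_dets:
  assumes "regular_bc n l beta C D"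
  shows "Determinant.det Smat \<noteq> 0" "Determinant.det neg.Smat \<noteq> 0"
  using assms unfolding regular_bc_def Smat_eq neg_Smat_eq by auto

lemma regular_complete: "regular_bc n l beta C D \<Longrightarrow> roots_complete n l beta Q C D"
  using complete_if_regular regular_dets by blast

lemma bminus_eq: "bminus n l beta = (\<Sum>k | k < n \<and> \<not> pos k. rho k l)"
proof -
  have "{k. k < n \<and> bk l beta k < 0} = {k. k < n \<and> \<not> pos k}"
    by (auto simp: bk_eq pos_def not_less le_less dest: rho_l_neq_0)
  then show ?thesis unfolding bminus_def by (auto simp: bk_eq intro: sum.cong)
qed

lemma bplus_eq: "bplus n l beta = - (\<Sum>k | k < n \<and> \<not> neg.pos k. neg.rho k l)"
proof -
  have "{k. k < n \<and> bk l beta k > 0} = {k. k < n \<and> \<not> neg.pos k}"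
    by (auto simp: bk_eq pos_def neg_pos)
  then show ?thesis unfolding bplus_def by (auto simp: bk_eq neg_rho sum_negf intro: sum.cong)
qed

text \<open>For \<open>Im lam \<ge> 0\<close> the exponential with \<open>bminus\<close> dominates
  because \<open>bminus \<le> 0 \<le> bplus\<close>; below the real axis it is the other one,
  bounded through the reflected problem. The sum is at most twice the dominant term.\<close>

lemma Delta_lower:
  assumes reg: "regular_bc n l beta C D"
  shows "\<exists>c>0. \<exists>\<kappa>0>0. \<forall>lam. \<bar>Im lam\<bar> \<ge> \<kappa>0 \<longrightarrow>
    cmod (Delta n l beta Q C D lam) \<ge> c * (exp (- Im lam * bminus n l beta)
        + exp (- Im lam * bplus n l beta))"
proof -
  have bm: "bminus n l beta \<le> 0" unfolding bminus_def by (intro sum_nonpos) auto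
  have bp: "bplus n l beta \<ge> 0" unfolding bplus_def by (intro sum_nonneg) auto
  obtain c1 where c1: "c1 > 0" "\<forall>\<^sub>F \<kappa> in at_top. \<forall>lam. Im lam = \<kappa> \<longrightarrow> c1 * exp (- \<kappa> * bminus n l beta)
      \<le> cmod (char_det lam)"
    using char_det_lower[OF regular_dets(1)[OF reg]] unfolding bminus_eq by blast
  obtain c2 where c2: "c2 > 0" "\<forall>\<^sub>F \<kappa> in at_top. \<forall>lam. Im lam = \<kappa> \<longrightarrow> c2 * exp (- \<kappa> * - bplus n l beta)
      \<le> cmod (neg.char_det lam)"
    using neg.char_det_lower[OF regular_dets(2)[OF reg]] unfolding bplus_eq minus_minus by blast
  from eventually_conj[OF c1(2) c2(2)] obtain k0 where k0: "\<And>\<kappa>. \<kappa> \<ge> k0 \<Longrightarrow>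
    (\<forall>lam. Im lam = \<kappa> \<longrightarrow> c1 * exp (- \<kappa> * bminus n l beta) \<le> cmod (char_det lam)) \<and>
    (\<forall>lam. Im lam = \<kappa> \<longrightarrow> c2 * exp (- \<kappa> * - bplus n l beta) \<le> cmod (neg.char_det lam))"
    unfolding eventually_at_top_linorder by blast
  \<comment> \<open>The minimum serves both half planes, and the factor 1/2 pays for the second
    exponential.\<close>
  define c where "c = min c1 c2 / 2"
  have c: "c > 0" "2 * c \<le> c1" "2 * c \<le> c2" using c1 c2 by (auto simp: c_def)
  show ?thesis
  proof (rule exI[of _ c], rule conjI, rule c(1), rule exI[of _ "max k0 1"], intro conjI allI impI)
    fix lam assume lam: "max k0 1 \<le> \<bar>Im lam\<bar>"
    let ?em = "exp (- Im lam * bminus n l beta)" and ?ep = "exp (- Im lam * bplus n l beta)"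
    show "c * (?em + ?ep) \<le> cmod (Delta n l beta Q C D lam)"
    proof (cases "Im lam \<ge> 0")
      case True
      have "- Im lam * bplus n l beta \<le> - Im lam * bminus n l beta"
        using True bm bp by (intro mult_left_mono_neg) auto
      then have "c * (?em + ?ep) \<le> c * (2 * ?em)" using c by (intro mult_left_mono) auto
      also have "\<dots> = (2 * c) * ?em" by simp
      also have "\<dots> \<le> c1 * ?em" using c by (intro mult_right_mono) auto
      also have "\<dots> \<le> cmod (char_det lam)" using k0[of "Im lam"] True lam by auto
      finally show ?thesis by (simp add: Delta_eq_char_det)
    next
      case False
      have "- Im lam * bminus n l beta \<le> - Im lam * bplus n l beta"
        using False bm bp by (intro mult_left_mono) auto
      then have "c * (?em + ?ep) \<le> c * (2 * ?ep)" using c by (intro mult_left_mono) auto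
      also have "\<dots> = (2 * c) * ?ep" by simp
      also have "\<dots> \<le> c2 * ?ep" using c by (intro mult_right_mono) auto
      also have "\<dots> \<le> cmod (neg.char_det (- lam))" using k0[of "- Im lam"] False lam by auto
      finally show ?thesis by (simp add: Delta_eq_char_det neg_char_det)
    qed
  qed simp
qed

end

section \<open>Rays off the real axis\<close>

lemma zero_in_triangle: "0 \<in> interior (convex hull {\<i>, -1 - \<i>, 1 - \<i>})"
proof -
  have "\<not> collinear {\<i>, -1 - \<i>, 1 - \<i>}"
  proof
    assume "collinear {\<i>, -1 - \<i>, 1 - \<i>}"
    then obtain u where u: "\<forall>x\<in>{\<i>, -1 - \<i>, 1 - \<i>}. \<forall>y\<in>{\<i>, -1 - \<i>, 1 - \<i>}. \<exists>c. x - y = c *\<^sub>R u"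
      unfolding collinear_def by blast
    obtain c d where c: "\<i> - (1 - \<i>) = c *\<^sub>R u" and d: "(1 - \<i>) - (-1 - \<i>) = d *\<^sub>R u" using u by blast
    have "d * Im u = 0" "d * Re u = 2" "c * Im u = 2"
      using arg_cong[OF c, of Im] arg_cong[OF d, of Re] arg_cong[OF d, of Im] by auto
    then show False by auto
  qed
  then have "interior (convex hull {\<i>, -1 - \<i>, 1 - \<i>}) =
     {v. \<exists>x y z. 0 < x \<and> 0 < y \<and> 0 < z \<and> x + y + z = 1 \<and> x *\<^sub>R \<i> + y *\<^sub>R (-1 - \<i>) + z *\<^sub>R (1 - \<i>) = v}"
    by (intro interior_convex_hull_3_minimal) auto
  \<comment> \<open>The barycentric coordinates of the origin.\<close>
  moreover have "(1/2) *\<^sub>R \<i> + (1/4) *\<^sub>R (-1 - \<i>) + (1/4) *\<^sub>R (1 - \<i>) = 0" by (simp add: complex_eq_iff)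
  ultimately show ?thesis
    by (simp only: mem_Collect_eq) (rule exI[of _ "1/2"], rule exI[of _ "1/4"], rule exI[of _ "1/4"],
        simp)
qed

text \<open>Along a ray \<open>Im lam\<close> is a fixed multiple of \<open>cmod lam\<close>, so the
  ratio found at \<open>z\<close> holds on the whole ray. The factor 2 exceeds the ratio 1 at
  \<open>\<i>\<close> and the ratio \<open>sqrt 2\<close> at the two other vertices to which this is
  applied.\<close>

lemma Im_lower_if_Arg_eq:
  assumes "Arg lam = Arg z" "lam \<noteq> 0" "z \<noteq> 0" "cmod z \<le> 2 * \<bar>Im z\<bar>"
  shows "cmod lam \<le> 2 * \<bar>Im lam\<bar>"
proof -
  have "lam = of_real (cmod lam) * exp (\<i> * of_real (Arg z))" using Arg_eq[OF assms(2)] assms(1) by simp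
  moreover have "z = of_real (cmod z) * exp (\<i> * of_real (Arg z))" using Arg_eq[OF assms(3)] .
  ultimately have "of_real (cmod z) * lam = of_real (cmod lam) * z" by (metis mult.left_commute)
  from arg_cong[OF this, of Im] have "cmod z * Im lam = cmod lam * Im z" by simp
  then have "cmod z * \<bar>Im lam\<bar> = cmod lam * \<bar>Im z\<bar>" by (metis abs_mult abs_norm_cancel)
  moreover have "cmod lam * cmod z \<le> cmod lam * (2 * \<bar>Im z\<bar>)" using assms(4)
    by (intro mult_left_mono) auto
  ultimately have "cmod z * cmod lam \<le> cmod z * (2 * \<bar>Im lam\<bar>)"
    by (simp add: mult.commute mult.left_commute)
  then show ?thesis using assms(3) by simp
qed

theorem theorem7p4:
  fixes n :: nat and l :: real and beta :: "nat \<Rightarrow> real \<Rightarrow> real"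
    and C D :: "complex mat"
  assumes l_pos: "l > 0"
    and beta_L1: "\<forall>k<n. integrable (lebesgue_on {0..l}) (beta k)"
    and beta_sign: "\<forall>k<n. (AE x in lebesgue_on {0..l}. beta k x > 0) \<or>
                          (AE x in lebesgue_on {0..l}. beta k x < 0)"
    and CD_dims: "C \<in> carrier_mat n n" "D \<in> carrier_mat n n"
    and CD_rank: "vec_space.rank n (CD_mat n C D) = n"
    and regular: "regular_bc n l beta C D"
  shows "roots_complete n l beta (\<lambda>_ _ _. 0) C D \<and>
    (\<forall>(Q :: nat \<Rightarrow> nat \<Rightarrow> real \<Rightarrow> complex) (nm :: nat) (\<theta> :: real).
       (\<forall>k<n. \<exists>c. AE x in lebesgue_on {0..l}. \<bar>beta k x\<bar> \<le> c \<and> \<bar>1 / beta k x\<bar> \<le> c) \<and>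
       nm \<le> n \<and>
       (\<forall>k<nm. AE x in lebesgue_on {0..l}. beta k x < 0) \<and>
       (\<forall>k. nm \<le> k \<and> k < n \<longrightarrow> (AE x in lebesgue_on {0..l}. beta k x > 0)) \<and>
       (\<forall>k. k + 1 < n \<longrightarrow> (AE x in lebesgue_on {0..l}. beta k x \<le> beta (k + 1) x)) \<and>
       \<theta> > 0 \<and>
       (\<forall>k. k + 1 < n \<longrightarrow>
          (AE x in lebesgue_on {0..l}. beta k x = beta (k + 1) x) \<or>
          (AE x in lebesgue_on {0..l}. beta k x + \<theta> < beta (k + 1) x)) \<and>
       (\<forall>i<n. \<forall>j<n. integrable (lebesgue_on {0..l}) (Q i j))
     \<longrightarrow>
       (\<exists>C0 M (z1::complex) z2 z3. C0 > 0 \<and> M > 0 \<and>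
          z1 \<notin> \<real> \<and> z2 \<notin> \<real> \<and> z3 \<notin> \<real> \<and>
          0 \<in> interior (convex hull {z1, z2, z3}) \<and>
          (\<forall>lam. cmod lam > M \<and> (Arg lam = Arg z1 \<or> Arg lam = Arg z2 \<or> Arg lam = Arg z3) \<longrightarrow>
             cmod (Delta n l beta Q C D lam) \<ge>
               C0 * (exp (- Im lam * bminus n l beta) + exp (- Im lam * bplus n l beta)))) \<and>
       roots_complete n l beta Q C D)"
proof -
  have signed_problem: "signed_problem n l beta Q C D"
    if "\<forall>i<n. \<forall>j<n. integrable (lebesgue_on {0..l}) (Q i j)" for Q :: "nat \<Rightarrow> nat \<Rightarrow> real \<Rightarrow> complex"
    using that assms by unfold_locales (auto simp flip: lebesgue_on_absint_iff)
  have zero: "roots_complete n l beta (\<lambda>_ _ _. 0) C D"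
    by (rule signed_problem.regular_complete[OF signed_problem regular]) simp
  have general: "(\<exists>C0 M (z1::complex) z2 z3. C0 > 0 \<and> M > 0 \<and>
          z1 \<notin> \<real> \<and> z2 \<notin> \<real> \<and> z3 \<notin> \<real> \<and>
          0 \<in> interior (convex hull {z1, z2, z3}) \<and>
          (\<forall>lam. cmod lam > M \<and> (Arg lam = Arg z1 \<or> Arg lam = Arg z2 \<or> Arg lam = Arg z3) \<longrightarrow>
             cmod (Delta n l beta Q C D lam) \<ge>
               C0 * (exp (- Im lam * bminus n l beta) + exp (- Im lam * bplus n l beta)))) \<and>
       roots_complete n l beta Q C D"
    if Q: "\<forall>i<n. \<forall>j<n. integrable (lebesgue_on {0..l}) (Q i j)" for Q :: "nat \<Rightarrow> nat \<Rightarrow> real \<Rightarrow> complex"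
  proof
    show "roots_complete n l beta Q C D" by (rule signed_problem.regular_complete[OF signed_problem[OF Q] regular])
    obtain c \<kappa>0 where c: "c > 0" "\<kappa>0 > 0" "\<And>lam. \<bar>Im lam\<bar> \<ge> \<kappa>0 \<Longrightarrow>
      cmod (Delta n l beta Q C D lam) \<ge> c * (exp (- Im lam * bminus n l beta) + exp (- Im lam * bplus n l beta))"
      using signed_problem.Delta_lower[OF signed_problem[OF Q] regular] by blast
    have sqrt2: "sqrt 2 \<le> 2" by (rule real_le_lsqrt) auto
    show "\<exists>C0 M (z1::complex) z2 z3. C0 > 0 \<and> M > 0 \<and>
          z1 \<notin> \<real> \<and> z2 \<notin> \<real> \<and> z3 \<notin> \<real> \<and>
          0 \<in> interior (convex hull {z1, z2, z3}) \<and>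
          (\<forall>lam. cmod lam > M \<and> (Arg lam = Arg z1 \<or> Arg lam = Arg z2 \<or> Arg lam = Arg z3) \<longrightarrow>
             cmod (Delta n l beta Q C D lam) \<ge>
               C0 * (exp (- Im lam * bminus n l beta) + exp (- Im lam * bplus n l beta)))"
    \<comment> \<open>The radius \<open>2 * \<kappa>0\<close> is chosen so that
      \<open>cmod lam \<le> 2 * \<bar>Im lam\<bar>\<close> yields
      \<open>\<kappa>0 \<le> \<bar>Im lam\<bar>\<close>.\<close>
    proof (rule exI[of _ c], rule exI[of _ "2 * \<kappa>0"], rule exI[of _ "\<i>"], rule exI[of _ "-1 - \<i>"],
        rule exI[of _ "1 - \<i>"], intro conjI allI impI)
      fix lam assume lam: "2 * \<kappa>0 < cmod lam \<and> (Arg lam = Arg \<i> \<or> Arg lam = Arg (-1 - \<i>) \<or> Arg lam = Arg (1 - \<i>))"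
      then have "lam \<noteq> 0" using c(2) by auto
      have "\<i> \<noteq> 0 \<and> cmod \<i> \<le> 2 * \<bar>Im \<i>\<bar>" "-1 - \<i> \<noteq> 0 \<and> cmod (-1 - \<i>) \<le> 2 * \<bar>Im (-1 - \<i>)\<bar>"
        "1 - \<i> \<noteq> 0 \<and> cmod (1 - \<i>) \<le> 2 * \<bar>Im (1 - \<i>)\<bar>"
        using sqrt2 by (simp_all add: cmod_def complex_eq_iff)
      then have "\<exists>z. Arg lam = Arg z \<and> z \<noteq> 0 \<and> cmod z \<le> 2 * \<bar>Im z\<bar>"
        using lam by blast
      then have "cmod lam \<le> 2 * \<bar>Im lam\<bar>" using Im_lower_if_Arg_eq \<open>lam \<noteq> 0\<close> by blast
      then show "c * (exp (- Im lam * bminus n l beta) + exp (- Im lam * bplus n l beta)) \<le> cmod (Delta n l beta Q C D lam)"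
        using lam by (intro c(3)) linarith
    qed (use c zero_in_triangle in \<open>auto simp: complex_is_Real_iff\<close>)
  qed
  show ?thesis
    by (rule conjI[OF zero], intro allI impI, rule general, elim conjE, assumption)
qed

end
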